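(* Let $s>s_1>\frac12$ and let $u\in L^2_s(\mathbb{R})$ be real-valued. For $\lambda>0$ let $m_1(\cdot,\lambda\pm0i)$, $m_e(\cdot,\lambda\pm0i)$ be the Jost solutions and set $$\Gamma(\lambda)=1+i\int_{\mathbb{R}}u(x)m_e(x,\lambda+0i)e^{-i\lambda x}\,dx,\quad \beta(\lambda)=i\int_{\mathbb{R}}u(x)m_1(x,\lambda+0i)e^{-i\lambda x}\,dx,$$ $$f(\lambda)=-\frac1{2\pi\lambda}\int_{\mathbb{R}}u(x)m_e(x,\lambda-0i)\,dx.$$ Then $\Gamma\in C^{1,\gamma}_{loc}(0,\infty)$ and $\beta,f\in C^{0,\gamma}_{loc}(0,\infty)$ for some $0<\gamma<1$, and for all $\lambda>0$: $$|\Gamma(\lambda)|=1,\qquad f(\lambda)=\frac{\overline{\beta(\lambda)}}{2\pi i\lambda},$$ $$|\beta(\lambda)|^2=2\,\mathrm{Im}\int_{\mathbb{R}}u(x)m_1(x,\lambda+0i)\,dx,\qquad \partial_\lambda\Gamma(\lambda)=\frac{|\beta(\lambda)|^2}{2\pi i\lambda}\Gamma(\lambda).$$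
   Context: Notation. $w(x)=1+|x|$; $L^p_s(\mathbb{R})=\{f: w^sf\in L^p(\mathbb{R})\}$ with norm $\|w^sf\|_p$. $\mathbb{R}^+=(0,\infty)$, $\mathbb{R}^-=(-\infty,0)$. Kernels: for $\lambda>0$, $\widetilde G_\lambda(x)=\frac1{2\pi}\int_{-\infty}^0\frac{e^{ix\xi}}{\xi-\lambda}\,d\xi$ and $G_{\lambda\pm0i}(x)=\pm ie^{i\lambda x}\chi_{\mathbb{R}^\pm}(x)-\widetilde G_\lambda(x)$. Jost solutions: $m_1(\cdot,\lambda\pm0i)$ and $m_e(\cdot,\lambda\pm0i)$ are the unique functions in $L^\infty_{-(s-s_1)}(\mathbb{R})$ solving $m_1(\cdot,\lambda\pm0i)=1+G_{\lambda\pm0i}*(u\,m_1(\cdot,\lambda\pm0i))$ and $m_e(\cdot,\lambda\pm0i)=e^{i\lambda x}+G_{\lambda\pm0i}*(u\,m_e(\cdot,\lambda\pm0i))$; for real-valued $u\in L^2_s(\mathbb{R})$ with $s>s_1>\frac12$ existence and uniqueness are known, and the solutions lie in $L^\infty(\mathbb{R})$. *)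

theory Defs
  imports "HOL-Analysis.Analysis"
begin

definition weight :: "real \<Rightarrow> real" where
  "weight x = 1 + \<bar>x\<bar>"

(* Elements of the weighted spaces are Lebesgue measurable representatives; equality in
   these spaces is equality almost everywhere. *)

definition weighted_L2 :: "real \<Rightarrow> (real \<Rightarrow> 'a::real_normed_vector) set" where
  "weighted_L2 s = {f. f \<in> borel_measurable lebesgue \<and>
     integrable lebesgue (\<lambda>x. (weight x powr s * norm (f x))\<^sup>2)}"

definition weighted_Linf :: "real \<Rightarrow> (real \<Rightarrow> 'a::real_normed_vector) set" where
  "weighted_Linf s = {f. f \<in> borel_measurable lebesgue \<and>
     (\<exists>C. AE x in lebesgue. weight x powr s * norm (f x) \<le> C)}"

(* The integrand decays only like 1/|xi|, so the integral converges conditionally for x \<noteq> 0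
   and is not a Lebesgue integral. The Henstock-Kurzweil integral over the half line covers the
   improper integral. At x = 0 it diverges, which only affects a null set. *)
definition G_tilde :: "real \<Rightarrow> real \<Rightarrow> complex" where
  "G_tilde l x =
     1 / (2 * of_real pi) * integral {..0} (\<lambda>\<xi>. exp (\<i> * of_real (x * \<xi>)) / of_real (\<xi> - l))"

(* The two boundary values l + 0i (Above) and l - 0i (Below) on the half line l > 0. *)
datatype side = Above | Below

fun G_kernel :: "side \<Rightarrow> real \<Rightarrow> real \<Rightarrow> complex" where
  "G_kernel Above l x = \<i> * exp (\<i> * of_real (l * x)) * indicator {0<..} x - G_tilde l x"
| "G_kernel Below l x = - \<i> * exp (\<i> * of_real (l * x)) * indicator {..<0} x - G_tilde l x"

definition convolution :: "(real \<Rightarrow> complex) \<Rightarrow> (real \<Rightarrow> complex) \<Rightarrow> real \<Rightarrow> complex" where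
  "convolution g h x = (LINT y|lebesgue. g (x - y) * h y)"

definition solves_jost_equation ::
  "real \<Rightarrow> (real \<Rightarrow> real) \<Rightarrow> side \<Rightarrow> real \<Rightarrow> (real \<Rightarrow> complex) \<Rightarrow> (real \<Rightarrow> complex) \<Rightarrow> bool" where
  "solves_jost_equation r u \<sigma> l h m \<longleftrightarrow>
     m \<in> weighted_Linf (- r) \<and>
     (AE x in lebesgue. m x = h x + convolution (G_kernel \<sigma> l) (\<lambda>y. of_real (u y) * m y) x)"

(* m is the unique solution, as an element of the weighted space, of m = h + G * (u m). *)
definition is_jost_solution ::
  "real \<Rightarrow> (real \<Rightarrow> real) \<Rightarrow> side \<Rightarrow> real \<Rightarrow> (real \<Rightarrow> complex) \<Rightarrow> (real \<Rightarrow> complex) \<Rightarrow> bool" where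
  "is_jost_solution r u \<sigma> l h m \<longleftrightarrow>
     solves_jost_equation r u \<sigma> l h m \<and>
     (\<forall>m'. solves_jost_equation r u \<sigma> l h m' \<longrightarrow> (AE x in lebesgue. m' x = m x))"

(* In the next three definitions, m1 \<sigma> l x and me \<sigma> l x stand for the values at x of the
   Jost solutions with spectral parameter l + 0i or l - 0i according to \<sigma>. *)

definition Gamma_coeff ::
  "(real \<Rightarrow> real) \<Rightarrow> (side \<Rightarrow> real \<Rightarrow> real \<Rightarrow> complex) \<Rightarrow> real \<Rightarrow> complex" where
  "Gamma_coeff u me l =
     1 + \<i> * (LINT x|lebesgue. of_real (u x) * me Above l x * exp (- \<i> * of_real (l * x)))"

definition beta_coeff ::
  "(real \<Rightarrow> real) \<Rightarrow> (side \<Rightarrow> real \<Rightarrow> real \<Rightarrow> complex) \<Rightarrow> real \<Rightarrow> complex" where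
  "beta_coeff u m1 l =
     \<i> * (LINT x|lebesgue. of_real (u x) * m1 Above l x * exp (- \<i> * of_real (l * x)))"

definition f_coeff ::
  "(real \<Rightarrow> real) \<Rightarrow> (side \<Rightarrow> real \<Rightarrow> real \<Rightarrow> complex) \<Rightarrow> real \<Rightarrow> complex" where
  "f_coeff u me l =
     - (1 / of_real (2 * pi * l)) * (LINT x|lebesgue. of_real (u x) * me Below l x)"

definition locally_holder :: "real \<Rightarrow> real set \<Rightarrow> (real \<Rightarrow> complex) \<Rightarrow> bool" where
  "locally_holder \<gamma> S g \<longleftrightarrow>
     (\<forall>K. compact K \<and> K \<subseteq> S \<longrightarrow>
        (\<exists>C. \<forall>x\<in>K. \<forall>y\<in>K. norm (g x - g y) \<le> C * \<bar>x - y\<bar> powr \<gamma>))"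

definition locally_C1_holder :: "real \<Rightarrow> real set \<Rightarrow> (real \<Rightarrow> complex) \<Rightarrow> bool" where
  "locally_C1_holder \<gamma> S g \<longleftrightarrow>
     (\<exists>g'. (\<forall>x\<in>S. (g has_vector_derivative g' x) (at x)) \<and> locally_holder \<gamma> S g')"

end

theory Submission
  imports Defs "HOL-Complex_Analysis.Great_Picard"
begin

text \<open>Multiply the Jost equations by \<open>exp (- i l x)\<close>. The conjugated kernel
  \<open>K\<^sub>l(x) = exp (- i l x) G\<^sub>l(x)\<close> is, up to a step function independent of \<open>l\<close>, the integral of
  \<open>exp (- i x t) / (2 \<pi> t)\<close> over \<open>t \<ge> l\<close>, so its derivative in \<open>l\<close> is the bounded function
  \<open>- exp (- i l x) / (2 \<pi> l)\<close>, and the operator \<open>T\<^sub>l : n \<mapsto> K\<^sub>l * (u n)\<close> is Lipschitz in \<open>l\<close>.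
  It is compact, and uniqueness of the Jost solutions is injectivity of \<open>1 - T\<^sub>l\<close>; hence
  \<open>1 - T\<^sub>l\<close> is bounded below, locally uniformly in \<open>l\<close>, which gives the regularity of the solutions.

  The kernels above and below the cut satisfy \<open>cnj (K\<^sup>-\<^sub>l(x)) = K\<^sup>+\<^sub>l(- x)\<close> and \<open>K\<^sup>+ - K\<^sup>- = i\<close>. As \<open>u\<close> is
  real, the first relation gives \<open>\<integral> u a cnj g = \<integral> u h cnj b\<close> whenever \<open>a = h + T\<^sup>+a\<close> and
  \<open>b = g + T\<^sup>-b\<close>; the second one expresses the solutions above the cut through those below.
  Together they give the algebraic identities. Applying the pairing with two different parameters
  \<open>l\<close> and \<open>k\<close> leaves the error term \<open>\<integral> u cnj b (T\<^sup>+\<^sub>l - T\<^sup>+\<^sub>k) a\<close>, whose linearization at \<open>l = k\<close> is a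
  product of two integrals and yields the differential equation for \<open>\<Gamma>\<close>.\<close>

section \<open>The oscillatory integral\<close>

text \<open>The kernels are not integrable: \<open>osc_int l\<close> has a logarithmic singularity
  at 0 and decays only like 1/|x|. It is square integrable, however, and its increments in l are
  bounded. This fixes the spaces. A solution may grow like \<open>weight x powr r\<close> with r = s
  - s1; its product with the potential then lies in L1 and in L2, because s1 > 1/2 makes the power
  -s1 of the weight square integrable, and the operator sends it to a bounded continuous function.
  The strict inequality s1 > 1/2 leaves a little weight over, with exponent \<gamma>. It pays for
  the increments of exp(-ixl), which are Hoelder continuous in l with exponent \<gamma> at the price
  of a factor of size |x|^\<gamma>; this is the origin of the Hoelder exponent in the theorem.
  \<Gamma> is differentiated without differentiating any solution: when a solution at l is paired
  with a fixed one at k, the increment falls on the operator alone, and the operator is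
  explicit.\<close>

text \<open>For \<open>x \<noteq> 0\<close>, \<open>osc_int l x\<close> is the conditionally convergent integral of \<open>exp (- i x t) / t\<close>
  over \<open>t \<ge> l\<close>, made absolutely convergent by one integration by parts. At \<open>x = 0\<close> it is the
  junk value \<open>0\<close>.\<close>

definition osc_tail :: "real \<Rightarrow> real \<Rightarrow> complex" where
  "osc_tail l x = (LINT t|lborel. indicator {l..} t *\<^sub>R (exp (- (\<i> * of_real (x * t))) / of_real (t\<^sup>2)))"

definition osc_int :: "real \<Rightarrow> real \<Rightarrow> complex" where
  "osc_int l x = (exp (- (\<i> * of_real (x * l))) / of_real l - osc_tail l x) / (\<i> * of_real x)"

lemma norm_exp_i_real [simp]:
  "norm (exp (\<i> * of_real t)) = 1" "norm (exp (- (\<i> * of_real t))) = 1"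
proof -
  show "norm (exp (\<i> * of_real t)) = 1" by simp
  have "- (\<i> * of_real t) = \<i> * of_real (- t)" by simp
  then show "norm (exp (- (\<i> * of_real t))) = 1"
    using norm_exp_i_times[of "-t"] by metis
qed

lemma nn_integral_inverse_square_atLeast:
  assumes "l > 0"
  shows "(\<integral>\<^sup>+t. ennreal (1 / t\<^sup>2) * indicator {l..} t \<partial>lborel) = ennreal (1 / l)"
proof -
  have "((\<lambda>t::real. - 1 / t) \<longlongrightarrow> 0) at_top"
    by (intro tendsto_divide_0[OF tendsto_const] filterlim_at_top_imp_at_infinity filterlim_ident)
  then have "(\<integral>\<^sup>+t. ennreal (1 / t\<^sup>2) * indicator {l..} t \<partial>lborel) = ennreal (0 - (- 1 / l))"
    using assms
    by (intro nn_integral_FTC_atLeast) (auto intro!: derivative_eq_intros simp: field_simps power2_eq_square)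
  then show ?thesis by simp
qed

lemma integrable_inverse_square_atLeast:
  assumes "l > 0"
  shows "integrable lborel (\<lambda>t::real. indicator {l..} t * (1 / t\<^sup>2))"
    and "(LINT t|lborel. indicator {l..} t * (1 / t\<^sup>2)) = 1 / l"
proof -
  have "(\<integral>\<^sup>+t. ennreal (indicator {l..} t * (1 / t\<^sup>2)) \<partial>lborel) = ennreal (1 / l)"
    by (subst nn_integral_inverse_square_atLeast[OF assms, symmetric])
      (auto intro!: nn_integral_cong simp: indicator_def)
  then have "has_bochner_integral lborel (\<lambda>t::real. indicator {l..} t * (1 / t\<^sup>2)) (1 / l)"
    using assms by (intro has_bochner_integral_nn_integral) auto
  then show "integrable lborel (\<lambda>t::real. indicator {l..} t * (1 / t\<^sup>2))"
    and "(LINT t|lborel. indicator {l..} t * (1 / t\<^sup>2)) = 1 / l"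
    by (auto simp: has_bochner_integral_iff)
qed

lemma integrable_osc_tail:
  assumes "l > 0"
  shows "integrable lborel (\<lambda>t. indicator {l..} t *\<^sub>R (exp (- (\<i> * of_real (x * t))) / of_real (t\<^sup>2) :: complex))"
  by (rule Bochner_Integration.integrable_bound[OF integrable_inverse_square_atLeast(1)[OF assms]])
    (auto simp: norm_divide norm_power)

lemma norm_osc_tail_le:
  assumes "l > 0"
  shows "norm (osc_tail l x) \<le> 1 / l"
proof -
  have "norm (osc_tail l x) \<le> (LINT t|lborel. indicator {l..} t * (1 / t\<^sup>2))"
    unfolding osc_tail_def
    by (rule Bochner_Integration.integral_norm_bound_integral[OF integrable_osc_tail[OF assms] integrable_inverse_square_atLeast(1)[OF assms]])
      (auto simp: norm_divide norm_power)
  then show ?thesis using integrable_inverse_square_atLeast(2)[OF assms] by simp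
qed

text \<open>The boundary term and the tail contribute 1/l each. At x = 0 both sides are 0 because
  division by 0 gives 0.\<close>

lemma norm_osc_int_le:
  assumes "l > 0"
  shows "norm (osc_int l x) \<le> 2 / (l * \<bar>x\<bar>)"
proof -
  have "norm (exp (- (\<i> * of_real (x * l))) / of_real l - osc_tail l x) \<le> 1 / l + 1 / l"
    using norm_osc_tail_le[OF assms, of x] assms
    by (intro order_trans[OF norm_triangle_ineq4] add_mono) (auto simp: norm_divide)
  then show ?thesis
    unfolding osc_int_def norm_divide norm_mult
    by (cases "x = 0") (auto simp: field_simps)
qed

lemma cnj_osc_int: "cnj (osc_int l x) = osc_int l (- x)"
proof -
  have "cnj (osc_tail l x) = osc_tail l (- x)"
    unfolding osc_tail_def
    by (subst Bochner_Integration.integral_cnj[symmetric], rule Bochner_Integration.integral_cong)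
     (auto simp: exp_cnj)
  then show ?thesis
    unfolding osc_int_def by (simp add: exp_cnj)
qed

lemma osc_tail_has_derivative:
  assumes "l > 0"
  shows "((\<lambda>l. osc_tail l x) has_vector_derivative - (exp (- (\<i> * of_real (x * l))) / of_real (l\<^sup>2))) (at l)"
proof -
  let ?f = "\<lambda>t. exp (- (\<i> * of_real (x * t))) / of_real (t\<^sup>2) :: complex"
  \<comment> \<open>A compact window around \<open>l\<close>: beyond \<open>b\<close> the integral
    does not depend on the lower limit, so the fundamental theorem of calculus on
    \<open>{a..b}\<close> suffices.\<close>
  define a b where "a = l / 2" and "b = 2 * l"
  have ab: "0 < a" "a < l" "l < b" using assms by (auto simp: a_def b_def)
  have cont: "continuous_on {a..b} ?f" using ab
    by (intro continuous_intros) auto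
  have split: "osc_tail k x = integral {k..b} ?f + osc_tail b x" if "k \<in> {a..b}" for k
  proof -
    have I: "set_integrable lborel {k..b} ?f"
      using borel_integrable_atLeastAtMost'[OF continuous_on_subset[OF cont, of "{k..b}"]] that by auto
    have "osc_tail k x = (LINT t|lborel. indicator {k..b} t *\<^sub>R ?f t + indicator {b..} t *\<^sub>R ?f t)"
      unfolding osc_tail_def
    proof (rule integral_cong_AE)
      show "AE t in lborel. indicator {k..} t *\<^sub>R ?f t = indicator {k..b} t *\<^sub>R ?f t + indicator {b..} t *\<^sub>R ?f t"
        using AE_lborel_singleton[of b] by eventually_elim (use that in \<open>auto simp: indicator_def\<close>)
    qed measurable
    also have "\<dots> = (LINT t|lborel. indicator {k..b} t *\<^sub>R ?f t) + osc_tail b x"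
      unfolding osc_tail_def
      by (rule Bochner_Integration.integral_add) (use I integrable_osc_tail[of b x] ab in \<open>auto simp: set_integrable_def\<close>)
    also have "(LINT t|lborel. indicator {k..b} t *\<^sub>R ?f t) = integral {k..b} ?f"
      using set_borel_integral_eq_integral(2)[OF I] by (simp add: set_lebesgue_integral_def)
    finally show ?thesis .
  qed
  have "((\<lambda>u. integral {u..b} ?f) has_vector_derivative - ?f l) (at l within {a..b})"
    by (rule integral_has_vector_derivative'[OF cont]) (use ab in auto)
  then have "((\<lambda>u. integral {u..b} ?f + osc_tail b x) has_vector_derivative - ?f l) (at l within {a..b})"
    by (auto intro!: derivative_eq_intros)
  then have "((\<lambda>l. osc_tail l x) has_vector_derivative - ?f l) (at l within {a..b})"
    by (rule has_vector_derivative_transform[rotated 2]) (use ab in simp, rule split)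
  then show ?thesis using at_within_Icc_at[of a l b] ab by simp
qed

text \<open>Differentiation undoes the integration by parts: the 1/l^2 from the boundary term
  cancels the one from the tail, and division by ix leaves minus the integrand at the lower
  limit.\<close>

lemma osc_int_has_derivative:
  assumes "l > 0" "x \<noteq> 0"
  shows "((\<lambda>l. osc_int l x) has_vector_derivative - (exp (- (\<i> * of_real (x * l))) / of_real l)) (at l)"
proof -
  define E :: complex where "E = exp (- (\<i> * of_real (x * l)))"
  have "((\<lambda>z. exp (- (\<i> * of_real x) * z) / z) has_field_derivative
      (exp (- (\<i> * of_real x) * of_real l) * (- (\<i> * of_real x)) * of_real l
        - exp (- (\<i> * of_real x) * of_real l) * 1) / (of_real l * of_real l)) (at (of_real l))"
    by (rule DERIV_divide) (use assms in \<open>auto intro!: derivative_eq_intros\<close>)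
  from has_vector_derivative_real_field[OF this]
  have e: "((\<lambda>l. exp (- (\<i> * of_real (x * l))) / of_real l) has_vector_derivative
      (E * (- (\<i> * of_real x)) * of_real l - E * 1) / (of_real l * of_real l)) (at l)"
    by (simp add: E_def mult.assoc)
  have eq: "((E * (- (\<i> * of_real x)) * of_real l - E * 1) / (of_real l * of_real l)
      - - (E / of_real (l\<^sup>2))) / (\<i> * of_real x) = - (E / of_real l)"
    using assms by (simp add: divide_simps power2_eq_square)
  show ?thesis
    using has_vector_derivative_divide[OF has_vector_derivative_diff[OF e
      osc_tail_has_derivative[OF assms(1), of x, folded E_def]], of "\<i> * of_real x", unfolded eq]
    unfolding osc_int_def E_def .
qed

text \<open>The substitution t = l - \<xi> turns the integrand into -exp(ilx) exp(-ixt)/t on t \<ge>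
  l. Accordingly \<open>F\<close> is an explicit antiderivative; it vanishes at minus infinity
  because \<open>osc_int\<close> decays in the spectral parameter, so the conditionally convergent
  integral equals \<open>F 0\<close>.\<close>

lemma G_tilde_eq:
  assumes "l > 0" "x \<noteq> 0"
  shows "G_tilde l x = - (exp (\<i> * of_real (l * x)) * osc_int l x / (2 * of_real pi))"
proof -
  define F where "F \<xi> = - (exp (\<i> * of_real (l * x)) * osc_int (l - \<xi>) x)" for \<xi>
  let ?f = "\<lambda>\<xi>. exp (\<i> * of_real (x * \<xi>)) / of_real (\<xi> - l) :: complex"
  have F: "(F has_vector_derivative ?f \<xi>) (at \<xi>)" if "\<xi> \<le> 0" for \<xi>
  proof -
    have "((\<lambda>\<xi>. l - \<xi>) has_vector_derivative -1) (at \<xi>)"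
      by (auto intro!: derivative_eq_intros)
    from vector_diff_chain_at[OF this osc_int_has_derivative[of "l - \<xi>" x]] assms that
    have "((\<lambda>\<xi>. osc_int (l - \<xi>) x) has_vector_derivative exp (- (\<i> * of_real (x * (l - \<xi>)))) / of_real (l - \<xi>)) (at \<xi>)"
      by (simp add: o_def)
    then have "(F has_vector_derivative - (exp (\<i> * of_real (l * x)) * (exp (- (\<i> * of_real (x * (l - \<xi>)))) / of_real (l - \<xi>)))) (at \<xi>)"
      unfolding F_def by (auto intro!: derivative_eq_intros)
    moreover have "exp (\<i> * of_real (l * x)) * exp (- (\<i> * of_real (x * (l - \<xi>)))) = exp (\<i> * of_real (x * \<xi>))"
      unfolding exp_add[symmetric] by (simp add: algebra_simps)
    then have "- (exp (\<i> * of_real (l * x)) * (exp (- (\<i> * of_real (x * (l - \<xi>)))) / of_real (l - \<xi>))) = ?f \<xi>"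
      using assms that by (simp add: field_simps)
    ultimately show ?thesis by metis
  qed
  have int: "(?f has_integral F 0 - F a) {a..0}" if "a \<le> 0" for a
    by (rule fundamental_theorem_of_calculus[OF that]) (use has_vector_derivative_at_within[OF F] in auto)
  have Fb: "norm (F \<xi>) \<le> 2 / ((l - \<xi>) * \<bar>x\<bar>)" if "\<xi> \<le> 0" for \<xi>
    using norm_osc_int_le[of "l - \<xi>" x] assms that by (simp add: F_def norm_mult)
  have "(?f has_integral F 0) {..0}"
    unfolding has_integral_alt'[of _ _ "{..0}"]
  proof (intro conjI allI impI)
    fix a b :: real
    have "?f integrable_on {..0} \<inter> cbox a b"
    proof (cases "a \<le> 0")
      case True
      then have "?f integrable_on {a..0}" using int by (auto simp: integrable_on_def)
      moreover have "{..0} \<inter> cbox a b = {a..min 0 b}" by auto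
      ultimately show ?thesis
        by (simp add: integrable_on_subinterval)
    next
      case False
      then have "{..0} \<inter> cbox a b = {}" by auto
      then show ?thesis by (simp only: integrable_on_empty)
    qed
    then show "(\<lambda>\<xi>. if \<xi> \<in> {..0} then ?f \<xi> else 0) integrable_on cbox a b"
      by (simp only: integrable_restrict_Int)
  next
    fix e :: real assume "e > 0"
    \<comment> \<open>For a left end \<open>a \<le> - B\<close> the bound \<open>Fb\<close> on
      \<open>F a\<close> drops below \<open>e\<close>; the summand 1 keeps \<open>B\<close>
      positive.\<close>
    define B where "B = 2 / (e * \<bar>x\<bar>) + 1"
    have "B > 0" using \<open>e > 0\<close> by (simp add: B_def add_nonneg_pos)
    moreover have "norm (integral (cbox a b) (\<lambda>\<xi>. if \<xi> \<in> {..0} then ?f \<xi> else 0) - F 0) < e"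
      if "ball 0 B \<subseteq> cbox a b" for a b
    proof -
      have ab: "a \<le> - B" "B \<le> b"
      proof -
        have "{-B<..<B} \<subseteq> {a..b}" using that by (simp add: ball_eq_greaterThanLessThan)
        then show "a \<le> - B" "B \<le> b" using \<open>B > 0\<close> by (auto simp: greaterThanLessThan_subseteq_atLeastAtMost_iff)
      qed
      have "integral (cbox a b) (\<lambda>\<xi>. if \<xi> \<in> {..0} then ?f \<xi> else 0) = integral ({..0} \<inter> cbox a b) ?f"
        by (rule integral_restrict_Int)
      also have "{..0} \<inter> cbox a b = {a..0}" using ab \<open>B > 0\<close> by auto
      also have "integral {a..0} ?f = F 0 - F a"
        using int[of a] ab \<open>B > 0\<close> by (auto intro: integral_unique)
      finally have "norm (integral (cbox a b) (\<lambda>\<xi>. if \<xi> \<in> {..0} then ?f \<xi> else 0) - F 0) = norm (F a)"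
        by simp
      also have "\<dots> \<le> 2 / ((l - a) * \<bar>x\<bar>)" using Fb ab \<open>B > 0\<close> by auto
      also have "\<dots> < e"
      proof -
        have "2 / (e * \<bar>x\<bar>) < l - a" using ab assms by (simp add: B_def)
        then show ?thesis using assms \<open>e > 0\<close> ab \<open>B > 0\<close> by (simp add: field_simps)
      qed
      finally show ?thesis .
    qed
    ultimately show "\<exists>B>0. \<forall>a b. ball 0 B \<subseteq> cbox a b \<longrightarrow>
            norm (integral (cbox a b) (\<lambda>\<xi>. if \<xi> \<in> {..0} then ?f \<xi> else 0) - F 0) < e" by blast
  qed
  then have "integral {..0} ?f = F 0" by (rule integral_unique)
  then show ?thesis unfolding G_tilde_def F_def by simp
qed

section \<open>Continuity, logarithmic singularity and square integrability in the space
  variable\<close>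

lemma continuous_osc_tail:
  assumes "l > 0"
  shows "continuous_on UNIV (osc_tail l)"
proof (rule continuous_on_sequentiallyI)
  fix X x assume X: "X \<longlonglongrightarrow> (x::real)"
  show "(\<lambda>n. osc_tail l (X n)) \<longlonglongrightarrow> osc_tail l x"
    unfolding osc_tail_def
  proof (rule integral_dominated_convergence[OF _ _ integrable_inverse_square_atLeast(1)[OF assms]])
    show "AE t in lborel. (\<lambda>n. indicator {l..} t *\<^sub>R (exp (- (\<i> * of_real (X n * t))) / of_real (t\<^sup>2) :: complex))
        \<longlonglongrightarrow> indicator {l..} t *\<^sub>R (exp (- (\<i> * of_real (x * t))) / of_real (t\<^sup>2))"
      using X assms by (intro AE_I2) (auto intro!: tendsto_intros simp: indicator_def)
  qed (auto simp: norm_divide norm_power)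
qed

lemma isCont_osc_int:
  assumes "l > 0" "x \<noteq> 0"
  shows "isCont (osc_int l) x"
proof -
  have "isCont (osc_tail l) x"
    using continuous_osc_tail[OF assms(1)] by (simp add: continuous_on_eq_continuous_at)
  then show ?thesis
    unfolding osc_int_def[abs_def] using assms by (intro continuous_intros) auto
qed

lemma borel_measurable_osc_int [measurable]:
  assumes "l > 0"
  shows "osc_int l \<in> borel_measurable borel"
  by (rule borel_measurable_continuous_countable_exceptions[of "{0}"])
    (use isCont_osc_int[OF assms] in \<open>auto intro!: continuous_at_imp_continuous_on\<close>)

text \<open>Moving the lower limit from \<open>l\<close> up to 1/|x| costs at most the integral of
  1/t, which is the logarithm; from 1/|x| on, the decay bound gives the constant 2.\<close>

lemma norm_osc_int_le_ln:
  assumes "l > 0" "x \<noteq> 0" "l * \<bar>x\<bar> \<le> 1"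
  shows "norm (osc_int l x) \<le> 2 - ln (l * \<bar>x\<bar>)"
proof -
  define b where "b = 1 / \<bar>x\<bar>"
  have b: "l \<le> b" "b > 0" using assms by (auto simp: b_def field_simps)
  have "norm (osc_int b x - osc_int l x) \<le> ln b - ln l"
  proof (cases "l = b")
    case False
    then have "l < b" using b by simp
    show ?thesis
    proof (rule differentiable_bound_general[OF \<open>l < b\<close>])
      show "continuous_on {l..b} (\<lambda>t. osc_int t x)"
        using assms by (intro continuous_at_imp_continuous_on ballI has_vector_derivative_continuous[OF osc_int_has_derivative]) auto
      show "continuous_on {l..b} ln" using assms by (intro continuous_intros) auto
      show "((\<lambda>t. osc_int t x) has_vector_derivative - (exp (- (\<i> * of_real (x * t))) / of_real t)) (at t)"
        "(ln has_vector_derivative 1 / t) (at t)"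
        "norm (- (exp (- (\<i> * of_real (x * t))) / of_real t) :: complex) \<le> 1 / t" if "l < t" for t
        using assms that osc_int_has_derivative[of t x]
        by (auto intro!: derivative_eq_intros
          simp: norm_divide has_real_derivative_iff_has_vector_derivative[symmetric])
    qed
  qed simp
  moreover have "norm (osc_int b x) \<le> 2"
    using norm_osc_int_le[of b x] b assms by (simp add: b_def)
  moreover have "ln b - ln l = - ln (l * \<bar>x\<bar>)"
    using assms by (simp add: b_def ln_div ln_mult)
  ultimately show ?thesis
    using norm_triangle_ineq2[of "osc_int l x" "osc_int b x"] by (simp add: norm_minus_commute)
qed

lemma integrable_osc_int_square:
  assumes "l > 0"
  shows "integrable lborel (\<lambda>x. (norm (osc_int l x))\<^sup>2)"
proof -
  note [measurable] = borel_measurable_osc_int[OF assms]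
  let ?f = "\<lambda>x. (norm (osc_int l x))\<^sup>2"
  \<comment> \<open>Both terms are squares of pointwise bounds: of 4 (lx)^(-1/4), which dominates
    the logarithmic bound where lx \<le> 1, and of the decay bound 2/(lx) elsewhere. The exponent
    1/4 leaves a square that is integrable at 0.\<close>
  define D where "D x = 16 * l powr (- 1 / 2) * (indicator {0..1 / l} x *\<^sub>R x powr (- 1 / 2))
    + 4 / l\<^sup>2 * (indicator {1 / l..} x * (1 / x\<^sup>2))" for x :: real
  have "(\<lambda>x::real. x powr (- 1 / 2)) absolutely_integrable_on {0..1 / l}"
    using integrable_on_powr_from_0[of "- 1 / 2" "1 / l"] assms
    by (intro nonnegative_absolutely_integrable_1) auto
  then have "integrable lborel (\<lambda>x. indicator {0..1 / l} x *\<^sub>R x powr (- 1 / 2))"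
    unfolding set_integrable_def by (subst (asm) integrable_completion) auto
  then have "integrable lborel D"
    unfolding D_def using assms
    by (intro Bochner_Integration.integrable_add integrable_mult_right integrable_inverse_square_atLeast) auto
  then have pos: "integrable lborel (\<lambda>x. indicator {0<..} x * ?f x)"
  proof (rule Bochner_Integration.integrable_bound)
    show "AE x in lborel. norm (indicator {0<..} x * ?f x) \<le> norm (D x)"
    proof (rule AE_I2)
      fix x :: real
      have D0: "D x \<ge> 0" by (simp add: D_def)
      have "?f x \<le> D x" if "x > 0"
      proof (cases "l * x \<le> 1")
        case True
        define y where "y = l * x"
        have y: "0 < y" "y \<le> 1" using that assms True by (auto simp: y_def)
        have "- ln y = 4 * ln (y powr (- 1 / 4))" using y by (simp add: ln_powr)
        also have "ln (y powr (- 1 / 4)) \<le> y powr (- 1 / 4) - 1"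
          using y by (intro ln_le_minus_one) auto
        finally have "2 - ln y \<le> 4 * y powr (- 1 / 4)" by simp
        then have "norm (osc_int l x) \<le> 4 * y powr (- 1 / 4)"
          using norm_osc_int_le_ln[of l x] assms that True by (simp add: y_def)
        then have "?f x \<le> (4 * y powr (- 1 / 4))\<^sup>2" by (intro power_mono) auto
        also have "\<dots> = 16 * y powr (- 1 / 2)"
          using y by (simp add: power_mult_distrib powr_power)
        also have "\<dots> = 16 * l powr (- 1 / 2) * x powr (- 1 / 2)"
          using assms that by (simp add: y_def powr_mult)
        also have "\<dots> \<le> D x"
          using True assms that by (auto simp: D_def indicator_def field_simps)
        finally show ?thesis .
      next
        case False
        then have "1 / l \<le> x" using assms by (simp add: field_simps)
        have "?f x \<le> (2 / (l * x))\<^sup>2"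
          using norm_osc_int_le[OF assms, of x] that by (intro power_mono) auto
        also have "\<dots> = 4 / l\<^sup>2 * (1 / x\<^sup>2)" by (simp add: power_divide power_mult_distrib)
        also have "\<dots> \<le> D x" using \<open>1 / l \<le> x\<close> by (simp add: D_def)
        finally show ?thesis .
      qed
      then show "norm (indicator {0<..} x * ?f x) \<le> norm (D x)"
        using D0 by (auto simp: indicator_def)
    qed
  qed measurable
  have "norm (osc_int l (- x)) = norm (osc_int l x)" for x
    by (metis cnj_osc_int complex_mod_cnj)
  then have neg: "integrable lborel (\<lambda>x. indicator {0<..} (- x) * ?f x)"
    using lborel_integrable_real_affine[OF pos, of "-1" 0] by simp
  have "integrable lborel (\<lambda>x. indicator {0<..} x * ?f x + indicator {0<..} (- x) * ?f x)"
    by (rule Bochner_Integration.integrable_add[OF pos neg])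
  \<comment> \<open>The two open half lines omit 0, where \<open>osc_int\<close> has the value
    0.\<close>
  also have "(\<lambda>x. indicator {0<..} x * ?f x + indicator {0<..} (- x) * ?f x) = ?f"
    by (auto simp: indicator_def fun_eq_iff osc_int_def)
  finally show ?thesis .
qed

text \<open>Interpolation between the Lipschitz bound at distance at most 1 and the trivial bound 2.
  With \<open>a = x * l\<close> and \<open>b = x * k\<close> it trades regularity in the spectral
  parameter for growth in x: exponent \<gamma> costs only the power \<gamma> of |x|.\<close>

lemma norm_exp_diff_le_powr:
  assumes "0 < \<gamma>" "\<gamma> \<le> 1"
  shows "norm (exp (- (\<i> * of_real a)) - exp (- (\<i> * of_real b)) :: complex) \<le> 2 * \<bar>a - b\<bar> powr \<gamma>"
proof (cases "\<bar>a - b\<bar> \<le> 1")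
  case True
  have d: "((\<lambda>t. exp (- (\<i> * of_real t)) :: complex) has_vector_derivative (- \<i> * exp (- (\<i> * of_real t)))) (at t within S)" for t S
  proof -
    have "((\<lambda>z. exp (- (\<i> * z)) :: complex) has_field_derivative (- \<i> * exp (- (\<i> * of_real t)))) (at (of_real t))"
      by (auto intro!: derivative_eq_intros)
    from has_vector_derivative_at_within[OF has_vector_derivative_real_field[OF this]] show ?thesis .
  qed
  have "norm (exp (- (\<i> * of_real a)) - exp (- (\<i> * of_real b)) :: complex) \<le> 1 * norm (a - b)"
    by (rule differentiable_bound[where S = UNIV, OF _ d[unfolded has_vector_derivative_def]])
      (auto intro!: onorm_le simp: norm_mult)
  also have "\<dots> \<le> \<bar>a - b\<bar> powr \<gamma>"
    using True assms by (cases "a = b") (auto intro!: powr_mono'[of \<gamma> 1 "\<bar>a - b\<bar>", simplified])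
  finally show ?thesis using powr_ge_zero[of "\<bar>a - b\<bar>" \<gamma>] by linarith
next
  case False
  then have "1 \<le> \<bar>a - b\<bar> powr \<gamma>" using assms by (intro ge_one_powr_ge_zero) auto
  moreover have "norm (exp (- (\<i> * of_real a)) - exp (- (\<i> * of_real b)) :: complex) \<le> 1 + 1"
    by (rule order_trans[OF norm_triangle_ineq4]) simp
  ultimately show ?thesis by linarith
qed

text \<open>The derivative in the parameter has norm 1/t \<le> 1/a. The bound is uniform in x
  although \<open>osc_int\<close> itself is unbounded near 0: the singularity does not depend on the
  parameter to leading order and cancels.\<close>

lemma osc_int_lipschitz:
  assumes "a > 0" "a \<le> l" "a \<le> k"
  shows "norm (osc_int l x - osc_int k x) \<le> \<bar>l - k\<bar> / a"
proof (cases "x = 0")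
  case False
  have "norm (osc_int l x - osc_int k x) \<le> (1 / a) * norm (l - k)"
  proof (rule differentiable_bound[of "{a..}" "\<lambda>t. osc_int t x"])
    show "((\<lambda>t. osc_int t x) has_derivative (\<lambda>h. h *\<^sub>R - (exp (- (\<i> * of_real (x * t))) / of_real t))) (at t within {a..})"
      if "t \<in> {a..}" for t
      using osc_int_has_derivative[of t x] that assms False has_derivative_at_withinI
      by (auto simp: has_vector_derivative_def)
    show "onorm (\<lambda>h. h *\<^sub>R - (exp (- (\<i> * of_real (x * t))) / of_real t :: complex)) \<le> 1 / a"
      if "t \<in> {a..}" for t
      using that assms by (intro onorm_le) (auto simp: norm_divide field_simps mult_right_mono)
  qed (use assms in auto)
  then show ?thesis by simp
qed (use assms in \<open>auto simp: osc_int_def\<close>)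

lemma weight_ge_1: "1 \<le> weight x" and weight_pos: "0 < weight x"
  by (auto simp: weight_def)

text \<open>The derivative at t differs from the one at k in two ways: the exponential moves, which
  gives 2/a and the factor \<open>weight x powr \<gamma>\<close>, and so does 1/t, which gives
  1/a^2. The second change is Lipschitz and is absorbed into the power \<gamma> because
  \<open>\<bar>l - k\<bar> \<le> 1\<close>. The plus sign reflects the negative derivative of
  \<open>osc_int\<close>.\<close>

lemma osc_int_linearization:
  assumes "a > 0" "a \<le> l" "a \<le> k" "\<bar>l - k\<bar> \<le> 1" "0 < \<gamma>" "\<gamma> \<le> 1" "x \<noteq> 0"
  shows "norm (osc_int l x - osc_int k x + of_real (l - k) * (exp (- (\<i> * of_real (x * k))) / of_real k))
    \<le> (2 / a + 1 / a\<^sup>2) * \<bar>l - k\<bar> * \<bar>l - k\<bar> powr \<gamma> * weight x powr \<gamma>"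
proof -
  define g where "g t = - (exp (- (\<i> * of_real (x * t))) / of_real t :: complex)" for t
  let ?B = "(2 / a + 1 / a\<^sup>2) * \<bar>l - k\<bar> powr \<gamma> * weight x powr \<gamma>"
  have "norm (osc_int l x - osc_int k x - (l - k) *\<^sub>R g k) \<le> norm (l - k) * ?B"
  proof (rule vector_differentiable_bound_linearization[of "closed_segment k l" "\<lambda>t. osc_int t x" g])
    fix t assume t: "t \<in> closed_segment k l"
    then have ta: "a \<le> t" and tk: "\<bar>t - k\<bar> \<le> \<bar>l - k\<bar>"
      using assms by (auto simp: closed_segment_eq_real_ivl split: if_splits)
    show "((\<lambda>t. osc_int t x) has_vector_derivative g t) (at t within closed_segment k l)"
      unfolding g_def using ta assms by (intro has_vector_derivative_at_within[OF osc_int_has_derivative]) auto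
    have "norm (g t - g k) = norm ((exp (- (\<i> * of_real (x * k))) - exp (- (\<i> * of_real (x * t)))) / of_real t
        + exp (- (\<i> * of_real (x * k))) * of_real (1 / k - 1 / t) :: complex)"
      using ta assms by (intro arg_cong[of _ _ norm]) (auto simp: g_def field_simps)
    also have "\<dots> \<le> 2 * \<bar>x * k - x * t\<bar> powr \<gamma> / t + \<bar>1 / k - 1 / t\<bar>"
      using norm_exp_diff_le_powr[of \<gamma> "x * k" "x * t"] assms ta
      by (intro order_trans[OF norm_triangle_ineq] add_mono)
        (auto simp: norm_divide norm_mult divide_right_mono simp del: of_real_diff of_real_divide)
    also have "\<dots> \<le> 2 * (\<bar>l - k\<bar> powr \<gamma> * weight x powr \<gamma>) / a + 1 / a\<^sup>2 * (\<bar>l - k\<bar> powr \<gamma> * weight x powr \<gamma>)"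
    proof (rule add_mono)
      have "\<bar>x * k - x * t\<bar> = \<bar>x\<bar> * \<bar>t - k\<bar>"
        by (simp add: abs_mult[symmetric] algebra_simps abs_minus_commute)
      also have "\<dots> \<le> weight x * \<bar>l - k\<bar>" using tk by (intro mult_mono) (auto simp: weight_def)
      finally have "\<bar>x * k - x * t\<bar> powr \<gamma> \<le> (weight x * \<bar>l - k\<bar>) powr \<gamma>"
        using assms by (intro powr_mono2) auto
      then have "\<bar>x * k - x * t\<bar> powr \<gamma> \<le> \<bar>l - k\<bar> powr \<gamma> * weight x powr \<gamma>"
        using weight_pos[of x] by (simp add: powr_mult mult.commute)
      then show "2 * \<bar>x * k - x * t\<bar> powr \<gamma> / t \<le> 2 * (\<bar>l - k\<bar> powr \<gamma> * weight x powr \<gamma>) / a"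
        using ta assms by (intro frac_le) auto
      have "\<bar>1 / k - 1 / t\<bar> = \<bar>t - k\<bar> / (k * t)"
        using ta assms by (simp add: abs_if field_simps)
      also have "\<dots> \<le> \<bar>l - k\<bar> / a\<^sup>2"
        using ta tk assms by (intro frac_le) (auto simp: power2_eq_square mult_mono)
      also have "\<bar>l - k\<bar> \<le> \<bar>l - k\<bar> powr \<gamma>"
        using assms by (cases "l = k") (auto intro!: powr_mono'[of \<gamma> 1 "\<bar>l - k\<bar>", simplified])
      also have "\<dots> \<le> \<bar>l - k\<bar> powr \<gamma> * weight x powr \<gamma>"
        using weight_ge_1[of x] assms by (simp add: ge_one_powr_ge_zero mult_le_cancel_left1)
      finally show "\<bar>1 / k - 1 / t\<bar> \<le> 1 / a\<^sup>2 * (\<bar>l - k\<bar> powr \<gamma> * weight x powr \<gamma>)"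
        by (simp add: divide_right_mono)
    qed
    also have "\<dots> = ?B" by (simp add: field_simps)
    finally show "norm (g t - g k) \<le> ?B" .
  qed auto
  then show ?thesis
    by (simp add: g_def scaleR_conv_of_real mult_ac)
qed

section \<open>The conjugated kernel\<close>

fun kern :: "side \<Rightarrow> real \<Rightarrow> real \<Rightarrow> complex" where
  "kern Above l x = \<i> * of_real (indicator {0<..} x) + osc_int l x / (2 * of_real pi)"
| "kern Below l x = - \<i> * of_real (indicator {..<0} x) + osc_int l x / (2 * of_real pi)"

lemma G_kernel_eq:
  assumes "l > 0" "x \<noteq> 0"
  shows "G_kernel \<sigma> l x = exp (\<i> * of_real (l * x)) * kern \<sigma> l x"
  using G_tilde_eq[OF assms] by (cases \<sigma>) (auto simp: field_simps indicator_def)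

lemma cnj_kern_Below: "cnj (kern Below l x) = kern Above l (- x)"
  using cnj_osc_int[of l x] by (auto simp: indicator_def)

lemma norm_kern_le: "norm (kern \<sigma> l x) \<le> 1 + norm (osc_int l x)"
proof -
  have "1 \<le> pi * 2" using pi_gt3 by simp
  from mult_right_mono[OF this, of "norm (osc_int l x)"] have "norm (osc_int l x / (2 * of_real pi)) \<le> norm (osc_int l x)"
    by (simp add: norm_divide norm_mult field_simps mult_le_cancel_left1)
  then show ?thesis
    by (cases \<sigma>) (auto simp: indicator_def intro!: order_trans[OF norm_triangle_ineq] order_trans[OF norm_triangle_ineq4])
qed

lemma borel_measurable_kern [measurable]:
  assumes "l > 0"
  shows "kern \<sigma> l \<in> borel_measurable borel"
proof -
  note [measurable] = borel_measurable_osc_int[OF assms]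
  show ?thesis by (cases \<sigma>) (simp_all add: kern.simps[abs_def] cong: measurable_cong)
qed

lemma isCont_kern:
  assumes "l > 0" "x \<noteq> 0"
  shows "isCont (kern \<sigma> l) x"
proof -
  have "isCont (indicator {0<..} :: real \<Rightarrow> real) x" "isCont (indicator {..<0} :: real \<Rightarrow> real) x"
    using assms by (auto simp: isCont_indicator frontier_def interior_open)
  then show ?thesis
    using isCont_osc_int[OF assms]
    by (cases \<sigma>) (auto intro!: continuous_intros simp: kern.simps[abs_def])
qed

lemma kern_diff: "kern \<sigma> l x - kern \<sigma> k x = (osc_int l x - osc_int k x) / (2 * of_real pi)"
  by (cases \<sigma>) (auto simp: diff_divide_distrib)

declare kern.simps [simp del]

definition osc_energy :: "real \<Rightarrow> real" where
  "osc_energy l = (LINT x|lborel. (norm (osc_int l x))\<^sup>2)"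

lemma
  assumes "l > 0"
  shows integrable_osc_int_shift: "integrable lborel (\<lambda>y. (norm (osc_int l (x - y)))\<^sup>2)"
    and osc_energy_shift: "(LINT y|lborel. (norm (osc_int l (x - y)))\<^sup>2) = osc_energy l"
  using lborel_integrable_real_affine[OF integrable_osc_int_square[OF assms], of "-1" x]
    lborel_integral_real_affine[of "-1" "\<lambda>x. (norm (osc_int l x))\<^sup>2" x]
  by (simp_all add: osc_energy_def)

lemma osc_energy_nonneg: "osc_energy l \<ge> 0"
  unfolding osc_energy_def by simp

text \<open>The step part of the kernel is bounded and the oscillatory part is square integrable, so
  \<open>h\<close> has to lie in L1 and in L2. The free parameter \<open>e\<close> distributes the
  product between \<open>osc_energy l\<close>, which is fixed, and the L2 norm of \<open>h\<close>:
  once \<open>h\<close> becomes small, a small \<open>e\<close> makes the whole bound small,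
  uniformly in x.\<close>

lemma
  fixes h :: "real \<Rightarrow> real"
  assumes l: "l > 0" and h [measurable]: "h \<in> borel_measurable borel" and h0: "\<And>x. h x \<ge> 0"
    and h1: "integrable lborel h" and h2: "integrable lborel (\<lambda>x. (h x)\<^sup>2)"
  shows integrable_kern_mult: "integrable lborel (\<lambda>y. norm (kern \<sigma> l (x - y)) * h y)"
    and integral_kern_mult_le: "e > 0 \<Longrightarrow> (LINT y|lborel. norm (kern \<sigma> l (x - y)) * h y)
      \<le> (LINT y|lborel. h y) + e * osc_energy l + (LINT y|lborel. (h y)\<^sup>2) / e"
proof -
  note [measurable] = borel_measurable_kern[OF l] borel_measurable_osc_int[OF l]
  have le: "norm (kern \<sigma> l (x - y)) * h y \<le> h y + e * (norm (osc_int l (x - y)))\<^sup>2 + (h y)\<^sup>2 / e"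
    if "e > 0" for y e
  proof -
    let ?q = "norm (osc_int l (x - y))"
    have "0 \<le> (e * ?q - h y)\<^sup>2 + e * ?q * h y" using that h0 by simp
    then have "e * (?q * h y) \<le> e * (e * ?q\<^sup>2 + (h y)\<^sup>2 / e)"
      using that by (simp add: power2_eq_square algebra_simps)
    then have "?q * h y \<le> e * ?q\<^sup>2 + (h y)\<^sup>2 / e" using that by (simp only: mult_le_cancel_left_pos)
    moreover have "norm (kern \<sigma> l (x - y)) * h y \<le> (1 + ?q) * h y"
      by (intro mult_right_mono norm_kern_le h0)
    ultimately show ?thesis by (simp add: algebra_simps)
  qed
  have int: "integrable lborel (\<lambda>y. h y + e * (norm (osc_int l (x - y)))\<^sup>2 + (h y)\<^sup>2 / e)" for e
    using integrable_osc_int_shift[OF l] h1 h2 by (intro Bochner_Integration.integrable_add) auto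
  show I: "integrable lborel (\<lambda>y. norm (kern \<sigma> l (x - y)) * h y)"
    by (rule Bochner_Integration.integrable_bound[OF int[of 1]]) (use le[of 1] h0 in \<open>auto intro!: AE_I2 simp: order_trans[OF _ abs_ge_self]\<close>)
  assume "e > 0"
  have "(LINT y|lborel. norm (kern \<sigma> l (x - y)) * h y) \<le> (LINT y|lborel. h y + e * (norm (osc_int l (x - y)))\<^sup>2 + (h y)\<^sup>2 / e)"
    by (rule integral_mono[OF I int le[OF \<open>e > 0\<close>]])
  also have "\<dots> = (LINT y|lborel. h y) + e * osc_energy l + (LINT y|lborel. (h y)\<^sup>2) / e"
    using integrable_osc_int_shift[OF l] h1 h2 osc_energy_shift[OF l] by simp
  finally show "(LINT y|lborel. norm (kern \<sigma> l (x - y)) * h y)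
      \<le> (LINT y|lborel. h y) + e * osc_energy l + (LINT y|lborel. (h y)\<^sup>2) / e" .
qed

text \<open>Generalised dominated convergence: the dominating functions are translates of one function,
  and converge in \<open>L\<^sup>1\<close> by Scheffe's lemma.\<close>

lemma kern_translation_continuous:
  fixes h :: "real \<Rightarrow> real"
  assumes l: "l > 0" and h [measurable]: "h \<in> borel_measurable borel" and h0: "\<And>x. h x \<ge> 0"
    and h1: "integrable lborel h" and h2: "integrable lborel (\<lambda>x. (h x)\<^sup>2)"
    and X: "X \<longlonglongrightarrow> x"
  shows "(\<lambda>n. LINT y|lborel. norm (kern \<sigma> l (X n - y) - kern \<sigma> l (x - y)) * h y) \<longlonglongrightarrow> 0"
proof -
  note [measurable] = borel_measurable_kern[OF l] borel_measurable_osc_int[OF l]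
  define F where "F n y = norm (kern \<sigma> l (X n - y) - kern \<sigma> l (x - y)) * h y" for n y
  define q where "q z y = (norm (osc_int l (z - y)))\<^sup>2" for z y
  \<comment> \<open>\<open>F n\<close> is at most \<open>2 h + 2 h^2 + q (X n) + q x\<close>.
    Replacing \<open>q (X n)\<close> by \<open>q x\<close> leaves the fixed majorant
    \<open>G\<close> and an error that tends to 0 in L1. Hence \<open>min (F n) (G)\<close> falls
    under ordinary dominated convergence, and the excess of \<open>F n\<close> over \<open>G\<close>
    is part of the error.\<close>
  define G where "G y = 2 * h y + 2 * (h y)\<^sup>2 + 2 * q x y" for y
  have [measurable]: "F n \<in> borel_measurable borel" "q z \<in> borel_measurable borel" "G \<in> borel_measurable borel" for n z
    unfolding F_def q_def G_def by measurable
  have qi: "integrable lborel (q z)" "integral\<^sup>L lborel (q z) = osc_energy l" for z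
    unfolding q_def by (auto intro!: integrable_osc_int_shift osc_energy_shift l)
  have q0: "q z y \<ge> 0" for z y by (simp add: q_def)
  have G0: "G y \<ge> 0" for y by (simp add: G_def q0 h0)
  have Gi: "integrable lborel G" unfolding G_def using qi h1 h2 by auto
  have F0: "F n y \<ge> 0" for n y by (simp add: F_def h0)
  have qlim: "(\<lambda>n. q (X n) y) \<longlonglongrightarrow> q x y" "(\<lambda>n. F n y) \<longlonglongrightarrow> 0" if "y \<noteq> x" for y
  proof -
    have "(\<lambda>n. X n - y) \<longlonglongrightarrow> x - y" using X by (intro tendsto_intros)
    then have "(\<lambda>n. osc_int l (X n - y)) \<longlonglongrightarrow> osc_int l (x - y)"
      "(\<lambda>n. kern \<sigma> l (X n - y)) \<longlonglongrightarrow> kern \<sigma> l (x - y)"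
      using that isCont_tendsto_compose[OF isCont_osc_int[OF l, of "x - y"]]
        isCont_tendsto_compose[OF isCont_kern[OF l, of "x - y"]] by auto
    then show "(\<lambda>n. q (X n) y) \<longlonglongrightarrow> q x y" "(\<lambda>n. F n y) \<longlonglongrightarrow> 0"
      unfolding q_def F_def by (auto intro!: tendsto_eq_intros)
  qed
  have AEx: "AE y in lborel. y \<noteq> x" by (rule AE_lborel_singleton)
  have "(\<lambda>n. \<integral>\<^sup>+ y. norm (q (X n) y - q x y) \<partial>lborel) \<longlonglongrightarrow> 0"
  proof (rule Scheffe_lemma2)
    show "AE y in lborel. (\<lambda>n. q (X n) y) \<longlonglongrightarrow> q x y"
      using AEx by eventually_elim (rule qlim)
    show "(\<integral>\<^sup>+ y. norm (q (X n) y) \<partial>lborel) \<le> (\<integral>\<^sup>+ y. norm (q x y) \<partial>lborel)" for n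
      using qi q0 by (simp add: nn_integral_eq_integral)
  qed (use qi in auto)
  then have "(\<lambda>n. ennreal (LINT y|lborel. \<bar>q (X n) y - q x y\<bar>)) \<longlonglongrightarrow> 0"
    using qi by (simp add: nn_integral_eq_integral)
  then have A: "(\<lambda>n. LINT y|lborel. \<bar>q (X n) y - q x y\<bar>) \<longlonglongrightarrow> 0"
    using tendsto_ennrealD[of "\<lambda>n. LINT y|lborel. \<bar>q (X n) y - q x y\<bar>" 0 sequentially] by simp
  have "(\<lambda>n. LINT y|lborel. min (F n y) (G y)) \<longlonglongrightarrow> (LINT (y::real)|lborel. 0)"
  proof (rule integral_dominated_convergence[where w = G])
    show "AE y in lborel. (\<lambda>n. min (F n y) (G y)) \<longlonglongrightarrow> 0"
      using AEx
    proof eventually_elim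
      case (elim y)
      show ?case using tendsto_min[OF qlim(2)[OF elim] tendsto_const[of "G y"]] G0[of y] by (simp add: min_absorb1)
    qed
  qed (use F0 G0 Gi in auto)
  then have B: "(\<lambda>n. LINT y|lborel. min (F n y) (G y)) \<longlonglongrightarrow> 0" by simp
  have I: "integrable lborel (\<lambda>y. min (F n y) (G y))" for n
    by (rule Bochner_Integration.integrable_bound[OF Gi]) (use F0 G0 in auto)
  have le: "F n y \<le> min (F n y) (G y) + \<bar>q (X n) y - q x y\<bar>" for n y
  proof -
    have *: "norm (kern \<sigma> l z) * h y \<le> h y + (h y)\<^sup>2 + (norm (osc_int l z))\<^sup>2" for z
    proof -
      have "0 \<le> (norm (osc_int l z) - h y)\<^sup>2 + norm (osc_int l z) * h y" using h0 by simp
      moreover have "norm (kern \<sigma> l z) * h y \<le> (1 + norm (osc_int l z)) * h y"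
        by (intro mult_right_mono norm_kern_le h0)
      ultimately show ?thesis by (simp add: power2_eq_square algebra_simps)
    qed
    have "F n y \<le> norm (kern \<sigma> l (X n - y)) * h y + norm (kern \<sigma> l (x - y)) * h y"
      unfolding F_def distrib_right[symmetric] by (intro mult_right_mono norm_triangle_ineq4 h0)
    also have "\<dots> \<le> 2 * h y + 2 * (h y)\<^sup>2 + q (X n) y + q x y"
      using *[of "X n - y"] *[of "x - y"] by (simp add: q_def)
    also have "\<dots> \<le> G y + \<bar>q (X n) y - q x y\<bar>" by (simp add: G_def)
    finally show ?thesis by simp
  qed
  have FI: "integrable lborel (F n)" for n
    by (rule Bochner_Integration.integrable_bound[where f = "\<lambda>y. min (F n y) (G y) + \<bar>q (X n) y - q x y\<bar>"])
      (use I qi le F0 G0 in \<open>auto intro!: AE_I2\<close>)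
  have "(\<lambda>n. LINT y|lborel. F n y) \<longlonglongrightarrow> 0"
  proof (rule tendsto_sandwich[OF _ _ tendsto_const])
    show "(\<lambda>n. (LINT y|lborel. min (F n y) (G y)) + (LINT y|lborel. \<bar>q (X n) y - q x y\<bar>)) \<longlonglongrightarrow> 0"
      using tendsto_add[OF B A] by simp
    show "\<forall>\<^sub>F n in sequentially. (LINT y|lborel. F n y) \<le> (LINT y|lborel. min (F n y) (G y)) + (LINT y|lborel. \<bar>q (X n) y - q x y\<bar>)"
    proof (rule always_eventually, rule allI)
      fix n
      have "(LINT y|lborel. F n y) \<le> (LINT y|lborel. min (F n y) (G y) + \<bar>q (X n) y - q x y\<bar>)"
        by (rule integral_mono[OF FI _ le]) (use I qi in auto)
      then show "(LINT y|lborel. F n y) \<le> (LINT y|lborel. min (F n y) (G y)) + (LINT y|lborel. \<bar>q (X n) y - q x y\<bar>)"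
        using I qi by simp
    qed
  qed (use F0 in auto)
  then show ?thesis unfolding F_def .
qed

section \<open>The integral operator\<close>

text \<open>A negative \<open>a\<close> would make the bound fail everywhere, whereas a property
  that holds almost everywhere holds somewhere. It is used to read off that radii in the weighted
  space are nonnegative.\<close>

lemma AE_lborel_mono_real:
  fixes a :: real
  assumes "AE x::real in lborel. norm (f x) \<le> a * g x" "\<And>x. g x > 0"
  shows "a \<ge> 0"
proof (rule ccontr)
  assume "\<not> a \<ge> 0"
  then have "a * g x < 0" for x using assms(2)[of x] by (simp add: mult_neg_pos)
  then have "AE x::real in lborel. False"
    using assms(1) by (elim eventually_mono) (metis norm_ge_zero not_less order_trans)
  then show False by (simp add: eventually_False ae_filter_eq_bot_iff)
qed

lemma integral_norm_bound_integral_AE: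
  fixes f :: "'a \<Rightarrow> 'b::{banach, second_countable_topology}"
  assumes "integrable M f" "integrable M g" "AE x in M. norm (f x) \<le> g x"
  shows "norm (integral\<^sup>L M f) \<le> integral\<^sup>L M g"
  by (rule order_trans[OF integral_norm_bound integral_mono_AE]) (use assms in auto)

text \<open>\<open>r\<close> is the growth allowed to solutions and \<open>\<gamma>\<close> the
  exponent of the weight left over for increments in the spectral parameter;
  \<open>\<gamma> \<le> r\<close> ensures that increments of plane waves belong to the solution
  space with a Hoelder bound. The potential is taken Borel measurable so that kernels and double
  integrals can be handled over \<open>lborel\<close>.\<close>

locale weighted_potential =
  fixes u :: "real \<Rightarrow> real" and r \<gamma> :: real
  assumes u_measurable [measurable]: "u \<in> borel_measurable borel"
    and r_pos: "r > 0" and \<gamma>_pos: "0 < \<gamma>" and \<gamma>_less: "\<gamma> < 1" and \<gamma>_le: "\<gamma> \<le> r"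
    and integrable_potential: "integrable lborel (\<lambda>x. \<bar>u x\<bar> * weight x powr r * weight x powr \<gamma>)"
    and integrable_potential_square: "integrable lborel (\<lambda>x. (\<bar>u x\<bar> * weight x powr r)\<^sup>2)"
begin

definition v :: "real \<Rightarrow> real" where "v x = \<bar>u x\<bar> * weight x powr r"

text \<open>A ball of the weighted L-infinity space given by its radius, in place of a norm:
  functions remain concrete and no quotient by null functions is formed. The smallest radius, from
  \<open>wbound_least\<close>, serves as the norm.\<close>

definition wbound :: "(real \<Rightarrow> complex) \<Rightarrow> real \<Rightarrow> bool" where
  "wbound n B \<longleftrightarrow> n \<in> borel_measurable borel \<and> (AE x in lborel. norm (n x) \<le> B * weight x powr r)"

definition oper :: "side \<Rightarrow> real \<Rightarrow> (real \<Rightarrow> complex) \<Rightarrow> real \<Rightarrow> complex" where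
  "oper \<sigma> l n x = (LINT y|lborel. kern \<sigma> l (x - y) * (of_real (u y) * n y))"

lemma borel_measurable_weight [measurable]: "weight \<in> borel_measurable borel"
  unfolding weight_def by measurable

lemma v_measurable [measurable]: "v \<in> borel_measurable borel"
  unfolding v_def by measurable

lemma v_nonneg: "v x \<ge> 0" by (simp add: v_def)

lemma integrable_v_square: "integrable lborel (\<lambda>x. (v x)\<^sup>2)"
  using integrable_potential_square by (simp add: v_def)

lemma integrable_v_weight: "integrable lborel (\<lambda>x. v x * weight x powr \<gamma>)"
  using integrable_potential by (simp add: v_def)

lemma integrable_v: "integrable lborel v"
proof (rule Bochner_Integration.integrable_bound[OF integrable_v_weight])
  have "v x \<le> v x * weight x powr \<gamma>" for x
    using v_nonneg[of x] ge_one_powr_ge_zero[OF weight_ge_1[of x], of \<gamma>] \<gamma>_pos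
    by (simp add: mult_le_cancel_left1)
  then show "AE x in lborel. norm (v x) \<le> norm (v x * weight x powr \<gamma>)"
    by (simp add: abs_mult v_nonneg)
qed simp

lemma wboundD:
  assumes "wbound n B"
  shows "n \<in> borel_measurable borel" "AE x in lborel. norm (n x) \<le> B * weight x powr r" "B \<ge> 0"
proof -
  have "weight x powr r > 0" for x using weight_pos[of x] by simp
  then show "n \<in> borel_measurable borel" "AE x in lborel. norm (n x) \<le> B * weight x powr r" "B \<ge> 0"
    using assms AE_lborel_mono_real[of n B "\<lambda>x. weight x powr r"] by (auto simp: wbound_def)
qed

lemma wbound_potential:
  assumes "wbound n B"
  shows "AE x in lborel. norm (of_real (u x) * n x) \<le> B * v x"
proof -
  show ?thesis
    using wboundD(2)[OF assms]
  proof eventually_elim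
    case (elim x)
    then have "\<bar>u x\<bar> * norm (n x) \<le> \<bar>u x\<bar> * (B * weight x powr r)" by (intro mult_left_mono) auto
    then show ?case by (simp add: norm_mult v_def mult_ac)
  qed
qed

lemma integrable_potential_mult:
  assumes "wbound n B"
  shows "integrable lborel (\<lambda>x. of_real (u x) * n x)"
proof (rule Bochner_Integration.integrable_bound[OF integrable_mult_right[OF integrable_v, of B]])
  note [measurable] = wboundD(1)[OF assms]
  show "(\<lambda>x. of_real (u x) * n x) \<in> borel_measurable lborel" by measurable
  show "AE x in lborel. norm (of_real (u x) * n x) \<le> norm (B * v x)"
    using wbound_potential[OF assms] by eventually_elim (use v_nonneg wboundD(3)[OF assms] in auto)
qed

lemma wbound_mult_unimodular:
  assumes "wbound n B" "e \<in> borel_measurable borel" "\<And>x. norm (e x) \<le> 1"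
  shows "wbound (\<lambda>x. e x * n x) B"
proof -
  note [measurable] = wboundD(1)[OF assms(1)] assms(2)
  have "norm (e x * n x) \<le> norm (n x)" for x
    using mult_right_mono[OF assms(3)[of x], of "norm (n x)"] by (simp add: norm_mult)
  then show ?thesis
    using wboundD(2)[OF assms(1)] by (auto simp: wbound_def elim!: eventually_mono intro: order_trans)
qed

text \<open>The bound of \<open>integral_kern_mult_le\<close> with \<open>h = v\<close> and
  \<open>e = 1\<close>. It bounds the operator from the weighted space into the bounded functions,
  so the image no longer grows.\<close>

definition kern_const :: "real \<Rightarrow> real" where
  "kern_const l = (LINT y|lborel. v y) + osc_energy l + (LINT y|lborel. (v y)\<^sup>2)"

lemma kern_const_nonneg: "kern_const l \<ge> 0"
  unfolding kern_const_def using osc_energy_nonneg v_nonneg by (intro add_nonneg_nonneg) auto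

lemma
  assumes "l > 0" "wbound n B"
  shows integrable_oper: "integrable lborel (\<lambda>y. kern \<sigma> l (x - y) * (of_real (u y) * n y))"
    and norm_oper_le: "norm (oper \<sigma> l n x) \<le> B * kern_const l"
proof -
  note [measurable] = wboundD(1)[OF assms(2)] borel_measurable_kern[OF assms(1)]
  have I: "integrable lborel (\<lambda>y. B * (norm (kern \<sigma> l (x - y)) * v y))"
    by (intro integrable_mult_right integrable_kern_mult assms v_measurable v_nonneg integrable_v integrable_v_square)
  have A: "AE y in lborel. norm (kern \<sigma> l (x - y) * (of_real (u y) * n y)) \<le> B * (norm (kern \<sigma> l (x - y)) * v y)"
    using wbound_potential[OF assms(2)]
  proof eventually_elim
    case (elim y)
    then show ?case
      using mult_left_mono[OF elim, of "norm (kern \<sigma> l (x - y))"] by (simp add: norm_mult mult_ac)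
  qed
  show J: "integrable lborel (\<lambda>y. kern \<sigma> l (x - y) * (of_real (u y) * n y))"
    by (rule Bochner_Integration.integrable_bound[OF I]) (use A in \<open>auto elim: eventually_mono\<close>)
  have "norm (oper \<sigma> l n x) \<le> (LINT y|lborel. B * (norm (kern \<sigma> l (x - y)) * v y))"
    unfolding oper_def by (rule integral_norm_bound_integral_AE[OF J I A])
  also have "\<dots> \<le> B * kern_const l"
    using integral_kern_mult_le[of l v 1 \<sigma> x] assms(1) wboundD(3)[OF assms(2)] integrable_v integrable_v_square v_nonneg
    by (simp add: kern_const_def mult_left_mono)
  finally show "norm (oper \<sigma> l n x) \<le> B * kern_const l" .
qed

section \<open>Equicontinuity, compactness and the bound from below\<close>

definition kern_modulus :: "side \<Rightarrow> real \<Rightarrow> real \<Rightarrow> real \<Rightarrow> real" where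
  "kern_modulus \<sigma> l x x' = (LINT y|lborel. norm (kern \<sigma> l (x - y) - kern \<sigma> l (x' - y)) * v y)"

lemma tendsto_kern_modulus:
  assumes "l > 0" "X \<longlonglongrightarrow> x"
  shows "(\<lambda>n. kern_modulus \<sigma> l (X n) x) \<longlonglongrightarrow> 0"
  unfolding kern_modulus_def
  by (intro kern_translation_continuous assms v_measurable v_nonneg integrable_v integrable_v_square)

text \<open>The modulus depends on \<open>n\<close> only through the radius \<open>B\<close>: the
  images of a ball are equicontinuous, which is one half of compactness.\<close>

lemma norm_oper_diff_le:
  assumes "l > 0" "wbound n B"
  shows "norm (oper \<sigma> l n x - oper \<sigma> l n x') \<le> B * kern_modulus \<sigma> l x x'"
proof -
  note [measurable] = wboundD(1)[OF assms(2)] borel_measurable_kern[OF assms(1)]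
  let ?k = "\<lambda>y. kern \<sigma> l (x - y) - kern \<sigma> l (x' - y)"
  have K: "integrable lborel (\<lambda>y. norm (kern \<sigma> l (z - y)) * v y)" for z
    by (intro integrable_kern_mult assms v_measurable v_nonneg integrable_v integrable_v_square)
  have "integrable lborel (\<lambda>y. norm (?k y) * v y)"
  proof (rule Bochner_Integration.integrable_bound[OF Bochner_Integration.integrable_add[OF K[of x] K[of x']]])
    show "AE y in lborel. norm (norm (?k y) * v y) \<le> norm (norm (kern \<sigma> l (x - y)) * v y + norm (kern \<sigma> l (x' - y)) * v y)"
      unfolding distrib_right[symmetric] using v_nonneg norm_triangle_ineq4
      by (intro AE_I2) (auto simp: abs_mult intro!: mult_right_mono)
  qed measurable
  then have I: "integrable lborel (\<lambda>y. B * (norm (?k y) * v y))" by simp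
  have A: "AE y in lborel. norm (?k y * (of_real (u y) * n y)) \<le> B * (norm (?k y) * v y)"
    using wbound_potential[OF assms(2)]
  proof eventually_elim
    case (elim y)
    then show ?case
      using mult_left_mono[OF elim, of "norm (?k y)"] by (simp add: norm_mult mult_ac)
  qed
  have "oper \<sigma> l n x - oper \<sigma> l n x' = (LINT y|lborel. ?k y * (of_real (u y) * n y))"
    unfolding oper_def using integrable_oper[OF assms]
    by (subst Bochner_Integration.integral_diff[symmetric]) (auto simp: algebra_simps)
  also have "norm \<dots> \<le> (LINT y|lborel. B * (norm (?k y) * v y))"
  proof (rule integral_norm_bound_integral_AE[OF _ I A])
    have "integrable lborel (\<lambda>y. kern \<sigma> l (x - y) * (of_real (u y) * n y) - kern \<sigma> l (x' - y) * (of_real (u y) * n y))"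
      using integrable_oper[OF assms] by (intro Bochner_Integration.integrable_diff)
    then show "integrable lborel (\<lambda>y. ?k y * (of_real (u y) * n y))" by (simp add: algebra_simps)
  qed
  finally show ?thesis by (simp add: kern_modulus_def)
qed

lemma continuous_on_oper:
  assumes "l > 0" "wbound n B"
  shows "continuous_on UNIV (oper \<sigma> l n)"
proof (rule continuous_on_sequentiallyI)
  fix X x assume X: "X \<longlonglongrightarrow> (x::real)"
  have "(\<lambda>n. B * kern_modulus \<sigma> l (X n) x) \<longlonglongrightarrow> B * 0"
    by (intro tendsto_mult_left tendsto_kern_modulus assms X)
  then have lim: "(\<lambda>n. B * kern_modulus \<sigma> l (X n) x) \<longlonglongrightarrow> 0" by simp
  have "(\<lambda>k. oper \<sigma> l n (X k) - oper \<sigma> l n x) \<longlonglongrightarrow> 0"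
    by (rule Lim_null_comparison[OF _ lim]) (simp add: norm_oper_diff_le[OF assms])
  then show "(\<lambda>k. oper \<sigma> l n (X k)) \<longlonglongrightarrow> oper \<sigma> l n x" by (rule LIM_zero_cancel)
qed

lemma borel_measurable_oper [measurable]:
  assumes "l > 0" "wbound n B"
  shows "oper \<sigma> l n \<in> borel_measurable borel"
  using borel_measurable_continuous_onI[OF continuous_on_oper[OF assms]] by simp

lemma oper_minus:
  assumes "l > 0" "wbound m A" "wbound n B"
  shows "oper \<sigma> l (\<lambda>y. m y - n y) x = oper \<sigma> l m x - oper \<sigma> l n x"
  unfolding oper_def using integrable_oper[OF assms(1,2)] integrable_oper[OF assms(1,3)]
  by (subst Bochner_Integration.integral_diff[symmetric]) (auto simp: algebra_simps)

lemma oper_cmult: "oper \<sigma> l (\<lambda>y. c * n y) x = c * oper \<sigma> l n x"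
  unfolding oper_def by (subst integral_mult_right_zero[symmetric]) (simp add: mult_ac)

lemma wbound_minus:
  assumes "wbound m A" "wbound n B"
  shows "wbound (\<lambda>x. m x - n x) (A + B)"
proof -
  note [measurable] = wboundD(1)[OF assms(1)] wboundD(1)[OF assms(2)]
  have "AE x in lborel. norm (m x - n x) \<le> (A + B) * weight x powr r"
    using wboundD(2)[OF assms(1)] wboundD(2)[OF assms(2)]
  proof eventually_elim
    case (elim x)
    then show ?case using norm_triangle_ineq4[of "m x" "n x"] by (simp add: distrib_right)
  qed
  then show ?thesis by (simp add: wbound_def)
qed

text \<open>The infimum of the radii is itself a radius: the bounds with slack 1/(j+1) fail on null
  sets, of which there are countably many.\<close>

lemma wbound_least:
  assumes "wbound n B"
  obtains M where "wbound n M" "\<And>M'. wbound n M' \<Longrightarrow> M \<le> M'"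
proof -
  define S where "S = {M. wbound n M}"
  have S: "S \<noteq> {}" "bdd_below S" using assms wboundD(3) by (auto simp: S_def intro!: bdd_belowI[of _ 0])
  have "AE x in lborel. norm (n x) \<le> (Inf S + 1 / real (Suc j)) * weight x powr r" for j
  proof -
    have "Inf S < Inf S + 1 / real (Suc j)" by simp
    then obtain M where M: "wbound n M" "M < Inf S + 1 / real (Suc j)"
      using cInf_lessD[OF S(1), of "Inf S + 1 / real (Suc j)"] unfolding S_def by blast
    show ?thesis
      using wboundD(2)[OF M(1)]
      by eventually_elim (meson M(2) less_imp_le mult_right_mono order_trans powr_ge_zero)
  qed
  then have "AE x in lborel. \<forall>j. norm (n x) \<le> (Inf S + 1 / real (Suc j)) * weight x powr r"
    by (simp add: AE_all_countable)
  then have "AE x in lborel. norm (n x) \<le> Inf S * weight x powr r"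
  proof eventually_elim
    case (elim x)
    have "(\<lambda>j. (Inf S + 1 / real (Suc j)) * weight x powr r) \<longlonglongrightarrow> (Inf S + 0) * weight x powr r"
      by (intro tendsto_intros LIMSEQ_Suc[OF lim_1_over_n])
    then show ?case using elim by (intro LIMSEQ_le_const) auto
  qed
  then have "wbound n (Inf S)" using assms by (simp add: wbound_def)
  moreover have "Inf S \<le> M'" if "wbound n M'" for M'
    using S that by (auto intro: cInf_lower simp: S_def)
  ultimately show ?thesis using that by blast
qed

text \<open>As in the theorem of Arzela and Ascoli, a diagonal subsequence converges at the
  rationals, and equicontinuity carries the Cauchy property to every point. Pointwise convergence is
  enough as a conclusion, since the integrable majorant \<open>v\<close> later turns it into
  convergence of integrals.\<close>

lemma oper_compact_convergence:
  assumes l: "l > 0" and N: "\<And>k. wbound (N k) 1"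
  obtains \<kappa> \<phi> where "strict_mono (\<kappa> :: nat \<Rightarrow> nat)" "\<phi> \<in> borel_measurable borel"
    "\<And>x. (\<lambda>k. oper \<sigma> l (N (\<kappa> k)) x) \<longlonglongrightarrow> \<phi> x"
proof -
  let ?f = "\<lambda>k. oper \<sigma> l (N k)"
  have "norm (?f k x) \<le> kern_const l" for k x
    using norm_oper_le[OF l N] by simp
  then obtain \<kappa> where \<kappa>: "strict_mono (\<kappa> :: nat \<Rightarrow> nat)"
    "\<And>q. q \<in> \<rat> \<Longrightarrow> \<exists>L. (\<lambda>k. ?f (\<kappa> k) q) \<longlonglongrightarrow> L"
    using function_convergent_subsequence[OF countable_rat, of ?f "kern_const l"] by metis
  have "Cauchy (\<lambda>k. ?f (\<kappa> k) x)" for x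
  proof (rule metric_CauchyI)
    fix e :: real assume "e > 0"
    have "x \<in> closure \<rat>" by (simp add: Rats_closure_real)
    then obtain X where X: "\<And>n. X n \<in> \<rat>" "X \<longlonglongrightarrow> x" unfolding closure_sequential by auto
    have "\<forall>\<^sub>F n in sequentially. kern_modulus \<sigma> l (X n) x < e / 3"
      by (rule order_tendstoD(2)[OF tendsto_kern_modulus[OF l X(2)]]) (use \<open>e > 0\<close> in simp)
    then obtain q where q: "q \<in> \<rat>" "kern_modulus \<sigma> l q x < e / 3"
      using X(1) by (auto dest!: eventually_happens)
    have d: "norm (?f k q - ?f k x) < e / 3" for k
      using norm_oper_diff_le[OF l N, of \<sigma> k q x] q(2) by simp
    have "Cauchy (\<lambda>k. ?f (\<kappa> k) q)" using \<kappa>(2)[OF q(1)] by (auto intro: LIMSEQ_imp_Cauchy)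
    then obtain M where M: "\<And>i j. i \<ge> M \<Longrightarrow> j \<ge> M \<Longrightarrow> dist (?f (\<kappa> i) q) (?f (\<kappa> j) q) < e / 3"
      using \<open>e > 0\<close> unfolding Cauchy_def by (meson divide_pos_pos zero_less_numeral)
    have "dist (?f (\<kappa> i) x) (?f (\<kappa> j) x) < e" if "i \<ge> M" "j \<ge> M" for i j
    proof -
      have "dist (?f (\<kappa> i) x) (?f (\<kappa> i) q) < e / 3" "dist (?f (\<kappa> j) q) (?f (\<kappa> j) x) < e / 3"
        using d by (simp_all add: dist_norm norm_minus_commute)
      then show ?thesis
        using M[OF that] dist_triangle[of "?f (\<kappa> i) x" "?f (\<kappa> j) x" "?f (\<kappa> i) q"]
          dist_triangle[of "?f (\<kappa> i) q" "?f (\<kappa> j) x" "?f (\<kappa> j) q"] by linarith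
    qed
    then show "\<exists>M. \<forall>m\<ge>M. \<forall>n\<ge>M. dist (?f (\<kappa> m) x) (?f (\<kappa> n) x) < e" by blast
  qed
  then have lim: "(\<lambda>k. ?f (\<kappa> k) x) \<longlonglongrightarrow> lim (\<lambda>k. ?f (\<kappa> k) x)" for x
    by (simp add: Cauchy_convergent_iff convergent_LIMSEQ_iff)
  have "(\<lambda>x. lim (\<lambda>k. ?f (\<kappa> k) x)) \<in> borel_measurable borel"
    by (rule borel_measurable_LIMSEQ_metric[OF _ lim]) (rule borel_measurable_oper[OF l N])
  then show ?thesis using that \<kappa>(1) lim by blast
qed

text \<open>Compactness of the operator upgrades injectivity of \<open>1 - oper\<close> to a bound from below.\<close>

lemma oper_bounded_below:
  assumes l: "l > 0"
    and inj: "\<And>n B. wbound n B \<Longrightarrow> (AE x in lborel. n x = oper \<sigma> l n x) \<Longrightarrow> (AE x in lborel. n x = 0)"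
  obtains c where "c > 0" "\<And>n B C. wbound n B \<Longrightarrow> wbound (\<lambda>x. n x - oper \<sigma> l n x) C \<Longrightarrow> wbound n (c * C)"
proof -
  have "\<exists>k. \<forall>n B C. wbound n B \<longrightarrow> wbound (\<lambda>x. n x - oper \<sigma> l n x) C \<longrightarrow> wbound n (real (Suc k) * C)"
  proof (rule ccontr)
    assume "\<not> ?thesis"
    then have "\<forall>k. \<exists>n B C. wbound n B \<and> wbound (\<lambda>x. n x - oper \<sigma> l n x) C \<and> \<not> wbound n (real (Suc k) * C)"
      by blast
    then obtain n B C where nBC: "\<And>k. wbound (n k) (B k)" "\<And>k. wbound (\<lambda>x. n k x - oper \<sigma> l (n k) x) (C k)"
      "\<And>k. \<not> wbound (n k) (real (Suc k) * C k)" by metis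
    have "\<exists>M. wbound (n k) M \<and> (\<forall>M'. wbound (n k) M' \<longrightarrow> M \<le> M')" for k
      using wbound_least[OF nBC(1)[of k]] by metis
    then obtain M where M: "\<And>k. wbound (n k) (M k)" "\<And>k M'. wbound (n k) M' \<Longrightarrow> M k \<le> M'" by metis
    have MC: "M k > real (Suc k) * C k" for k
    proof (rule ccontr)
      assume "\<not> M k > real (Suc k) * C k"
      then have "M k * weight x powr r \<le> real (Suc k) * C k * weight x powr r" for x
        by (intro mult_right_mono) auto
      then have "AE x in lborel. norm (n k x) \<le> real (Suc k) * C k * weight x powr r"
        using wboundD(2)[OF M(1)[of k]] by (auto elim!: eventually_mono intro: order_trans)
      then show False using nBC(3)[of k] wboundD(1)[OF M(1)[of k]] by (simp add: wbound_def)
    qed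
    have M0: "M k > 0" for k
      using MC[of k] wboundD(3)[OF nBC(2)[of k]] by (metis mult_nonneg_nonneg of_nat_0_le_iff order_le_less_trans)
    \<comment> \<open>Dividing by the minimal radius gives functions whose minimal radius is 1
      (\<open>N1\<close> and \<open>N3\<close>), while \<open>N k - oper \<sigma> l (N k)\<close>
      has radius at most 1/(k+1) (\<open>N2\<close>).\<close>
    define N where "N k x = of_real (1 / M k) * n k x" for k x
    have scale: "wbound (\<lambda>x. of_real t * f x) (t * A)" if "wbound f A" "t \<ge> 0" for f t A
    proof -
      have "AE x in lborel. norm (of_real t * f x) \<le> t * A * weight x powr r"
        using wboundD(2)[OF that(1)] by eventually_elim (use that in \<open>auto simp: norm_mult mult.assoc mult_left_mono\<close>)
      then show ?thesis using wboundD(1)[OF that(1)] by (simp add: wbound_def)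
    qed
    have N1: "wbound (N k) 1" for k
      using scale[OF M(1)[of k], of "1 / M k"] M0[of k] by (simp add: N_def[abs_def])
    have N2: "AE x in lborel. norm (N k x - oper \<sigma> l (N k) x) \<le> 1 / real (Suc k) * weight x powr r" for k
    proof -
      have eq: "of_real (1 / M k) * (n k x - oper \<sigma> l (n k) x) = N k x - oper \<sigma> l (N k) x" for x
        unfolding N_def[abs_def] oper_cmult by (simp add: right_diff_distrib)
      have "1 / M k * C k \<le> 1 / real (Suc k)"
        using MC[of k] M0[of k] by (simp add: field_simps)
      then have le: "1 / M k * C k * weight x powr r \<le> 1 / real (Suc k) * weight x powr r" for x
        by (rule mult_right_mono) simp
      have "wbound (\<lambda>x. of_real (1 / M k) * (n k x - oper \<sigma> l (n k) x)) (1 / M k * C k)"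
        using M0[of k] by (intro scale nBC) auto
      from wboundD(2)[OF this] show ?thesis
        unfolding eq by eventually_elim (rule order_trans[OF _ le])
    qed
    have N3: "1 \<le> M'" if "wbound (N k) M'" for k M'
    proof -
      have "wbound (\<lambda>x. of_real (M k) * N k x) (M k * M')" using that M0[of k] by (intro scale) auto
      moreover have "of_real (M k) * N k x = n k x" for x using M0[of k] by (simp add: N_def)
      ultimately have "M k \<le> M k * M'" using M(2) by auto
      then show ?thesis using M0[of k] by simp
    qed
    obtain \<kappa> \<phi> where \<kappa>: "strict_mono (\<kappa> :: nat \<Rightarrow> nat)" and [measurable]: "\<phi> \<in> borel_measurable borel"
      and f\<phi>: "\<And>x. (\<lambda>k. oper \<sigma> l (N (\<kappa> k)) x) \<longlonglongrightarrow> \<phi> x"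
      by (rule oper_compact_convergence[where N = N and \<sigma> = \<sigma>, OF l N1]) blast
    have [measurable]: "N k \<in> borel_measurable borel" for k using wboundD(1)[OF N1] .
    have "AE x in lborel. \<forall>k. norm (N k x - oper \<sigma> l (N k) x) \<le> 1 / real (Suc k) * weight x powr r"
      using N2 by (simp add: AE_all_countable)
    then have N\<phi>: "AE x in lborel. (\<lambda>k. N (\<kappa> k) x) \<longlonglongrightarrow> \<phi> x"
    proof eventually_elim
      case (elim x)
      have "(\<lambda>k. 1 / real (Suc k) * weight x powr r) \<longlonglongrightarrow> 0 * weight x powr r"
        by (intro tendsto_intros LIMSEQ_Suc[OF lim_1_over_n])
      then have lim: "(\<lambda>k. 1 / real (Suc k) * weight x powr r) \<longlonglongrightarrow> 0" by simp
      have "(\<lambda>k. N k x - oper \<sigma> l (N k) x) \<longlonglongrightarrow> 0"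
        by (rule Lim_null_comparison[OF _ lim]) (use elim in simp)
      then have "(\<lambda>k. N (\<kappa> k) x - oper \<sigma> l (N (\<kappa> k)) x) \<longlonglongrightarrow> 0"
        using LIMSEQ_subseq_LIMSEQ[OF _ \<kappa>] unfolding o_def by blast
      from tendsto_add[OF this f\<phi>[of x]] show ?case by simp
    qed
    have allN: "AE x in lborel. \<forall>k. norm (of_real (u x) * N k x) \<le> v x"
      unfolding AE_all_countable using wbound_potential[OF N1] by simp
    have "wbound \<phi> 1"
    proof -
      have "AE x in lborel. \<forall>k. norm (N k x) \<le> weight x powr r"
        unfolding AE_all_countable using wboundD(2)[OF N1] by simp
      with N\<phi> have "AE x in lborel. norm (\<phi> x) \<le> weight x powr r"
        by eventually_elim (rule LIMSEQ_le_const2[OF tendsto_norm], auto)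
      then show ?thesis by (simp add: wbound_def)
    qed
    moreover have "\<phi> x = oper \<sigma> l \<phi> x" for x
    proof (rule LIMSEQ_unique[OF f\<phi>])
      note [measurable] = borel_measurable_kern[OF l]
      show "(\<lambda>k. oper \<sigma> l (N (\<kappa> k)) x) \<longlonglongrightarrow> oper \<sigma> l \<phi> x"
        unfolding oper_def
      proof (rule integral_dominated_convergence[where w = "\<lambda>y. norm (kern \<sigma> l (x - y)) * v y"])
        show "integrable lborel (\<lambda>y. norm (kern \<sigma> l (x - y)) * v y)"
          by (intro integrable_kern_mult l v_measurable v_nonneg integrable_v integrable_v_square)
        show "AE y in lborel. (\<lambda>k. kern \<sigma> l (x - y) * (of_real (u y) * N (\<kappa> k) y))
            \<longlonglongrightarrow> kern \<sigma> l (x - y) * (of_real (u y) * \<phi> y)"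
          using N\<phi> by eventually_elim (auto intro!: tendsto_intros)
        show "AE y in lborel. norm (kern \<sigma> l (x - y) * (of_real (u y) * N (\<kappa> k) y)) \<le> norm (kern \<sigma> l (x - y)) * v y" for k
          using allN by eventually_elim (auto simp: norm_mult intro!: mult_left_mono)
      qed measurable
    qed
    ultimately have "AE x in lborel. \<phi> x = 0" by (intro inj[of \<phi> 1]) auto
    \<comment> \<open>Since the limit \<open>\<phi>\<close> vanishes, \<open>h k\<close> tends to 0
      almost everywhere, hence in L1 and L2 by the majorant \<open>v\<close>. This makes the images
      under the operator small uniformly in x, which pointwise convergence alone would not
      give.\<close>
    define h where "h k y = norm (of_real (u y) * N (\<kappa> k) y)" for k y
    have [measurable]: "h k \<in> borel_measurable borel" for k unfolding h_def by measurable
    have h0: "AE y in lborel. (\<lambda>k. h k y) \<longlonglongrightarrow> 0"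
      using N\<phi> \<open>AE x in lborel. \<phi> x = 0\<close>
    proof eventually_elim
      case (elim y)
      then have "(\<lambda>k. of_real (u y) * N (\<kappa> k) y) \<longlonglongrightarrow> of_real (u y) * 0" by (intro tendsto_intros) auto
      then show ?case unfolding h_def by (auto intro: tendsto_norm_zero)
    qed
    have hv: "AE y in lborel. norm (h k y) \<le> v y" for k
      using allN by eventually_elim (simp add: h_def)
    have h2: "AE y in lborel. norm ((h k y)\<^sup>2) \<le> (v y)\<^sup>2" for k
      using hv[of k] by eventually_elim (auto intro!: power_mono simp: h_def)
    have L1: "(\<lambda>k. LINT y|lborel. h k y) \<longlonglongrightarrow> (LINT (y::real)|lborel. 0)"
      by (rule integral_dominated_convergence[where w = v]) (use h0 hv integrable_v in auto)
    have L2: "(\<lambda>k. LINT y|lborel. (h k y)\<^sup>2) \<longlonglongrightarrow> (LINT (y::real)|lborel. 0)"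
    proof (rule integral_dominated_convergence[where w = "\<lambda>y. (v y)\<^sup>2"])
      show "AE y in lborel. (\<lambda>k. (h k y)\<^sup>2) \<longlonglongrightarrow> 0"
        using h0 by eventually_elim (auto intro!: tendsto_eq_intros)
    qed (use h2 integrable_v_square in auto)
    \<comment> \<open>Fixed before \<open>k\<close> is chosen: the energy term is then at most 1/8,
      and the remaining two terms are below 1/8 for large \<open>k\<close>. So the image is bounded
      by 1/4, the defect for \<open>k \<ge> 4\<close> by 1/4 of the weight, and the radius 1/2
      contradicts \<open>N3\<close>.\<close>
    define e where "e = 1 / (8 * (osc_energy l + 1))"
    have e: "e > 0" "e * osc_energy l \<le> 1 / 8"
      using osc_energy_nonneg[of l] by (auto simp: e_def field_simps)
    have "(\<lambda>k. (LINT y|lborel. h k y) + (LINT y|lborel. (h k y)\<^sup>2) / e) \<longlonglongrightarrow> 0 + 0 / e"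
      using L1 L2 e by (intro tendsto_intros) auto
    then have "\<forall>\<^sub>F k in sequentially. (LINT y|lborel. h k y) + (LINT y|lborel. (h k y)\<^sup>2) / e < 1 / 8"
      by (rule order_tendstoD) simp
    moreover have "\<forall>\<^sub>F k in sequentially. k \<ge> (4::nat)" by (rule eventually_ge_at_top)
    ultimately have "\<forall>\<^sub>F k in sequentially. (LINT y|lborel. h k y) + (LINT y|lborel. (h k y)\<^sup>2) / e < 1 / 8 \<and> 4 \<le> k"
      by (rule eventually_conj)
    then obtain k where k: "(LINT y|lborel. h k y) + (LINT y|lborel. (h k y)\<^sup>2) / e < 1 / 8" "4 \<le> k"
      by (auto dest!: eventually_happens)
    have hI: "integrable lborel (h k)" "integrable lborel (\<lambda>y. (h k y)\<^sup>2)"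
    proof -
      show "integrable lborel (h k)"
        by (rule Bochner_Integration.integrable_bound[OF integrable_v]) (use hv[of k] in \<open>auto elim: eventually_mono\<close>)
      show "integrable lborel (\<lambda>y. (h k y)\<^sup>2)"
        by (rule Bochner_Integration.integrable_bound[OF integrable_v_square]) (use h2[of k] in \<open>auto elim: eventually_mono\<close>)
    qed
    have small: "norm (oper \<sigma> l (N (\<kappa> k)) x) \<le> 1 / 4" for x
    proof -
      have "norm (oper \<sigma> l (N (\<kappa> k)) x) \<le> (LINT y|lborel. norm (kern \<sigma> l (x - y) * (of_real (u y) * N (\<kappa> k) y)))"
        unfolding oper_def by (rule integral_norm_bound)
      also have "\<dots> = (LINT y|lborel. norm (kern \<sigma> l (x - y)) * h k y)"
        by (simp add: h_def norm_mult)
      also have "\<dots> \<le> (LINT y|lborel. h k y) + e * osc_energy l + (LINT y|lborel. (h k y)\<^sup>2) / e"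
        by (rule integral_kern_mult_le[OF l _ _ hI e(1)]) (auto simp: h_def)
      finally show ?thesis using k e by linarith
    qed
    have "wbound (N (\<kappa> k)) (1 / 2)"
    proof -
      have "k \<le> \<kappa> k" using seq_suble[OF \<kappa>] .
      then have \<kappa>4: "1 / real (Suc (\<kappa> k)) \<le> 1 / 4" using k(2) by (simp add: field_simps)
      have "AE x in lborel. norm (N (\<kappa> k) x) \<le> 1 / 2 * weight x powr r"
        using N2[of "\<kappa> k"]
      proof eventually_elim
        case (elim x)
        have w: "1 \<le> weight x powr r" using weight_ge_1 r_pos by (intro ge_one_powr_ge_zero) auto
        have "1 / real (Suc (\<kappa> k)) * weight x powr r \<le> 1 / 4 * weight x powr r"
          using \<kappa>4 by (rule mult_right_mono) simp
        then show ?case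
          using elim small[of x] w norm_triangle_ineq2[of "N (\<kappa> k) x" "oper \<sigma> l (N (\<kappa> k)) x"] by linarith
      qed
      then show ?thesis by (simp add: wbound_def)
    qed
    from N3[OF this] show False by simp
  qed
  then obtain k where "\<forall>n B C. wbound n B \<longrightarrow> wbound (\<lambda>x. n x - oper \<sigma> l n x) C \<longrightarrow> wbound n (real (Suc k) * C)" ..
  then show ?thesis using that[of "real (Suc k)"] by auto
qed

text \<open>Fubini for \<open>f\<close>. Absolute integrability holds because the inner integral of
  the norm is at most \<open>B * kern_const l\<close> times the factor \<open>u a\<close>, which is
  integrable in the outer variable.\<close>

lemma oper_adjoint:
  assumes l: "l > 0" and a: "wbound a A" and b: "wbound b B"
  shows "(LINT x|lborel. of_real (u x) * a x * cnj (oper Below l b x))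
    = (LINT y|lborel. of_real (u y) * cnj (b y) * oper Above l a y)"
proof -
  note [measurable] = wboundD(1)[OF a] wboundD(1)[OF b] borel_measurable_kern[OF l] borel_measurable_oper[OF l]
  have [measurable]: "cnj \<in> borel_measurable borel"
    by (intro borel_measurable_continuous_onI continuous_intros)
  have [measurable]: "(\<lambda>z. kern Above l (snd z - fst z)) \<in> borel_measurable (borel \<Otimes>\<^sub>M borel)"
    by (rule measurable_compose[OF _ borel_measurable_kern[OF l]]) measurable
  define f where "f x y = of_real (u x) * a x * (of_real (u y) * cnj (b y) * kern Above l (y - x))" for x y
  have f_eq: "f x y = of_real (u x) * a x * cnj (kern Below l (x - y) * (of_real (u y) * b y))" for x y
    by (simp add: f_def cnj_kern_Below mult_ac)
  have f_eq': "f x y = of_real (u y) * cnj (b y) * (kern Above l (y - x) * (of_real (u x) * a x))" for x y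
    by (simp add: f_def mult_ac)
  have inner: "(LINT y|lborel. f x y) = of_real (u x) * a x * cnj (oper Below l b x)" for x
    unfolding f_eq oper_def integral_mult_right_zero Bochner_Integration.integral_cnj ..
  have inner': "(LINT x|lborel. f x y) = of_real (u y) * cnj (b y) * oper Above l a y" for y
    unfolding f_eq' oper_def integral_mult_right_zero ..
  have bound: "(LINT y|lborel. norm (f x y)) \<le> norm (of_real (u x) * a x) * (B * kern_const l)" for x
  proof -
    have "(LINT y|lborel. norm (f x y)) = norm (of_real (u x) * a x) * (LINT y|lborel. norm (kern Below l (x - y) * (of_real (u y) * b y)))"
      unfolding f_eq norm_mult complex_mod_cnj by simp
    also have "(LINT y|lborel. norm (kern Below l (x - y) * (of_real (u y) * b y)))
        \<le> (LINT y|lborel. B * (norm (kern Below l (x - y)) * v y))"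
    proof (rule integral_mono_AE)
      show "integrable lborel (\<lambda>y. B * (norm (kern Below l (x - y)) * v y))"
        by (intro integrable_mult_right integrable_kern_mult l v_measurable v_nonneg integrable_v integrable_v_square)
      show "AE y in lborel. norm (kern Below l (x - y) * (of_real (u y) * b y)) \<le> B * (norm (kern Below l (x - y)) * v y)"
        using wbound_potential[OF b]
      proof eventually_elim
        case (elim y)
        then show ?case using mult_left_mono[OF elim, of "norm (kern Below l (x - y))"] by (simp add: norm_mult mult_ac)
      qed
    qed (use integrable_oper[OF l b] in auto)
    also have "\<dots> \<le> B * kern_const l"
      using integral_kern_mult_le[of l v 1 Below x] l wboundD(3)[OF b] integrable_v integrable_v_square v_nonneg
      by (simp add: kern_const_def mult_left_mono)
    finally show ?thesis by (simp add: mult_left_mono)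
  qed
  have "integrable (lborel \<Otimes>\<^sub>M lborel) (case_prod f)"
  proof (rule lborel_pair.Fubini_integrable)
    show "case_prod f \<in> borel_measurable (lborel \<Otimes>\<^sub>M lborel)"
      unfolding f_def measurable_lborel1 measurable_cong_sets[OF sets_pair_measure_cong[OF sets_lborel sets_lborel] refl]
      by (simp add: case_prod_beta)
    show "AE x in lborel. integrable lborel (\<lambda>y. case_prod f (x, y))"
      using integrable_oper[OF l b, of Below]
      by (simp add: f_eq del: complex_cnj_mult)
    show "integrable lborel (\<lambda>x. LINT y|lborel. norm (case_prod f (x, y)))"
    proof (rule Bochner_Integration.integrable_bound)
      show "integrable lborel (\<lambda>x. norm (of_real (u x) * a x) * (B * kern_const l))"
        using integrable_potential_mult[OF a] by auto
      show "(\<lambda>x. LINT y|lborel. norm (case_prod f (x, y))) \<in> borel_measurable lborel"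
        unfolding f_def by measurable
      show "AE x in lborel. norm (LINT y|lborel. norm (case_prod f (x, y))) \<le> norm (norm (of_real (u x) * a x) * (B * kern_const l))"
        using bound by (intro AE_I2) (auto intro: order_trans[OF _ abs_ge_self])
    qed
  qed
  from lborel_pair.Fubini_integral[OF this] show ?thesis
    by (simp add: inner inner')
qed

end

section \<open>Dependence on the spectral parameter\<close>

lemma weight_diff_le: "weight (x - y) \<le> weight x * weight y"
  by (auto simp: weight_def algebra_simps abs_mult[symmetric])

lemma has_vector_derivative_of_power_bound:
  fixes f :: "real \<Rightarrow> complex"
  assumes "0 < \<gamma>" "0 < \<delta>"
    and le: "\<And>l. \<bar>l - k\<bar> < \<delta> \<Longrightarrow> norm (f l - f k - of_real (l - k) * D) \<le> C * (\<bar>l - k\<bar> * \<bar>l - k\<bar> powr \<gamma>)"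
  shows "(f has_vector_derivative D) (at k)"
  unfolding has_vector_derivative_def has_derivative_at
proof (intro conjI bounded_linear_scaleR_left)
  have "((\<lambda>h. C * \<bar>h\<bar> powr \<gamma>) \<longlongrightarrow> C * 0) (at 0)"
  proof (intro tendsto_mult_left)
    have "((\<lambda>h::real. \<bar>h\<bar> powr \<gamma>) \<longlongrightarrow> \<bar>0\<bar> powr \<gamma>) (at 0)"
      using assms by (intro tendsto_powr' tendsto_rabs tendsto_ident_at tendsto_const) auto
    then show "((\<lambda>h::real. \<bar>h\<bar> powr \<gamma>) \<longlongrightarrow> 0) (at 0)" by simp
  qed
  then have lim: "((\<lambda>h. C * \<bar>h\<bar> powr \<gamma>) \<longlongrightarrow> 0) (at 0)" by simp
  have "\<forall>\<^sub>F h in at 0. norm (norm (f (k + h) - f k - h *\<^sub>R D) / norm h) \<le> C * \<bar>h\<bar> powr \<gamma>"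
    unfolding eventually_at
  proof (intro exI[of _ \<delta>] conjI ballI impI)
    fix h :: real assume h: "h \<noteq> 0 \<and> dist h 0 < \<delta>"
    then have "norm (f (k + h) - f k - h *\<^sub>R D) \<le> C * (\<bar>h\<bar> * \<bar>h\<bar> powr \<gamma>)"
      using le[of "k + h"] by (simp add: scaleR_conv_of_real)
    then show "norm (norm (f (k + h) - f k - h *\<^sub>R D) / norm h) \<le> C * \<bar>h\<bar> powr \<gamma>"
      using h by (simp add: field_simps)
  qed (use assms in auto)
  then show "(\<lambda>h. norm (f (k + h) - f k - h *\<^sub>R D) / norm h) \<midarrow>0\<rightarrow> 0"
    by (rule Lim_null_comparison[OF _ lim])
qed

context weighted_potential
begin

definition v_mass :: real where "v_mass = (LINT x|lborel. v x)"
definition v_moment :: real where "v_moment = (LINT x|lborel. v x * weight x powr \<gamma>)"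

lemma v_mass_nonneg: "v_mass \<ge> 0"
  unfolding v_mass_def using v_nonneg by (auto intro!: integral_nonneg_AE)

lemma norm_integral_potential_le:
  assumes "wbound n B"
  shows "norm (LINT x|lborel. of_real (u x) * n x) \<le> B * v_mass"
  using integral_norm_bound_integral_AE[OF integrable_potential_mult[OF assms]
      integrable_mult_right[OF integrable_v] wbound_potential[OF assms]]
  by (simp add: v_mass_def)

lemma oper_diff_param:
  assumes "l > 0" "k > 0" "wbound n B"
  shows "oper \<sigma> l n x - oper \<sigma> k n x
    = (LINT y|lborel. (osc_int l (x - y) - osc_int k (x - y)) / (2 * of_real pi) * (of_real (u y) * n y))"
    and "integrable lborel (\<lambda>y. (osc_int l (x - y) - osc_int k (x - y)) / (2 * of_real pi) * (of_real (u y) * n y))"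
proof -
  have eq: "(osc_int l (x - y) - osc_int k (x - y)) / (2 * of_real pi) * (of_real (u y) * n y)
      = kern \<sigma> l (x - y) * (of_real (u y) * n y) - kern \<sigma> k (x - y) * (of_real (u y) * n y)" for y
    unfolding kern_diff[of \<sigma>, symmetric] by (rule left_diff_distrib)
  show "oper \<sigma> l n x - oper \<sigma> k n x
    = (LINT y|lborel. (osc_int l (x - y) - osc_int k (x - y)) / (2 * of_real pi) * (of_real (u y) * n y))"
    unfolding oper_def eq using integrable_oper assms by (intro Bochner_Integration.integral_diff[symmetric])
  show "integrable lborel (\<lambda>y. (osc_int l (x - y) - osc_int k (x - y)) / (2 * of_real pi) * (of_real (u y) * n y))"
    unfolding eq using integrable_oper assms by (intro Bochner_Integration.integrable_diff)
qed

lemma norm_oper_param_diff_le: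
  assumes "a > 0" "a \<le> l" "a \<le> k" "wbound n B"
  shows "norm (oper \<sigma> l n x - oper \<sigma> k n x) \<le> \<bar>l - k\<bar> / a * (B * v_mass)"
proof -
  have "l > 0" "k > 0" using assms by auto
  note d = oper_diff_param[OF this assms(4)]
  have "norm (oper \<sigma> l n x - oper \<sigma> k n x) \<le> (LINT y|lborel. \<bar>l - k\<bar> / a * (B * v y))"
    unfolding d(1)
  proof (rule integral_norm_bound_integral_AE[OF d(2)])
    show "AE y in lborel. norm ((osc_int l (x - y) - osc_int k (x - y)) / (2 * of_real pi) * (of_real (u y) * n y))
        \<le> \<bar>l - k\<bar> / a * (B * v y)"
      using wbound_potential[OF assms(4)]
    proof eventually_elim
      case (elim y)
      have "norm ((osc_int l (x - y) - osc_int k (x - y)) / (2 * of_real pi)) \<le> norm (osc_int l (x - y) - osc_int k (x - y)) / 1"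
        unfolding norm_divide using pi_gt3 by (intro divide_left_mono) (auto simp: norm_mult)
      also have "\<dots> \<le> \<bar>l - k\<bar> / a" using osc_int_lipschitz[OF assms(1-3)] by simp
      finally show ?case
        unfolding norm_mult[of "_ / _"] using elim assms(1) by (intro mult_mono) auto
    qed
  qed (use integrable_v in auto)
  then show ?thesis by (simp add: v_mass_def)
qed

text \<open>The parameter derivative of the kernel is a multiple of exp(-i(x-y)k), which factors
  into a function of x and a function of y: to first order the operator changes by a rank one
  operator. In the remainder, submultiplicativity of the weight splits the factor in x - y; the part
  in y is absorbed by \<open>v_moment\<close>, the part in x stays in the bound.\<close>

lemma oper_linearization:
  assumes "a > 0" "a \<le> l" "a \<le> k" "\<bar>l - k\<bar> \<le> 1" "wbound n B"
  shows "norm (oper \<sigma> l n x - oper \<sigma> k n x + of_real ((l - k) / (2 * pi * k)) * exp (- (\<i> * of_real (x * k)))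
      * (LINT y|lborel. of_real (u y) * (exp (\<i> * of_real (y * k)) * n y)))
    \<le> (2 / a + 1 / a\<^sup>2) * \<bar>l - k\<bar> * \<bar>l - k\<bar> powr \<gamma> * (B * v_moment) * weight x powr \<gamma>"
proof -
  have lk: "l > 0" "k > 0" using assms by auto
  note d = oper_diff_param[OF lk assms(5)]
  define c where "c = (2 / a + 1 / a\<^sup>2) * \<bar>l - k\<bar> * \<bar>l - k\<bar> powr \<gamma>"
  have c0: "c \<ge> 0" using assms(1) by (simp add: c_def)
  define D where "D y = (osc_int l y - osc_int k y) / (2 * of_real pi)
    + of_real ((l - k) / (2 * pi * k)) * exp (- (\<i> * of_real (y * k)))" for y
  have e1: "wbound (\<lambda>y. exp (\<i> * of_real (y * k)) * n y) B"
    by (rule wbound_mult_unimodular[OF assms(5)]) (auto simp: of_real_mult[symmetric] simp del: of_real_mult)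
  have eq: "of_real ((l - k) / (2 * pi * k)) * exp (- (\<i> * of_real (x * k))) * (of_real (u y) * (exp (\<i> * of_real (y * k)) * n y))
     = of_real ((l - k) / (2 * pi * k)) * exp (- (\<i> * of_real ((x - y) * k))) * (of_real (u y) * n y)" for y
  proof -
    have "exp (- (\<i> * of_real ((x - y) * k))) = exp (- (\<i> * of_real (x * k))) * exp (\<i> * of_real (y * k))"
      unfolding exp_add[symmetric] by (simp add: algebra_simps)
    then show ?thesis by (simp add: mult_ac)
  qed
  have i1: "integrable lborel (\<lambda>y. of_real ((l - k) / (2 * pi * k)) * exp (- (\<i> * of_real ((x - y) * k))) * (of_real (u y) * n y))"
    unfolding eq[symmetric] by (intro integrable_mult_right integrable_potential_mult[OF e1])
  have "oper \<sigma> l n x - oper \<sigma> k n x + of_real ((l - k) / (2 * pi * k)) * exp (- (\<i> * of_real (x * k)))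
      * (LINT y|lborel. of_real (u y) * (exp (\<i> * of_real (y * k)) * n y))
    = (LINT y|lborel. D (x - y) * (of_real (u y) * n y))"
    unfolding d(1) integral_mult_right_zero[symmetric] eq D_def distrib_right
    by (rule Bochner_Integration.integral_add[symmetric, OF d(2) i1])
  also have "norm \<dots> \<le> (LINT y|lborel. c * weight x powr \<gamma> * (B * (v y * weight y powr \<gamma>)))"
  proof (rule integral_norm_bound_integral_AE)
    show "integrable lborel (\<lambda>y. D (x - y) * (of_real (u y) * n y))"
      unfolding D_def distrib_right by (rule Bochner_Integration.integrable_add[OF d(2) i1])
    show "AE y in lborel. norm (D (x - y) * (of_real (u y) * n y)) \<le> c * weight x powr \<gamma> * (B * (v y * weight y powr \<gamma>))"
      using wbound_potential[OF assms(5)] AE_lborel_singleton[of x]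
    proof eventually_elim
      case (elim y)
      let ?E = "osc_int l (x - y) - osc_int k (x - y) + of_real (l - k) * (exp (- (\<i> * of_real ((x - y) * k))) / of_real k)"
      have "D (x - y) = ?E / (2 * of_real pi)"
        using lk by (simp add: D_def add_divide_distrib field_simps)
      then have "norm (D (x - y)) = norm ?E / (2 * pi)"
        by (simp only: norm_divide norm_mult) simp
      also have "\<dots> \<le> norm ?E / 1" using pi_gt3 by (intro divide_left_mono) auto
      also have "\<dots> \<le> c * weight (x - y) powr \<gamma>"
        unfolding c_def using osc_int_linearization[OF assms(1-4) \<gamma>_pos less_imp_le[OF \<gamma>_less], of "x - y"] elim by simp
      also have "\<dots> \<le> c * (weight x powr \<gamma> * weight y powr \<gamma>)"
      proof -
        have "weight (x - y) powr \<gamma> \<le> (weight x * weight y) powr \<gamma>"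
          using weight_diff_le[of x y] weight_pos[of "x - y"] \<gamma>_pos by (intro powr_mono2) auto
        then show ?thesis
          using c0 weight_pos[of x] weight_pos[of y] by (auto simp: powr_mult intro!: mult_left_mono)
      qed
      finally have "norm (D (x - y)) * norm (of_real (u y) * n y) \<le> c * (weight x powr \<gamma> * weight y powr \<gamma>) * (B * v y)"
        using elim c0 by (intro mult_mono) auto
      then show ?case by (simp only: norm_mult) (simp add: mult_ac)
    qed
  qed (use integrable_v_weight in auto)
  also have "\<dots> = c * (B * v_moment) * weight x powr \<gamma>"
    by (simp add: v_moment_def)
  finally show ?thesis by (simp only: c_def)
qed

section \<open>Solutions of the conjugated equation and their stability in the parameter\<close>

definition solution :: "side \<Rightarrow> real \<Rightarrow> (real \<Rightarrow> complex) \<Rightarrow> (real \<Rightarrow> complex) \<Rightarrow> bool" where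
  "solution \<sigma> l h n \<longleftrightarrow> (\<exists>B. wbound n B) \<and> (AE x in lborel. n x = h x + oper \<sigma> l n x)"

definition regular :: "side \<Rightarrow> real \<Rightarrow> bool" where
  "regular \<sigma> l \<longleftrightarrow> (\<forall>n. solution \<sigma> l (\<lambda>x. 0) n \<longrightarrow> (AE x in lborel. n x = 0))"

lemma wbound_mono: "wbound n A \<Longrightarrow> A \<le> B \<Longrightarrow> wbound n B"
  unfolding wbound_def
  by (elim conjE, intro conjI, assumption)
    (elim eventually_mono, erule order_trans, rule mult_right_mono, auto)

lemma wbound_of_bounded:
  assumes "n \<in> borel_measurable borel" "\<And>x. norm (n x) \<le> B"
  shows "wbound n B"
proof -
  have "norm (n x) \<le> B * weight x powr r" for x
    using assms(2)[of x] norm_ge_zero[of "n x"] weight_ge_1[of x] r_pos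
      mult_left_mono[OF ge_one_powr_ge_zero[of "weight x" r], of B] by linarith
  then show ?thesis using assms(1) by (simp add: wbound_def)
qed

text \<open>A bound from below survives small perturbations of the operator. Written for the minimal
  radius \<open>M\<close> of \<open>n\<close>, the perturbation returns at most M/2 on the
  right-hand side, which is absorbed on the left and doubles the constant.\<close>

lemma locally_uniformly_bounded_below:
  assumes l0: "l0 > 0" and reg: "regular \<sigma> l0"
  obtains \<delta> c where "0 < \<delta>" "\<delta> \<le> l0 / 2" "c > 0"
    "\<And>l n B C. \<bar>l - l0\<bar> \<le> \<delta> \<Longrightarrow> wbound n B \<Longrightarrow> wbound (\<lambda>x. n x - oper \<sigma> l n x) C \<Longrightarrow> wbound n (c * C)"
proof -
  obtain c where c: "c > 0" "\<And>n B C. wbound n B \<Longrightarrow> wbound (\<lambda>x. n x - oper \<sigma> l0 n x) C \<Longrightarrow> wbound n (c * C)"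
  proof (rule oper_bounded_below[OF l0, of \<sigma>])
    fix n B assume "wbound n B" "AE x in lborel. n x = oper \<sigma> l0 n x"
    then have "solution \<sigma> l0 (\<lambda>x. 0) n" unfolding solution_def by auto
    then show "AE x in lborel. n x = 0" using reg unfolding regular_def by blast
  qed blast
  \<comment> \<open>The first entry keeps \<open>l\<close> above \<open>l0 / 2\<close>, where the
    operator is Lipschitz with constant \<open>v_mass / (l0 / 2)\<close>; the second makes
    \<open>c\<close> times the perturbation at most 1/2. Adding 1 to \<open>v_mass\<close> avoids a
    zero denominator.\<close>
  define \<delta> where "\<delta> = min (l0 / 2) (l0 / (4 * c * (v_mass + 1)))"
  have \<delta>: "0 < \<delta>" "\<delta> \<le> l0 / 2" using l0 c(1) v_mass_nonneg by (auto simp: \<delta>_def)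
  have small: "c * (\<delta> / (l0 / 2) * v_mass) \<le> 1 / 2"
  proof -
    have "\<delta> / (l0 / 2) \<le> (l0 / (4 * c * (v_mass + 1))) / (l0 / 2)"
      unfolding \<delta>_def using l0 by (intro divide_right_mono) auto
    also have "\<dots> = 1 / (2 * c * (v_mass + 1))"
    proof -
      have "(l0 / (4 * c * W)) / (l0 / 2) = 1 / (2 * c * W)" if "W > 0" for W
        using l0 c(1) that by (simp add: field_simps)
      from this[of "v_mass + 1"] show ?thesis using v_mass_nonneg by linarith
    qed
    finally have "\<delta> / (l0 / 2) * v_mass \<le> 1 / (2 * c * (v_mass + 1)) * v_mass"
      using v_mass_nonneg by (rule mult_right_mono)
    then have "c * (\<delta> / (l0 / 2) * v_mass) \<le> c * (1 / (2 * c * (v_mass + 1)) * v_mass)"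
      using c(1) by (intro mult_left_mono) auto
    also have "\<dots> = v_mass / (v_mass + 1) / 2" using c(1) by simp
    also have "\<dots> \<le> 1 / 2" using v_mass_nonneg by (intro divide_right_mono) auto
    finally show ?thesis .
  qed
  have "wbound n (2 * c * C)"
    if l: "\<bar>l - l0\<bar> \<le> \<delta>" and n: "wbound n B" and nC: "wbound (\<lambda>x. n x - oper \<sigma> l n x) C" for l n B C
  proof -
    obtain M where M: "wbound n M" "\<And>M'. wbound n M' \<Longrightarrow> M \<le> M'" using wbound_least[OF n] by metis
    have "l0 / 2 \<le> l" using l \<delta> by linarith
    then have lpos: "l > 0" using l0 by simp
    note [measurable] = wboundD(1)[OF M(1)] borel_measurable_oper[OF l0 M(1)] borel_measurable_oper[OF lpos M(1)]
    have "wbound (\<lambda>x. oper \<sigma> l0 n x - oper \<sigma> l n x) (\<delta> / (l0 / 2) * (M * v_mass))"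
    proof (rule wbound_of_bounded)
      fix x
      have "norm (oper \<sigma> l0 n x - oper \<sigma> l n x) \<le> \<bar>l0 - l\<bar> / (l0 / 2) * (M * v_mass)"
        by (rule norm_oper_param_diff_le[OF _ _ \<open>l0 / 2 \<le> l\<close> M(1)]) (use l0 in auto)
      also have "\<dots> \<le> \<delta> / (l0 / 2) * (M * v_mass)"
        using l l0 v_mass_nonneg wboundD(3)[OF M(1)] by (intro mult_right_mono divide_right_mono) auto
      finally show "norm (oper \<sigma> l0 n x - oper \<sigma> l n x) \<le> \<delta> / (l0 / 2) * (M * v_mass)" .
    qed measurable
    from wbound_minus[OF nC this] have "wbound (\<lambda>x. n x - oper \<sigma> l0 n x) (C + \<delta> / (l0 / 2) * (M * v_mass))"
      by simp
    from M(2)[OF c(2)[OF M(1) this]] have "M \<le> c * C + M * (c * (\<delta> / (l0 / 2) * v_mass))"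
      by (simp add: algebra_simps)
    also have "\<dots> \<le> c * C + M * (1 / 2)"
      using small wboundD(3)[OF M(1)] by (intro add_left_mono mult_left_mono) auto
    finally have "M \<le> 2 * c * C" by simp
    then show ?thesis using wbound_mono[OF M(1)] by blast
  qed
  then show ?thesis using that[of \<delta> "2 * c"] \<delta> c(1) by auto
qed

text \<open>The difference of two solutions has defect \<open>h - g\<close> plus an operator
  increment applied to \<open>m\<close>. The increment is Lipschitz in the parameter, so the source
  alone limits the regularity: solutions with constant source are Lipschitz, those with source
  \<open>wave l\<close> Hoelder with exponent \<open>\<gamma>\<close>.\<close>

lemma solution_locally_holder:
  assumes l0: "l0 > 0" and reg: "regular \<sigma> l0"
  obtains \<delta> c where "0 < \<delta>" "\<delta> \<le> l0 / 2" "c > 0"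
    "\<And>l h n. \<bar>l - l0\<bar> \<le> \<delta> \<Longrightarrow> wbound h 1 \<Longrightarrow> solution \<sigma> l h n \<Longrightarrow> wbound n c"
    "\<And>l k h g n m D. \<bar>l - l0\<bar> \<le> \<delta> \<Longrightarrow> \<bar>k - l0\<bar> \<le> \<delta> \<Longrightarrow> wbound h 1 \<Longrightarrow> wbound g 1 \<Longrightarrow>
      wbound (\<lambda>x. h x - g x) D \<Longrightarrow> solution \<sigma> l h n \<Longrightarrow> solution \<sigma> k g m \<Longrightarrow>
      wbound (\<lambda>x. n x - m x) (c * (D + \<bar>l - k\<bar>))"
proof -
  obtain \<delta> c where \<delta>: "0 < \<delta>" "\<delta> \<le> l0 / 2" and c: "c > 0" and
    below: "\<And>l n B C. \<bar>l - l0\<bar> \<le> \<delta> \<Longrightarrow> wbound n B \<Longrightarrow> wbound (\<lambda>x. n x - oper \<sigma> l n x) C \<Longrightarrow> wbound n (c * C)"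
    by (rule locally_uniformly_bounded_below[OF l0 reg]) blast
  have lb: "l0 / 2 \<le> l" "l > 0" if "\<bar>l - l0\<bar> \<le> \<delta>" for l using that \<delta> l0 by auto
  have bd: "wbound n c" if l: "\<bar>l - l0\<bar> \<le> \<delta>" and h: "wbound h 1" and s: "solution \<sigma> l h n" for l h n
  proof -
    obtain B where n: "wbound n B" and eq: "AE x in lborel. n x = h x + oper \<sigma> l n x"
      using s by (auto simp: solution_def)
    have "wbound (\<lambda>x. n x - oper \<sigma> l n x) 1"
      unfolding wbound_def
    proof
      show "(\<lambda>x. n x - oper \<sigma> l n x) \<in> borel_measurable borel"
        using borel_measurable_oper[OF lb(2)[OF l] n] wboundD(1)[OF n] by measurable
      show "AE x in lborel. norm (n x - oper \<sigma> l n x) \<le> 1 * weight x powr r"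
        using eq wboundD(2)[OF h] by eventually_elim (simp add: algebra_simps)
    qed
    from below[OF l n this] show ?thesis by simp
  qed
  \<comment> \<open>One constant for both conclusions: \<open>c\<close> bounds a single solution,
    and the second summand accounts for the operator increment applied to a solution of radius
    \<open>c\<close>.\<close>
  define c' where "c' = c * (1 + c * v_mass / (l0 / 2))"
  have c': "c \<le> c'" "c' > 0"
  proof -
    have "0 \<le> c * v_mass / (l0 / 2)" using c v_mass_nonneg l0 by auto
    then show "c \<le> c'" unfolding c'_def using c mult_left_mono[of 1 "1 + c * v_mass / (l0 / 2)" c] by simp
    then show "c' > 0" using c by simp
  qed
  have diff: "wbound (\<lambda>x. n x - m x) (c' * (D + \<bar>l - k\<bar>))"
    if l: "\<bar>l - l0\<bar> \<le> \<delta>" and k: "\<bar>k - l0\<bar> \<le> \<delta>" and h: "wbound h 1" and g: "wbound g 1"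
      and hg: "wbound (\<lambda>x. h x - g x) D" and sn: "solution \<sigma> l h n" and sm: "solution \<sigma> k g m" for l k h g n m D
  proof -
    have n: "wbound n c" and m: "wbound m c" using bd l k h g sn sm by blast+
    have eq: "AE x in lborel. n x = h x + oper \<sigma> l n x" "AE x in lborel. m x = g x + oper \<sigma> k m x"
      using sn sm by (auto simp: solution_def)
    note [measurable] = wboundD(1)[OF n] wboundD(1)[OF m] borel_measurable_oper[OF lb(2)[OF l] n]
      borel_measurable_oper[OF lb(2)[OF k] m] borel_measurable_oper[OF lb(2)[OF l] m]
      borel_measurable_oper[OF lb(2)[OF l] wbound_minus[OF n m]]
    have "wbound (\<lambda>x. oper \<sigma> k m x - oper \<sigma> l m x) (\<bar>k - l\<bar> / (l0 / 2) * (c * v_mass))"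
      by (rule wbound_of_bounded) (measurable, rule norm_oper_param_diff_le[OF _ lb(1)[OF k] lb(1)[OF l] m], use l0 in simp)
    note w = wbound_minus[OF hg this]
    have "wbound (\<lambda>x. (n x - m x) - oper \<sigma> l (\<lambda>x. n x - m x) x) (D + \<bar>k - l\<bar> / (l0 / 2) * (c * v_mass))"
      unfolding wbound_def
    proof
      show "AE x in lborel. norm ((n x - m x) - oper \<sigma> l (\<lambda>x. n x - m x) x) \<le> (D + \<bar>k - l\<bar> / (l0 / 2) * (c * v_mass)) * weight x powr r"
        using eq wboundD(2)[OF w]
      proof eventually_elim
        case (elim x)
        have "(n x - m x) - oper \<sigma> l (\<lambda>x. n x - m x) x = (n x - oper \<sigma> l n x) - (m x - oper \<sigma> l m x)"
          unfolding oper_minus[OF lb(2)[OF l] n m] by simp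
        also have "\<dots> = h x - g x - (oper \<sigma> k m x - oper \<sigma> l m x)"
          using elim(1,2) by (simp add: algebra_simps)
        finally show ?case using elim(3) by simp
      qed
    qed measurable
    from below[OF l wbound_minus[OF n m] this]
    have "wbound (\<lambda>x. n x - m x) (c * (D + \<bar>k - l\<bar> / (l0 / 2) * (c * v_mass)))" .
    moreover have "c * (D + \<bar>k - l\<bar> / (l0 / 2) * (c * v_mass)) \<le> c' * (D + \<bar>l - k\<bar>)"
    proof -
      have "c' * (D + \<bar>l - k\<bar>) - c * (D + \<bar>k - l\<bar> / (l0 / 2) * (c * v_mass))
          = c * \<bar>l - k\<bar> + c * (c * v_mass / (l0 / 2)) * D"
        unfolding c'_def abs_minus_commute[of k l] using l0 by (simp add: field_simps)
      moreover have "\<dots> \<ge> 0" using c v_mass_nonneg l0 wboundD(3)[OF hg] by auto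
      ultimately show ?thesis by linarith
    qed
    ultimately show ?thesis by (rule wbound_mono)
  qed
  have bd': "wbound n c'" if "\<bar>l - l0\<bar> \<le> \<delta>" "wbound h 1" "solution \<sigma> l h n" for l h n
    using wbound_mono[OF bd[OF that] c'(1)] .
  show ?thesis
    by (rule that[OF \<delta> c'(2)]) (erule (2) bd', erule (6) diff)
qed

end

text \<open>If no constant worked on \<open>K\<close>, pairs of points violating the estimate with
  constant n would have a subsequence converging to some (a, b). For a = b the local estimate
  excludes this; for a \<noteq> b the distance of the points stays positive while the increments of
  \<open>f\<close> stay bounded.\<close>

lemma locally_holderI:
  assumes \<gamma>: "\<gamma> > 0"
    and loc: "\<And>a. a \<in> S \<Longrightarrow> \<exists>\<delta>>0. \<exists>C. \<forall>x y. \<bar>x - a\<bar> < \<delta> \<longrightarrow> \<bar>y - a\<bar> < \<delta> \<longrightarrow> norm (f x - f y) \<le> C * \<bar>x - y\<bar> powr \<gamma>"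
  shows "locally_holder \<gamma> S f"
  unfolding locally_holder_def
proof (intro allI impI, rule ccontr)
  fix K assume K: "compact K \<and> K \<subseteq> S" and "\<not> (\<exists>C. \<forall>x\<in>K. \<forall>y\<in>K. norm (f x - f y) \<le> C * \<bar>x - y\<bar> powr \<gamma>)"
  then have "\<forall>n::nat. \<exists>x\<in>K. \<exists>y\<in>K. norm (f x - f y) > real n * \<bar>x - y\<bar> powr \<gamma>"
    by (meson not_le)
  then obtain X Y where XY: "\<And>n. X n \<in> K" "\<And>n. Y n \<in> K"
    "\<And>n. norm (f (X n) - f (Y n)) > real n * \<bar>X n - Y n\<bar> powr \<gamma>" by metis
  obtain a \<rho> where a: "a \<in> K" "strict_mono (\<rho> :: nat \<Rightarrow> nat)" "(X \<circ> \<rho>) \<longlonglongrightarrow> a"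
    using K XY(1) unfolding compact_def by meson
  obtain b \<tau> where b: "b \<in> K" "strict_mono (\<tau> :: nat \<Rightarrow> nat)" "((Y \<circ> \<rho>) \<circ> \<tau>) \<longlonglongrightarrow> b"
    using K XY(2) unfolding compact_def by (metis comp_apply)
  define \<kappa> where "\<kappa> = \<rho> \<circ> \<tau>"
  have \<kappa>: "strict_mono \<kappa>" unfolding \<kappa>_def using a(2) b(2) by (rule strict_mono_o)
  have Xa: "(\<lambda>n. X (\<kappa> n)) \<longlonglongrightarrow> a" using LIMSEQ_subseq_LIMSEQ[OF a(3) b(2)] by (simp add: \<kappa>_def o_def)
  have Yb: "(\<lambda>n. Y (\<kappa> n)) \<longlonglongrightarrow> b" using b(3) by (simp add: \<kappa>_def o_def)
  have gt: "norm (f (X (\<kappa> n)) - f (Y (\<kappa> n))) > real n * \<bar>X (\<kappa> n) - Y (\<kappa> n)\<bar> powr \<gamma>" for n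
  proof -
    have "real n * \<bar>X (\<kappa> n) - Y (\<kappa> n)\<bar> powr \<gamma> \<le> real (\<kappa> n) * \<bar>X (\<kappa> n) - Y (\<kappa> n)\<bar> powr \<gamma>"
      using seq_suble[OF \<kappa>, of n] by (intro mult_right_mono) auto
    then show ?thesis using XY(3)[of "\<kappa> n"] by linarith
  qed
  obtain \<delta> C where \<delta>: "\<delta> > 0" and C: "\<And>x y. \<bar>x - a\<bar> < \<delta> \<Longrightarrow> \<bar>y - a\<bar> < \<delta> \<Longrightarrow> norm (f x - f y) \<le> C * \<bar>x - y\<bar> powr \<gamma>"
    using loc[of a] a(1) K by blast
  obtain \<delta>' C' where \<delta>': "\<delta>' > 0" and C': "\<And>x y. \<bar>x - b\<bar> < \<delta>' \<Longrightarrow> \<bar>y - b\<bar> < \<delta>' \<Longrightarrow> norm (f x - f y) \<le> C' * \<bar>x - y\<bar> powr \<gamma>"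
    using loc[of b] b(1) K by blast
  have evX: "\<forall>\<^sub>F n in sequentially. \<bar>X (\<kappa> n) - a\<bar> < e" if "e > 0" for e
    using tendstoD[OF Xa that] by (simp add: dist_real_def)
  have evY: "\<forall>\<^sub>F n in sequentially. \<bar>Y (\<kappa> n) - b\<bar> < e" if "e > 0" for e
    using tendstoD[OF Yb that] by (simp add: dist_real_def)
  have large: "\<forall>\<^sub>F n in sequentially. real n \<ge> M" for M
    by (rule eventually_sequentiallyI[of "nat \<lceil>M\<rceil>"]) linarith
  show False
  proof (cases "a = b")
    case True
    have "\<forall>\<^sub>F n in sequentially. False"
      using evX[OF \<delta>] evY[OF \<delta>] large[of C]
    proof eventually_elim
      case (elim n)
      have "norm (f (X (\<kappa> n)) - f (Y (\<kappa> n))) \<le> C * \<bar>X (\<kappa> n) - Y (\<kappa> n)\<bar> powr \<gamma>"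
        using C elim True by simp
      also have "\<dots> \<le> real n * \<bar>X (\<kappa> n) - Y (\<kappa> n)\<bar> powr \<gamma>"
        using elim by (intro mult_right_mono) auto
      finally show ?case using gt[of n] by simp
    qed
    then show False by simp
  next
    case False
    \<comment> \<open>If the points are within d/2 of \<open>a\<close> and \<open>b\<close>, whose
      distance is 2d, they remain at least d apart. \<open>M\<close> bounds the increment along the
      path through \<open>a\<close> and \<open>b\<close>.\<close>
    define d where "d = \<bar>a - b\<bar> / 2"
    have d: "d > 0" using False by (simp add: d_def)
    define M where "M = \<bar>C\<bar> * \<delta> powr \<gamma> + norm (f a - f b) + \<bar>C'\<bar> * \<delta>' powr \<gamma>"
    have "\<forall>\<^sub>F n in sequentially. False"
      using evX[OF \<delta>] evY[OF \<delta>'] evX[OF half_gt_zero[OF d]] evY[OF half_gt_zero[OF d]] large[of "M / d powr \<gamma>"]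
    proof eventually_elim
      case (elim n)
      have "norm (f (X (\<kappa> n)) - f a) \<le> C * \<bar>X (\<kappa> n) - a\<bar> powr \<gamma>" using C elim \<delta> by simp
      also have "\<dots> \<le> \<bar>C\<bar> * \<delta> powr \<gamma>" using elim \<gamma> by (intro mult_mono powr_mono2) auto
      finally have 1: "norm (f (X (\<kappa> n)) - f a) \<le> \<bar>C\<bar> * \<delta> powr \<gamma>" .
      have "norm (f b - f (Y (\<kappa> n))) \<le> C' * \<bar>b - Y (\<kappa> n)\<bar> powr \<gamma>" using C' elim \<delta>' by simp
      also have "\<dots> \<le> \<bar>C'\<bar> * \<delta>' powr \<gamma>" using elim \<gamma> by (intro mult_mono powr_mono2) auto
      finally have 2: "norm (f b - f (Y (\<kappa> n))) \<le> \<bar>C'\<bar> * \<delta>' powr \<gamma>" .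
      have "norm (f (X (\<kappa> n)) - f (Y (\<kappa> n))) = norm ((f (X (\<kappa> n)) - f a) + (f a - f b) + (f b - f (Y (\<kappa> n))))" by simp
      also have "\<dots> \<le> M" unfolding M_def
        by (rule order_trans[OF norm_triangle_ineq add_mono[OF order_trans[OF norm_triangle_ineq add_mono[OF 1 order_refl]] 2]])
      also have "M \<le> real n * d powr \<gamma>" using elim(5) d by (simp add: field_simps)
      also have "\<dots> \<le> real n * \<bar>X (\<kappa> n) - Y (\<kappa> n)\<bar> powr \<gamma>"
      proof -
        have "\<bar>a - b\<bar> \<le> \<bar>X (\<kappa> n) - a\<bar> + \<bar>Y (\<kappa> n) - b\<bar> + \<bar>X (\<kappa> n) - Y (\<kappa> n)\<bar>" by linarith
        moreover have "R \<ge> d" if "D \<le> P + Q + R" "P < d / 2" "Q < d / 2" "2 * d = D" for D P Q R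
          using that by linarith
        ultimately have "d \<le> \<bar>X (\<kappa> n) - Y (\<kappa> n)\<bar>" using elim(3,4) by (simp add: d_def)
        then show ?thesis using d \<gamma> by (intro mult_left_mono powr_mono2) auto
      qed
      finally show ?case using gt[of n] by simp
    qed
    then show False by simp
  qed
qed

lemma locally_holder_cnj:
  assumes "locally_holder \<gamma> S f"
  shows "locally_holder \<gamma> S (\<lambda>x. cnj (f x))"
  using assms unfolding locally_holder_def complex_cnj_diff[symmetric] complex_mod_cnj .

lemma locally_holder_mult:
  assumes "locally_holder \<gamma> S f" "locally_holder \<gamma> S g" "\<gamma> > 0"
  shows "locally_holder \<gamma> S (\<lambda>x. f x * g x)"
  unfolding locally_holder_def
proof (intro allI impI)
  fix K assume K: "compact K \<and> K \<subseteq> S"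
  \<comment> \<open>Boundedness on \<open>K\<close> comes from the Hoelder estimate itself, by
    comparison with one point of the bounded set \<open>K\<close>.\<close>
  have bounded: "\<exists>M\<ge>0. \<forall>x\<in>K. norm (h x) \<le> M"
    if C: "\<forall>x\<in>K. \<forall>y\<in>K. norm (h x - h y) \<le> C * \<bar>x - y\<bar> powr \<gamma>" for h :: "real \<Rightarrow> complex" and C
  proof (cases "K = {}")
    case False
    then obtain a where a: "a \<in> K" by auto
    obtain R where R: "\<And>x. x \<in> K \<Longrightarrow> \<bar>x - a\<bar> \<le> R"
      using K compact_imp_bounded[of K] unfolding bounded_any_center[of K a] by (auto simp: dist_real_def abs_minus_commute)
    show ?thesis
    proof (intro exI[of _ "\<bar>C\<bar> * R powr \<gamma> + norm (h a)"] conjI ballI)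
      fix x assume x: "x \<in> K"
      have "norm (h x - h a) \<le> C * \<bar>x - a\<bar> powr \<gamma>" using C x a by blast
      also have "\<dots> \<le> \<bar>C\<bar> * R powr \<gamma>" using R[OF x] assms(3) by (intro mult_mono powr_mono2) auto
      finally show "norm (h x) \<le> \<bar>C\<bar> * R powr \<gamma> + norm (h a)"
        using norm_triangle_ineq2[of "h x" "h a"] by linarith
    qed auto
  qed auto
  obtain C D where C: "\<forall>x\<in>K. \<forall>y\<in>K. norm (f x - f y) \<le> C * \<bar>x - y\<bar> powr \<gamma>"
    and D: "\<forall>x\<in>K. \<forall>y\<in>K. norm (g x - g y) \<le> D * \<bar>x - y\<bar> powr \<gamma>"
    using assms(1,2) K unfolding locally_holder_def by meson
  obtain M N where M: "M \<ge> 0" "\<forall>x\<in>K. norm (f x) \<le> M" and N: "N \<ge> 0" "\<forall>x\<in>K. norm (g x) \<le> N"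
    using bounded[OF C] bounded[OF D] by metis
  show "\<exists>C. \<forall>x\<in>K. \<forall>y\<in>K. norm (f x * g x - f y * g y) \<le> C * \<bar>x - y\<bar> powr \<gamma>"
  proof (intro exI[of _ "M * D + C * N"] ballI)
    fix x y assume xy: "x \<in> K" "y \<in> K"
    have "f x * g x - f y * g y = f x * (g x - g y) + (f x - f y) * g y" by (simp add: algebra_simps)
    also have "norm \<dots> \<le> M * (D * \<bar>x - y\<bar> powr \<gamma>) + (C * \<bar>x - y\<bar> powr \<gamma>) * N"
    proof (rule order_trans[OF norm_triangle_ineq add_mono])
      show "norm (f x * (g x - g y)) \<le> M * (D * \<bar>x - y\<bar> powr \<gamma>)"
        unfolding norm_mult using M D xy by (intro mult_mono) auto
      have "0 \<le> C * \<bar>x - y\<bar> powr \<gamma>" using C xy by (meson norm_ge_zero order_trans)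
      then show "norm ((f x - f y) * g y) \<le> (C * \<bar>x - y\<bar> powr \<gamma>) * N"
        unfolding norm_mult using N C xy by (intro mult_mono) auto
    qed
    finally show "norm (f x * g x - f y * g y) \<le> (M * D + C * N) * \<bar>x - y\<bar> powr \<gamma>"
      by (simp add: algebra_simps)
  qed
qed

lemma abs_le_powr:
  fixes t :: real
  assumes "\<bar>t\<bar> \<le> 1" "\<gamma> \<le> 1"
  shows "\<bar>t\<bar> \<le> \<bar>t\<bar> powr \<gamma>"
  using assms powr_mono'[of \<gamma> 1 "\<bar>t\<bar>"] by (cases "t = 0") auto

lemma locally_holder_inverse:
  assumes "0 < \<gamma>" "\<gamma> \<le> 1"
  shows "locally_holder \<gamma> {0<..} (\<lambda>l. c / of_real l)"
proof (rule locally_holderI[OF assms(1)])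
  fix a :: real assume "a \<in> {0<..}"
  then have a: "a > 0" by simp
  have "norm (c / of_real x - c / of_real y) \<le> norm c * (4 / a\<^sup>2) * \<bar>x - y\<bar> powr \<gamma>"
    if x: "\<bar>x - a\<bar> < min (a / 2) (1 / 2)" and y: "\<bar>y - a\<bar> < min (a / 2) (1 / 2)" for x y
  proof -
    have xy: "a / 2 \<le> x" "a / 2 \<le> y" "\<bar>y - x\<bar> \<le> 1" using x y unfolding min_less_iff_conj by linarith+
    have pos: "x > 0" "y > 0" using xy a by auto
    have "c / of_real x - c / of_real y = c * of_real ((y - x) / (x * y))"
      using pos by (simp add: field_simps)
    then have eq: "norm (c / of_real x - c / of_real y) = norm c * (\<bar>y - x\<bar> / (x * y))"
      using pos by (simp add: norm_mult norm_divide del: of_real_diff of_real_divide of_real_mult)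
    have "\<bar>y - x\<bar> / (x * y) \<le> \<bar>y - x\<bar> powr \<gamma> / ((a / 2) * (a / 2))"
      using xy a assms abs_le_powr by (intro frac_le mult_mono) auto
    also have "\<dots> = 4 / a\<^sup>2 * \<bar>x - y\<bar> powr \<gamma>"
      by (simp add: power2_eq_square abs_minus_commute)
    finally show ?thesis
      unfolding eq mult.assoc by (rule mult_left_mono) simp
  qed
  then show "\<exists>\<delta>>0. \<exists>C. \<forall>x y. \<bar>x - a\<bar> < \<delta> \<longrightarrow> \<bar>y - a\<bar> < \<delta> \<longrightarrow> norm (c / of_real x - c / of_real y) \<le> C * \<bar>x - y\<bar> powr \<gamma>"
    using a by (intro exI[of _ "min (a / 2) (1 / 2)"] exI[of _ "norm c * (4 / a\<^sup>2)"] conjI) auto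
qed

section \<open>Pairing of solutions and the jump of the operator across the cut\<close>

context weighted_potential
begin

lemma integrable_potential_mult_bounded:
  assumes "wbound a A" "g \<in> borel_measurable borel" "\<And>x. norm (g x) \<le> C"
  shows "integrable lborel (\<lambda>x. of_real (u x) * a x * g x)"
proof (rule Bochner_Integration.integrable_bound[OF integrable_mult_right[OF integrable_potential_mult[OF assms(1)], of "of_real C"]])
  note [measurable] = wboundD(1)[OF assms(1)] assms(2)
  show "(\<lambda>x. of_real (u x) * a x * g x) \<in> borel_measurable lborel" by measurable
  have "norm (of_real (u x) * a x) * norm (g x) \<le> norm (of_real (u x) * a x) * \<bar>C\<bar>" for x
    using assms(3)[of x] by (intro mult_left_mono) auto
  then show "AE x in lborel. norm (of_real (u x) * a x * g x) \<le> norm (of_real C * (of_real (u x) * a x))"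
    by (intro AE_I2) (simp add: norm_mult mult_ac)
qed

lemma wbound_cnj: "wbound a A \<Longrightarrow> wbound (\<lambda>x. cnj (a x)) A"
proof -
  have [measurable]: "cnj \<in> borel_measurable borel"
    by (intro borel_measurable_continuous_onI continuous_intros)
  assume "wbound a A" then show ?thesis by (auto simp: wbound_def)
qed

text \<open>Expand the integral of \<open>u a cnj b\<close> once by the equation for
  \<open>b\<close> and once by the equation for \<open>a\<close>. Adjointness at \<open>k\<close>
  moves \<open>oper Below k\<close> from \<open>b\<close> onto \<open>a\<close>, so of the operator
  terms only the increment from \<open>k\<close> to \<open>l\<close> remains, and none when
  \<open>l = k\<close>.\<close>

lemma solution_pairing:
  assumes l: "l > 0" "k > 0" and a: "solution Above l h a" and b: "solution Below k g b"
    and h: "h \<in> borel_measurable borel" "\<And>x. norm (h x) \<le> 1"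
    and g: "g \<in> borel_measurable borel" "\<And>x. norm (g x) \<le> 1"
  shows "(LINT x|lborel. of_real (u x) * a x * cnj (g x)) - (LINT x|lborel. of_real (u x) * cnj (b x) * h x)
    = (LINT x|lborel. of_real (u x) * cnj (b x) * (oper Above l a x - oper Above k a x))"
proof -
  have cnj_meas [measurable]: "cnj \<in> borel_measurable borel"
    by (intro borel_measurable_continuous_onI continuous_intros)
  obtain A B where wa: "wbound a A" and wb: "wbound b B" using a b by (auto simp: solution_def)
  have ae: "AE x in lborel. a x = h x + oper Above l a x" and be: "AE x in lborel. b x = g x + oper Below k b x"
    using a b by (auto simp: solution_def)
  note wb' = wbound_cnj[OF wb]
  note [measurable] = wboundD(1)[OF wa] wboundD(1)[OF wb] h(1) g(1)
    borel_measurable_oper[OF l(1) wa] borel_measurable_oper[OF l(2) wa] borel_measurable_oper[OF l(2) wb]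
  have I1: "integrable lborel (\<lambda>x. of_real (u x) * a x * cnj (g x))"
    by (rule integrable_potential_mult_bounded[OF wa, of _ 1]) (use g in auto)
  have I2: "integrable lborel (\<lambda>x. of_real (u x) * a x * cnj (oper Below k b x))"
    by (rule integrable_potential_mult_bounded[OF wa, of _ "B * kern_const k"]) (use norm_oper_le[OF l(2) wb] in auto)
  have I3: "integrable lborel (\<lambda>x. of_real (u x) * cnj (b x) * h x)"
    by (rule integrable_potential_mult_bounded[OF wb', of _ 1]) (use h in auto)
  have I4: "integrable lborel (\<lambda>x. of_real (u x) * cnj (b x) * oper Above m a x)" if "m > 0" for m
    by (rule integrable_potential_mult_bounded[OF wb', of _ "A * kern_const m"])
      (use norm_oper_le[OF that wa] borel_measurable_oper[OF that wa] in auto)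
  have "(LINT x|lborel. of_real (u x) * a x * cnj (g x)) + (LINT x|lborel. of_real (u x) * a x * cnj (oper Below k b x))
      = (LINT x|lborel. of_real (u x) * a x * cnj (g x) + of_real (u x) * a x * cnj (oper Below k b x))"
    by (rule Bochner_Integration.integral_add[OF I1 I2, symmetric])
  also have "\<dots> = (LINT x|lborel. of_real (u x) * cnj (b x) * h x + of_real (u x) * cnj (b x) * oper Above l a x)"
  proof (rule integral_cong_AE)
    show "AE x in lborel. of_real (u x) * a x * cnj (g x) + of_real (u x) * a x * cnj (oper Below k b x)
        = of_real (u x) * cnj (b x) * h x + of_real (u x) * cnj (b x) * oper Above l a x"
      using ae be
    proof eventually_elim
      case (elim x)
      have "of_real (u x) * a x * cnj (g x) + of_real (u x) * a x * cnj (oper Below k b x) = of_real (u x) * a x * cnj (b x)"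
        by (subst elim(2)) (simp add: distrib_left)
      also have "\<dots> = of_real (u x) * cnj (b x) * h x + of_real (u x) * cnj (b x) * oper Above l a x"
        by (subst elim(1)) (simp add: algebra_simps)
      finally show ?case .
    qed
  qed measurable
  also have "\<dots> = (LINT x|lborel. of_real (u x) * cnj (b x) * h x) + (LINT x|lborel. of_real (u x) * cnj (b x) * oper Above l a x)"
    by (rule Bochner_Integration.integral_add[OF I3 I4[OF l(1)]])
  finally have "(LINT x|lborel. of_real (u x) * a x * cnj (g x)) - (LINT x|lborel. of_real (u x) * cnj (b x) * h x)
      = (LINT x|lborel. of_real (u x) * cnj (b x) * oper Above l a x) - (LINT x|lborel. of_real (u x) * cnj (b x) * oper Above k a x)"
    unfolding oper_adjoint[OF l(2) wa wb] by (simp add: algebra_simps)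
  then show ?thesis
    unfolding right_diff_distrib Bochner_Integration.integral_diff[OF I4[OF l(1)] I4[OF l(2)]] .
qed

lemma oper_Above_minus_Below:
  assumes "l > 0" "wbound n B"
  shows "oper Above l n x - oper Below l n x = \<i> * (LINT y|lborel. of_real (u y) * n y)"
proof -
  have "oper Above l n x - oper Below l n x
      = (LINT y|lborel. kern Above l (x - y) * (of_real (u y) * n y) - kern Below l (x - y) * (of_real (u y) * n y))"
    unfolding oper_def using integrable_oper[OF assms] by (intro Bochner_Integration.integral_diff[symmetric])
  also have "\<dots> = (LINT y|lborel. \<i> * (of_real (u y) * n y))"
  proof (rule integral_cong_AE)
    note [measurable] = wboundD(1)[OF assms(2)] borel_measurable_kern[OF assms(1)]
    show "AE y in lborel. kern Above l (x - y) * (of_real (u y) * n y) - kern Below l (x - y) * (of_real (u y) * n y) = \<i> * (of_real (u y) * n y)"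
      using AE_lborel_singleton[of x]
      by eventually_elim (auto simp: left_diff_distrib[symmetric] kern.simps indicator_def)
  qed (use wboundD(1)[OF assms(2)] borel_measurable_kern[OF assms(1)] in measurable)
  finally show ?thesis by (simp add: integral_mult_right_zero)
qed

end

section \<open>The scattering coefficients\<close>

definition wave :: "real \<Rightarrow> real \<Rightarrow> complex" where
  "wave l x = exp (- (\<i> * of_real (x * l)))"

lemma norm_wave [simp]: "norm (wave l x) = 1"
  unfolding wave_def by (rule norm_exp_i_real)

lemma wave_measurable [measurable]: "wave l \<in> borel_measurable borel"
  unfolding wave_def[abs_def] by measurable

lemma cnj_wave: "cnj (wave l x) = exp (\<i> * of_real (x * l))"
  by (simp add: wave_def exp_cnj)

text \<open>\<open>n \<sigma> l\<close> and \<open>p \<sigma> l\<close> are the conjugated Jost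
  solutions exp(-ilx) me and exp(-ilx) m1. Conjugation turns the source exp(ilx) of the former into
  1 and the source 1 of the latter into \<open>wave l\<close>.\<close>

locale jost_family = weighted_potential +
  fixes n p :: "side \<Rightarrow> real \<Rightarrow> real \<Rightarrow> complex"
  assumes regular: "\<And>\<sigma> l. l > 0 \<Longrightarrow> regular \<sigma> l"
    and n_solution: "\<And>\<sigma> l. l > 0 \<Longrightarrow> solution \<sigma> l (\<lambda>x. 1) (n \<sigma> l)"
    and p_solution: "\<And>\<sigma> l. l > 0 \<Longrightarrow> solution \<sigma> l (wave l) (p \<sigma> l)"
begin

text \<open>In terms of the Jost solutions, \<open>mass_n\<close> and \<open>mass_p\<close> are the
  integrals in \<Gamma> and \<beta>, \<open>mass_1\<close> is the integral of u m1 above the cut,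
  and \<open>mass_e\<close> that of u me below it, the one in \<open>f_coeff\<close>.\<close>

definition mass_n :: "real \<Rightarrow> complex" where
  "mass_n l = (LINT x|lborel. of_real (u x) * n Above l x)"

definition mass_p :: "real \<Rightarrow> complex" where
  "mass_p l = (LINT x|lborel. of_real (u x) * p Above l x)"

definition mass_1 :: "real \<Rightarrow> complex" where
  "mass_1 l = (LINT x|lborel. of_real (u x) * p Above l x * cnj (wave l x))"

definition mass_e :: "real \<Rightarrow> complex" where
  "mass_e l = (LINT x|lborel. of_real (u x) * n Below l x * cnj (wave l x))"

definition \<Gamma> :: "real \<Rightarrow> complex" where "\<Gamma> l = 1 + \<i> * mass_n l"
definition \<beta> :: "real \<Rightarrow> complex" where "\<beta> l = \<i> * mass_p l"

lemma wbound_ex: "l > 0 \<Longrightarrow> \<exists>B. wbound (n \<sigma> l) B" "l > 0 \<Longrightarrow> \<exists>B. wbound (p \<sigma> l) B"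
  using n_solution p_solution by (auto simp: solution_def)

lemma wbound_1: "wbound (\<lambda>x. 1) 1" and wbound_wave: "wbound (wave l) 1"
  by (auto intro!: wbound_of_bounded)

lemma integrable_mult_wave:
  assumes "wbound a A"
  shows "integrable lborel (\<lambda>x. of_real (u x) * a x * cnj (wave l x))"
proof (rule integrable_potential_mult_bounded[OF assms, of _ 1])
  show "(\<lambda>x. cnj (wave l x)) \<in> borel_measurable borel" unfolding cnj_wave by measurable
qed simp

lemma cnj_integral: "cnj (LINT x|lborel. of_real (u x) * f x * cnj (g x)) = (LINT x|lborel. of_real (u x) * cnj (f x) * g x)"
  by (subst Bochner_Integration.integral_cnj[symmetric]) simp

text \<open>Pairing at equal parameters with source \<open>wave l\<close> above and 1 below. Up to
  scalar factors this is the relation between f and \<beta>.\<close>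

lemma mass_p_eq:
  assumes "l > 0"
  shows "mass_p l = cnj (mass_e l)"
  using solution_pairing[OF assms assms p_solution[OF assms] n_solution[OF assms]]
  by (simp add: mass_p_def mass_e_def cnj_integral)

lemma mass_n_eq:
  assumes "l > 0"
  shows "mass_n l = cnj (LINT x|lborel. of_real (u x) * n Below l x)"
  using solution_pairing[OF assms assms n_solution[OF assms] n_solution[OF assms]]
    cnj_integral[of "n Below l" "\<lambda>x. 1"]
  by (simp add: mass_n_def)

lemma mass_1_eq:
  assumes "l > 0"
  shows "mass_1 l = cnj (LINT x|lborel. of_real (u x) * p Below l x * cnj (wave l x))"
  using solution_pairing[OF assms assms p_solution[OF assms] p_solution[OF assms]]
  by (simp add: mass_1_def cnj_integral)

section \<open>Jump relations for the solutions and the algebraic identities\<close>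

lemma oper_add_cmult:
  assumes "l > 0" "wbound a A" "wbound b B" "wbound d D"
  shows "oper \<sigma> l (\<lambda>x. a x - b x - c * d x) x = oper \<sigma> l a x - oper \<sigma> l b x - c * oper \<sigma> l d x"
    and "\<exists>E. wbound (\<lambda>x. a x - b x - c * d x) E"
proof -
  have cd: "wbound (\<lambda>x. c * d x) (norm c * D)"
  proof -
    have "AE x in lborel. norm (c * d x) \<le> norm c * D * weight x powr r"
      using wboundD(2)[OF assms(4)] by eventually_elim (auto simp: norm_mult mult.assoc intro!: mult_left_mono)
    then show ?thesis using wboundD(1)[OF assms(4)] by (simp add: wbound_def)
  qed
  show "oper \<sigma> l (\<lambda>x. a x - b x - c * d x) x = oper \<sigma> l a x - oper \<sigma> l b x - c * oper \<sigma> l d x"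
    by (simp only: oper_minus[OF assms(1) wbound_minus[OF assms(2,3)] cd] oper_minus[OF assms(1-3)] oper_cmult)
  show "\<exists>E. wbound (\<lambda>x. a x - b x - c * d x) E"
    using wbound_minus[OF wbound_minus[OF assms(2,3)] cd] by blast
qed

text \<open>Replacing the operator above by the one below in the equation for
  \<open>n Above l\<close> adds the constant \<open>\<i> * mass_n l\<close> to the source 1, which
  becomes \<open>\<Gamma> l\<close>; uniqueness below the cut then gives the multiple of
  \<open>n Below l\<close>. In \<open>p_jump\<close> the added constant is \<open>\<beta> l\<close>,
  by the same argument.\<close>

lemma n_jump:
  assumes "l > 0"
  shows "AE x in lborel. n Above l x = \<Gamma> l * n Below l x"
proof -
  obtain A B where w: "wbound (n Above l) A" "wbound (n Below l) B" using wbound_ex(1)[OF assms] by metis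
  have z: "wbound (\<lambda>x. 0) 0" by (rule wbound_of_bounded) auto
  \<comment> \<open>The subtracted 0 gives the combination the three-term shape of
    \<open>oper_add_cmult\<close>, which \<open>p_jump\<close> uses in full.\<close>
  have "solution Below l (\<lambda>x. 0) (\<lambda>x. n Above l x - 0 - \<Gamma> l * n Below l x)"
    unfolding solution_def
  proof
    show "AE x in lborel. n Above l x - 0 - \<Gamma> l * n Below l x = 0 + oper Below l (\<lambda>x. n Above l x - 0 - \<Gamma> l * n Below l x) x"
      using n_solution[OF assms, of Above, unfolded solution_def, THEN conjunct2]
        n_solution[OF assms, of Below, unfolded solution_def, THEN conjunct2]
    proof eventually_elim
      case (elim x)
      have "n Above l x = \<Gamma> l + oper Below l (n Above l) x"
        using elim(1) oper_Above_minus_Below[OF assms w(1), of x] by (simp add: \<Gamma>_def mass_n_def algebra_simps)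
      moreover have "\<Gamma> l * n Below l x = \<Gamma> l + \<Gamma> l * oper Below l (n Below l) x"
        by (subst elim(2)) (simp add: distrib_left)
      ultimately show ?case
        unfolding oper_add_cmult(1)[OF assms w(1) z w(2)] by (simp add: oper_def)
    qed
    show "\<exists>B. wbound (\<lambda>x. n Above l x - 0 - \<Gamma> l * n Below l x) B" by (rule oper_add_cmult(2)[OF assms w(1) z w(2)])
  qed
  then have "AE x in lborel. n Above l x - 0 - \<Gamma> l * n Below l x = 0"
    using regular[OF assms] unfolding regular_def by blast
  then show ?thesis by eventually_elim simp
qed

lemma p_jump:
  assumes "l > 0"
  shows "AE x in lborel. p Above l x = p Below l x + \<beta> l * n Below l x"
proof -
  obtain A B D where w: "wbound (p Above l) A" "wbound (p Below l) B" "wbound (n Below l) D"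
    using wbound_ex[OF assms] by metis
  have "solution Below l (\<lambda>x. 0) (\<lambda>x. p Above l x - p Below l x - \<beta> l * n Below l x)"
    unfolding solution_def
  proof
    show "AE x in lborel. p Above l x - p Below l x - \<beta> l * n Below l x = 0 + oper Below l (\<lambda>x. p Above l x - p Below l x - \<beta> l * n Below l x) x"
      using p_solution[OF assms, of Above, unfolded solution_def, THEN conjunct2]
        p_solution[OF assms, of Below, unfolded solution_def, THEN conjunct2]
        n_solution[OF assms, of Below, unfolded solution_def, THEN conjunct2]
    proof eventually_elim
      case (elim x)
      have "p Above l x = wave l x + \<beta> l + oper Below l (p Above l) x"
        using elim(1) oper_Above_minus_Below[OF assms w(1), of x] by (simp add: \<beta>_def mass_p_def algebra_simps)
      moreover have "\<beta> l * n Below l x = \<beta> l + \<beta> l * oper Below l (n Below l) x"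
        by (subst elim(3)) (simp add: distrib_left)
      ultimately show ?case
        unfolding oper_add_cmult(1)[OF assms w] using elim(2) by simp
    qed
    show "\<exists>B. wbound (\<lambda>x. p Above l x - p Below l x - \<beta> l * n Below l x) B" by (rule oper_add_cmult(2)[OF assms w])
  qed
  then have "AE x in lborel. p Above l x - p Below l x - \<beta> l * n Below l x = 0"
    using regular[OF assms] unfolding regular_def by blast
  then show ?thesis by eventually_elim (simp add: algebra_simps)
qed

text \<open>For X = \<open>mass_n l\<close>, the jump relation and the pairing give X = \<Gamma> cnj
  X. Since cnj \<Gamma> = 1 - i cnj X, this yields \<Gamma> cnj \<Gamma> = \<Gamma> - iX =
  1.\<close>

lemma \<Gamma>_unimodular:
  assumes "l > 0"
  shows "norm (\<Gamma> l) = 1"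
proof -
  obtain A B where w: "wbound (n Above l) A" "wbound (n Below l) B" using wbound_ex(1)[OF assms] by metis
  note [measurable] = wboundD(1)[OF w(1)] wboundD(1)[OF w(2)]
  let ?X = "mass_n l"
  have "?X = (LINT x|lborel. \<Gamma> l * (of_real (u x) * n Below l x))"
    unfolding mass_n_def
  proof (rule integral_cong_AE)
    show "AE x in lborel. of_real (u x) * n Above l x = \<Gamma> l * (of_real (u x) * n Below l x)"
      using n_jump[OF assms] by eventually_elim simp
  qed measurable
  also have "\<dots> = \<Gamma> l * cnj ?X"
    unfolding mass_n_eq[OF assms] by (simp add: integral_mult_right_zero)
  finally have X: "?X = \<Gamma> l * cnj ?X" .
  have "\<Gamma> l * cnj (\<Gamma> l) = \<Gamma> l - \<i> * (\<Gamma> l * cnj ?X)"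
    by (simp add: \<Gamma>_def algebra_simps)
  also have "\<dots> = \<Gamma> l - \<i> * ?X" using X by simp
  also have "\<dots> = 1" by (simp add: \<Gamma>_def)
  finally have "(norm (\<Gamma> l))\<^sup>2 = 1"
    by (metis complex_norm_square of_real_1 of_real_eq_iff)
  then show ?thesis by (simp add: power2_eq_1_iff) (use norm_ge_zero[of "\<Gamma> l"] in linarith)
qed

text \<open>Integrating \<open>p_jump\<close> against \<open>u\<close> times the conjugate wave
  gives \<open>mass_1 = cnj mass_1 + \<beta> mass_e\<close>, where \<open>mass_e\<close> equals i
  cnj \<beta> by \<open>mass_p_eq\<close>. The imaginary parts give the identity.\<close>

lemma norm_\<beta>_square:
  assumes "l > 0"
  shows "(norm (\<beta> l))\<^sup>2 = 2 * Im (mass_1 l)"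
proof -
  obtain A B D where w: "wbound (p Above l) A" "wbound (p Below l) B" "wbound (n Below l) D"
    using wbound_ex[OF assms] by metis
  have [measurable]: "(\<lambda>x. cnj (wave l x)) \<in> borel_measurable borel" unfolding cnj_wave by measurable
  note [measurable] = wboundD(1)[OF w(1)] wboundD(1)[OF w(2)] wboundD(1)[OF w(3)]
  have "mass_1 l = (LINT x|lborel. of_real (u x) * p Below l x * cnj (wave l x) + \<beta> l * (of_real (u x) * n Below l x * cnj (wave l x)))"
    unfolding mass_1_def
  proof (rule integral_cong_AE)
    show "AE x in lborel. of_real (u x) * p Above l x * cnj (wave l x)
        = of_real (u x) * p Below l x * cnj (wave l x) + \<beta> l * (of_real (u x) * n Below l x * cnj (wave l x))"
      using p_jump[OF assms] by eventually_elim (simp add: algebra_simps)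
  qed measurable
  also have "\<dots> = cnj (mass_1 l) + \<beta> l * mass_e l"
    unfolding mass_1_eq[OF assms] mass_e_def complex_cnj_cnj integral_mult_right_zero[symmetric]
    by (intro Bochner_Integration.integral_add integrable_mult_right integrable_mult_wave[OF w(2)] integrable_mult_wave[OF w(3)])
  also have "\<beta> l * mass_e l = \<i> * of_real ((norm (\<beta> l))\<^sup>2)"
  proof -
    have "mass_e l = \<i> * cnj (\<beta> l)" using mass_p_eq[OF assms] by (simp add: \<beta>_def)
    then show ?thesis by (simp only: complex_norm_square) simp
  qed
  finally have "Im (mass_1 l) = - Im (mass_1 l) + (norm (\<beta> l))\<^sup>2"
    by (metis Im_complex_of_real Im_i_times Re_complex_of_real cnj.simps(2) plus_complex.simps(2))
  then show ?thesis by simp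
qed

text \<open>This is the integral that \<open>oper_linearization\<close> produces for
  \<open>n Above l\<close>; the jump relation reduces it to \<open>mass_e\<close>, and supplies the
  factor \<Gamma> of the differential equation.\<close>

lemma mass_n_wave:
  assumes "l > 0"
  shows "(LINT x|lborel. of_real (u x) * (exp (\<i> * of_real (x * l)) * n Above l x)) = \<Gamma> l * mass_e l"
proof -
  obtain A B where w: "wbound (n Above l) A" "wbound (n Below l) B" using wbound_ex(1)[OF assms] by metis
  have [measurable]: "(\<lambda>x. cnj (wave l x)) \<in> borel_measurable borel" unfolding cnj_wave by measurable
  note [measurable] = wboundD(1)[OF w(1)] wboundD(1)[OF w(2)]
  have "(LINT x|lborel. of_real (u x) * (cnj (wave l x) * n Above l x)) = (LINT x|lborel. \<Gamma> l * (of_real (u x) * n Below l x * cnj (wave l x)))"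
  proof (rule integral_cong_AE)
    show "AE x in lborel. of_real (u x) * (cnj (wave l x) * n Above l x) = \<Gamma> l * (of_real (u x) * n Below l x * cnj (wave l x))"
      using n_jump[OF assms] by eventually_elim simp
  qed measurable
  then show ?thesis unfolding mass_e_def integral_mult_right_zero cnj_wave .
qed

section \<open>Hoelder regularity of the coefficients and the derivative of \<Gamma>\<close>

lemma wbound_wave_diff: "wbound (\<lambda>x. wave l x - wave k x) (2 * \<bar>l - k\<bar> powr \<gamma>)"
  unfolding wbound_def
proof (intro conjI AE_I2)
  fix x
  have "norm (wave l x - wave k x) \<le> 2 * \<bar>x * l - x * k\<bar> powr \<gamma>"
    unfolding wave_def by (rule norm_exp_diff_le_powr[OF \<gamma>_pos less_imp_le[OF \<gamma>_less]])
  also have "\<bar>x * l - x * k\<bar> = \<bar>x\<bar> * \<bar>l - k\<bar>" by (simp add: abs_mult[symmetric] right_diff_distrib)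
  finally have le: "norm (wave l x - wave k x) \<le> 2 * (\<bar>x\<bar> * \<bar>l - k\<bar>) powr \<gamma>" .
  have "(\<bar>x\<bar> * \<bar>l - k\<bar>) powr \<gamma> \<le> (weight x * \<bar>l - k\<bar>) powr \<gamma>"
    using \<gamma>_pos by (intro powr_mono2 mult_right_mono) (auto simp: weight_def)
  also have "\<dots> = weight x powr \<gamma> * \<bar>l - k\<bar> powr \<gamma>" using weight_pos[of x] by (simp add: powr_mult)
  also have "\<dots> \<le> weight x powr r * \<bar>l - k\<bar> powr \<gamma>"
    using weight_ge_1[of x] \<gamma>_le by (intro mult_right_mono powr_mono) auto
  finally show "norm (wave l x - wave k x) \<le> 2 * \<bar>l - k\<bar> powr \<gamma> * weight x powr r"
    using le by (simp add: mult_ac)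
qed measurable

lemma locally_holder_mass:
  assumes sol: "\<And>l. l > 0 \<Longrightarrow> solution Above l (h l) (a l)"
    and h: "\<And>l. wbound (h l) 1" and hd: "\<And>l k. wbound (\<lambda>x. h l x - h k x) (2 * \<bar>l - k\<bar> powr \<gamma>)"
  shows "locally_holder \<gamma> {0<..} (\<lambda>l. LINT x|lborel. of_real (u x) * a l x)"
proof (rule locally_holderI[OF \<gamma>_pos])
  fix l0 :: real assume "l0 \<in> {0<..}"
  then have l0: "l0 > 0" by simp
  obtain \<delta> c where \<delta>: "0 < \<delta>" "\<delta> \<le> l0 / 2" and c: "c > 0" and
    diff: "\<And>l k h g n m D. \<bar>l - l0\<bar> \<le> \<delta> \<Longrightarrow> \<bar>k - l0\<bar> \<le> \<delta> \<Longrightarrow> wbound h 1 \<Longrightarrow> wbound g 1 \<Longrightarrow>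
      wbound (\<lambda>x. h x - g x) D \<Longrightarrow> solution Above l h n \<Longrightarrow> solution Above k g m \<Longrightarrow>
      wbound (\<lambda>x. n x - m x) (c * (D + \<bar>l - k\<bar>))"
    by (rule solution_locally_holder[OF l0 regular[OF l0, of Above]]) blast
  have "norm ((LINT x|lborel. of_real (u x) * a l x) - (LINT x|lborel. of_real (u x) * a k x)) \<le> 3 * c * v_mass * \<bar>l - k\<bar> powr \<gamma>"
    if l: "\<bar>l - l0\<bar> < min \<delta> (1 / 2)" and k: "\<bar>k - l0\<bar> < min \<delta> (1 / 2)" for l k
  proof -
    have lk: "\<bar>l - l0\<bar> \<le> \<delta>" "\<bar>k - l0\<bar> \<le> \<delta>" "\<bar>l - k\<bar> \<le> 1"
      using l k unfolding min_less_iff_conj by linarith+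
    then have pos: "l > 0" "k > 0" using \<delta> l0 by linarith+
    obtain A B where w: "wbound (a l) A" "wbound (a k) B" using sol[OF pos(1)] sol[OF pos(2)] by (auto simp: solution_def)
    have "wbound (\<lambda>x. a l x - a k x) (c * (2 * \<bar>l - k\<bar> powr \<gamma> + \<bar>l - k\<bar>))"
      by (rule diff[OF lk(1,2) h h hd sol[OF pos(1)] sol[OF pos(2)]])
    from norm_integral_potential_le[OF this]
    have "norm (LINT x|lborel. of_real (u x) * (a l x - a k x)) \<le> c * (2 * \<bar>l - k\<bar> powr \<gamma> + \<bar>l - k\<bar>) * v_mass" .
    also have "\<dots> \<le> c * (2 * \<bar>l - k\<bar> powr \<gamma> + \<bar>l - k\<bar> powr \<gamma>) * v_mass"
      using abs_le_powr[OF lk(3)] \<gamma>_less c v_mass_nonneg by (intro mult_right_mono mult_left_mono add_left_mono) auto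
    also have "(LINT x|lborel. of_real (u x) * (a l x - a k x)) = (LINT x|lborel. of_real (u x) * a l x) - (LINT x|lborel. of_real (u x) * a k x)"
      unfolding right_diff_distrib by (intro Bochner_Integration.integral_diff integrable_potential_mult[OF w(1)] integrable_potential_mult[OF w(2)])
    finally show ?thesis by (simp add: algebra_simps)
  qed
  then show "\<exists>\<delta>>0. \<exists>C. \<forall>x y. \<bar>x - l0\<bar> < \<delta> \<longrightarrow> \<bar>y - l0\<bar> < \<delta> \<longrightarrow>
      norm ((LINT xa|lborel. of_real (u xa) * a x xa) - (LINT x|lborel. of_real (u x) * a y x)) \<le> C * \<bar>x - y\<bar> powr \<gamma>"
    using \<delta> by (intro exI[of _ "min \<delta> (1 / 2)"]) auto
qed

lemma locally_holder_affine:
  assumes "locally_holder \<gamma> S f"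
  shows "locally_holder \<gamma> S (\<lambda>x. a + \<i> * f x)"
proof -
  have "norm (a + \<i> * f x - (a + \<i> * f y)) = norm (f x - f y)" for x y
    by (simp add: norm_mult right_diff_distrib[symmetric] del: right_diff_distrib)
  then show ?thesis using assms by (simp add: locally_holder_def)
qed

lemma locally_holder_\<Gamma>: "locally_holder \<gamma> {0<..} \<Gamma>"
proof -
  have "wbound (\<lambda>x. 1 - 1) (2 * \<bar>l - k\<bar> powr \<gamma>)" for l k :: real by (rule wbound_of_bounded) auto
  from locally_holder_affine[OF locally_holder_mass[OF n_solution wbound_1 this]]
  show ?thesis unfolding \<Gamma>_def mass_n_def .
qed

lemma locally_holder_\<beta>: "locally_holder \<gamma> {0<..} \<beta>"
  using locally_holder_affine[OF locally_holder_mass[OF p_solution wbound_wave wbound_wave_diff], of 0]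
  by (simp add: \<beta>_def[abs_def] mass_p_def)

text \<open>Pairing with the fixed solution \<open>b = n Below k\<close> expresses the increment of
  \<open>mass_n\<close> as the integral of \<open>u cnj b\<close> times the operator increment
  applied to \<open>n Above l\<close>. Its rank one linearization at \<open>n Above k\<close> is the
  derivative; the rest is of order 1 + \<gamma> in l - k.\<close>

lemma mass_n_has_derivative:
  assumes k: "k > 0"
  shows "(mass_n has_vector_derivative - (cnj (mass_e k) * (\<Gamma> k * mass_e k)) / of_real (2 * pi * k)) (at k)"
proof -
  obtain \<delta> c where \<delta>: "0 < \<delta>" "\<delta> \<le> k / 2" and c: "c > 0" and
    bd: "\<And>l h n. \<bar>l - k\<bar> \<le> \<delta> \<Longrightarrow> wbound h 1 \<Longrightarrow> solution Above l h n \<Longrightarrow> wbound n c" and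
    diff: "\<And>l k' h g n m D. \<bar>l - k\<bar> \<le> \<delta> \<Longrightarrow> \<bar>k' - k\<bar> \<le> \<delta> \<Longrightarrow> wbound h 1 \<Longrightarrow> wbound g 1 \<Longrightarrow>
      wbound (\<lambda>x. h x - g x) D \<Longrightarrow> solution Above l h n \<Longrightarrow> solution Above k' g m \<Longrightarrow>
      wbound (\<lambda>x. n x - m x) (c * (D + \<bar>l - k'\<bar>))"
    by (rule solution_locally_holder[OF k regular[OF k, of Above]]) blast
  define b where "b = n Below k"
  obtain B where wb: "wbound b B" using wbound_ex(1)[OF k] unfolding b_def by metis
  note wb' = wbound_cnj[OF wb]
  define a0 where "a0 = k / 2"
  have a0: "a0 > 0" using k by (simp add: a0_def)
  define K where "K = 2 / a0 + 1 / a0\<^sup>2"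
  have K: "K \<ge> 0" using a0 by (simp add: K_def)
  define Y where "Y = (LINT y|lborel. of_real (u y) * (exp (\<i> * of_real (y * k)) * n Above k y))"
  have Y: "Y = \<Gamma> k * mass_e k" unfolding Y_def by (rule mass_n_wave[OF k])
  \<comment> \<open>The source does not change with the parameter, so \<open>diff\<close> yields a
    Lipschitz bound in \<open>wd\<close>, without a Hoelder term.\<close>
  have z: "wbound (\<lambda>x. 1 - 1) 0" by (rule wbound_of_bounded) auto
  have est: "norm (mass_n l - mass_n k - of_real (l - k) * (- (cnj (mass_e k) * Y) / of_real (2 * pi * k)))
      \<le> B * (c * v_mass / a0 * v_moment + K * (c * v_moment) * v_moment) * (\<bar>l - k\<bar> * \<bar>l - k\<bar> powr \<gamma>)"
    if l: "\<bar>l - k\<bar> < min \<delta> 1" for l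
  proof -
    have lk: "\<bar>l - k\<bar> \<le> \<delta>" "\<bar>k - k\<bar> \<le> \<delta>" "\<bar>l - k\<bar> \<le> 1" using l \<delta> by auto
    have al: "a0 \<le> l" "a0 \<le> k" using lk \<delta> k unfolding a0_def by linarith+
    then have lpos: "l > 0" using a0 by simp
    have wl: "wbound (n Above l) c" by (rule bd[OF lk(1) wbound_1 n_solution[OF lpos]])
    have wk: "wbound (n Above k) c" by (rule bd[OF lk(2) wbound_1 n_solution[OF k]])
    have wd: "wbound (\<lambda>x. n Above l x - n Above k x) (c * (0 + \<bar>l - k\<bar>))"
      by (rule diff[OF lk(1,2) wbound_1 wbound_1 z n_solution[OF lpos] n_solution[OF k]])
    define d where "d x = oper Above l (n Above l) x - oper Above k (n Above l) x" for x
    define R where "R x = d x + of_real ((l - k) / (2 * pi * k)) * wave k x * Y" for x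
    have dm [measurable]: "d \<in> borel_measurable borel"
      using borel_measurable_oper[OF lpos wl, of Above] borel_measurable_oper[OF k wl, of Above] unfolding d_def[abs_def] by measurable
    have Rm [measurable]: "R \<in> borel_measurable borel" unfolding R_def[abs_def] by measurable
    have pair: "mass_n l' - (LINT x|lborel. of_real (u x) * cnj (b x))
        = (LINT x|lborel. of_real (u x) * cnj (b x) * (oper Above l' (n Above l') x - oper Above k (n Above l') x))" if "l' > 0" for l'
      using solution_pairing[OF that k n_solution[OF that] n_solution[OF k, of Below]] by (simp add: mass_n_def b_def)
    have "mass_n k = (LINT x|lborel. of_real (u x) * cnj (b x))" using pair[OF k] by simp
    then have X: "mass_n l - mass_n k = (LINT x|lborel. of_real (u x) * cnj (b x) * d x)"
      using pair[OF lpos] unfolding d_def by simp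
    have d_bound: "norm (d x) \<le> c * kern_const l + c * kern_const k" for x
      unfolding d_def by (rule order_trans[OF norm_triangle_ineq4 add_mono[OF norm_oper_le[OF lpos wl] norm_oper_le[OF k wl]]])
    have Id: "integrable lborel (\<lambda>x. of_real (u x) * cnj (b x) * d x)"
      by (rule integrable_potential_mult_bounded[OF wb' dm d_bound])
    have Iw: "integrable lborel (\<lambda>x. of_real (u x) * cnj (b x) * wave k x)"
      by (rule integrable_potential_mult_bounded[OF wb', of _ 1]) auto
    have eq: "of_real (u x) * cnj (b x) * R x = of_real (u x) * cnj (b x) * d x
        + of_real ((l - k) / (2 * pi * k)) * Y * (of_real (u x) * cnj (b x) * wave k x)" for x
      by (simp add: R_def algebra_simps)
    have IR: "integrable lborel (\<lambda>x. of_real (u x) * cnj (b x) * R x)"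
      unfolding eq by (intro Bochner_Integration.integrable_add Id integrable_mult_right Iw)
    have "(LINT x|lborel. of_real (u x) * cnj (b x) * R x)
        = (LINT x|lborel. of_real (u x) * cnj (b x) * d x) + of_real ((l - k) / (2 * pi * k)) * Y * (LINT x|lborel. of_real (u x) * cnj (b x) * wave k x)"
      unfolding eq integral_mult_right_zero[symmetric] by (intro Bochner_Integration.integral_add Id integrable_mult_right Iw)
    also have "(LINT x|lborel. of_real (u x) * cnj (b x) * wave k x) = cnj (mass_e k)"
      by (simp add: mass_e_def b_def cnj_integral)
    finally have key: "mass_n l - mass_n k - of_real (l - k) * (- (cnj (mass_e k) * Y) / of_real (2 * pi * k))
        = (LINT x|lborel. of_real (u x) * cnj (b x) * R x)"
      unfolding X using k by (simp add: field_simps)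
    have "norm (LINT x|lborel. of_real (u x) * cnj (b x) * R x) \<le> (LINT x|lborel. (B * (c * v_mass / a0 + K * (c * v_moment)) * (\<bar>l - k\<bar> * \<bar>l - k\<bar> powr \<gamma>)) * (v x * weight x powr \<gamma>))"
    proof (rule integral_norm_bound_integral_AE[OF IR])
      have Rb: "norm (R x) \<le> (c * v_mass / a0 + K * (c * v_moment)) * (\<bar>l - k\<bar> * \<bar>l - k\<bar> powr \<gamma>) * weight x powr \<gamma>" for x
      proof -
        \<comment> \<open>\<open>R1\<close> is the operator increment on the solution increment, a
          product of two Lipschitz terms and hence quadratic in l - k. \<open>R2\<close> is the
          linearization error at the fixed function \<open>n Above k\<close>.\<close>
        define R1 where "R1 = oper Above l (\<lambda>y. n Above l y - n Above k y) x - oper Above k (\<lambda>y. n Above l y - n Above k y) x"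
        define R2 where "R2 = oper Above l (n Above k) x - oper Above k (n Above k) x + of_real ((l - k) / (2 * pi * k)) * wave k x * Y"
        have "R x = R1 + R2"
          unfolding R_def R1_def R2_def d_def oper_minus[OF lpos wl wk] oper_minus[OF k wl wk] by simp
        moreover have "norm R1 \<le> c * v_mass / a0 * (\<bar>l - k\<bar> * \<bar>l - k\<bar> powr \<gamma>) * weight x powr \<gamma>"
        proof -
          have "norm R1 \<le> \<bar>l - k\<bar> / a0 * (c * (0 + \<bar>l - k\<bar>) * v_mass)"
            unfolding R1_def by (rule norm_oper_param_diff_le[OF a0 al wd])
          also have "\<dots> = c * v_mass / a0 * (\<bar>l - k\<bar> * (\<bar>l - k\<bar> * 1))" by simp
          also have "\<dots> \<le> c * v_mass / a0 * (\<bar>l - k\<bar> * (\<bar>l - k\<bar> powr \<gamma> * weight x powr \<gamma>))"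
            using c v_mass_nonneg a0 abs_le_powr[OF lk(3), of \<gamma>] \<gamma>_less \<gamma>_pos ge_one_powr_ge_zero[OF weight_ge_1[of x], of \<gamma>]
            by (intro mult_left_mono mult_mono) auto
          finally show ?thesis by (simp add: mult_ac)
        qed
        moreover have "norm R2 \<le> K * (c * v_moment) * (\<bar>l - k\<bar> * \<bar>l - k\<bar> powr \<gamma>) * weight x powr \<gamma>"
          using oper_linearization[OF a0 al lk(3) wk, of Above x] unfolding R2_def K_def wave_def Y_def by (simp add: mult_ac)
        ultimately show ?thesis
          using norm_triangle_ineq[of R1 R2] by (simp add: algebra_simps)
      qed
      show "AE x in lborel. norm (of_real (u x) * cnj (b x) * R x) \<le> (B * (c * v_mass / a0 + K * (c * v_moment)) * (\<bar>l - k\<bar> * \<bar>l - k\<bar> powr \<gamma>)) * (v x * weight x powr \<gamma>)"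
        using wbound_potential[OF wb']
      proof eventually_elim
        case (elim x)
        have "norm (of_real (u x) * cnj (b x) * R x) \<le> B * v x * ((c * v_mass / a0 + K * (c * v_moment)) * (\<bar>l - k\<bar> * \<bar>l - k\<bar> powr \<gamma>) * weight x powr \<gamma>)"
          unfolding norm_mult[of "_ * _" "R x"] using elim Rb[of x] wboundD(3)[OF wb] v_nonneg[of x] by (intro mult_mono) auto
        then show ?case by (simp add: mult_ac)
      qed
    qed (use integrable_v_weight in auto)
    also have "\<dots> = B * (c * v_mass / a0 * v_moment + K * (c * v_moment) * v_moment) * (\<bar>l - k\<bar> * \<bar>l - k\<bar> powr \<gamma>)"
    proof -
      have m: "(LINT x|lborel. M * (v x * weight x powr \<gamma>)) = M * v_moment" for M
        unfolding v_moment_def by (rule integral_mult_right_zero)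
      show ?thesis unfolding m by (simp add: distrib_left distrib_right mult_ac)
    qed
    finally show ?thesis unfolding key .
  qed
  show ?thesis
    using has_vector_derivative_of_power_bound[OF \<gamma>_pos _ est, of "min \<delta> 1"] \<delta> Y by simp
qed

lemma \<Gamma>_has_derivative:
  assumes "l > 0"
  shows "(\<Gamma> has_vector_derivative of_real ((norm (\<beta> l))\<^sup>2) / (2 * of_real pi * \<i> * of_real l) * \<Gamma> l) (at l)"
proof -
  have "of_real ((norm (\<beta> l))\<^sup>2) = cnj (mass_e l) * mass_e l"
    using mass_p_eq[OF assms] unfolding complex_norm_square \<beta>_def by (simp add: algebra_simps)
  then have eq: "\<i> * (- (cnj (mass_e l) * (\<Gamma> l * mass_e l)) / of_real (2 * pi * l))
      = of_real ((norm (\<beta> l))\<^sup>2) / (2 * of_real pi * \<i> * of_real l) * \<Gamma> l"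
    using assms by (simp add: field_simps)
  have "((\<lambda>l. 1 + \<i> * mass_n l) has_vector_derivative \<i> * (- (cnj (mass_e l) * (\<Gamma> l * mass_e l)) / of_real (2 * pi * l))) (at l)"
    using mass_n_has_derivative[OF assms] by (auto intro!: derivative_eq_intros)
  then show ?thesis unfolding eq \<Gamma>_def[abs_def, symmetric] .
qed

end

section \<open>Passage to Lebesgue measurable functions\<close>

text \<open>Lebesgue measure is complete, so \<open>f\<close> inherits measurability from its Borel
  representative \<open>g\<close>.\<close>

lemma lebesgue_integral_eq_lborel:
  fixes f :: "real \<Rightarrow> complex"
  assumes "g \<in> borel_measurable borel" "AE x in lborel. f x = g x"
  shows "(LINT x|lebesgue. f x) = (LINT x|lborel. g x)"
proof -
  have g: "g \<in> borel_measurable lebesgue" using assms(1) by (intro measurable_completion) auto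
  have ae: "AE x in lebesgue. g x = f x" using AE_completion[OF assms(2)] by eventually_elim simp
  have "f \<in> borel_measurable lebesgue" by (rule borel_measurable_AE[OF g ae])
  then have "(LINT x|lebesgue. f x) = (LINT x|lebesgue. g x)"
    using ae g by (intro integral_cong_AE) (auto elim: eventually_mono)
  also have "\<dots> = (LINT x|lborel. g x)" using assms(1) by (intro integral_completion) auto
  finally show ?thesis .
qed

lemma lebesgue_measurable_borel_representative:
  fixes f :: "real \<Rightarrow> complex"
  assumes "f \<in> borel_measurable lebesgue"
  obtains g where "g \<in> borel_measurable borel" "AE x in lborel. f x = g x"
proof -
  have "(\<lambda>x. Re (f x)) \<in> borel_measurable lebesgue" "(\<lambda>x. Im (f x)) \<in> borel_measurable lebesgue"
    using assms by measurable
  from this[THEN completion_ex_borel_measurable_real] obtain a b where ab: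
    "a \<in> borel_measurable lborel" "AE x in lborel. Re (f x) = a x"
    "b \<in> borel_measurable lborel" "AE x in lborel. Im (f x) = b x"
    by auto
  have "(\<lambda>x. Complex (a x) (b x)) \<in> borel_measurable borel"
    unfolding Complex_eq using ab(1,3) by measurable
  moreover have "AE x in lborel. f x = Complex (a x) (b x)"
    using ab(2,4) by eventually_elim (auto simp: complex_eq_iff)
  ultimately show ?thesis by (rule that)
qed

lemma integrable_weight_powr:
  assumes "q > 1"
  shows "integrable lborel (\<lambda>x. weight x powr (- q))"
proof -
  have lim: "((\<lambda>x. (1 + x) powr (1 - q) / (1 - q)) \<longlongrightarrow> 0 / (1 - q)) at_top"
    using assms
    by (intro tendsto_intros tendsto_neg_powr filterlim_tendsto_add_at_top[OF tendsto_const filterlim_ident]) auto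
  have "(\<integral>\<^sup>+x. ennreal ((1 + x) powr (- q)) * indicator {0..} x \<partial>lborel) = ennreal (0 / (1 - q) - (1 + 0) powr (1 - q) / (1 - q))"
  proof (rule nn_integral_FTC_atLeast[OF _ _ _ lim])
    fix x :: real assume "0 \<le> x"
    then have "((\<lambda>x. (1 + x) powr (1 - q)) has_real_derivative (1 - q) * (1 + x) powr (1 - q - of_nat 1) * 1) (at x)"
      by (intro DERIV_fun_powr) (auto intro!: derivative_eq_intros)
    from DERIV_cdivide[OF this, of "1 - q"]
    show "((\<lambda>x. (1 + x) powr (1 - q) / (1 - q)) has_real_derivative (1 + x) powr (- q)) (at x)"
      using assms by simp
  qed auto
  moreover have "(\<integral>\<^sup>+x. ennreal ((1 + x) powr (- q)) * indicator {0..} x \<partial>lborel) = (\<integral>\<^sup>+x. ennreal (indicator {0..} x * weight x powr (- q)) \<partial>lborel)"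
    by (intro nn_integral_cong) (auto simp: weight_def indicator_def)
  ultimately have "(\<integral>\<^sup>+x. ennreal (indicator {0..} x * weight x powr (- q)) \<partial>lborel) < \<infinity>" by simp
  then have pos: "integrable lborel (\<lambda>x. indicator {0..} x * weight x powr (- q))"
    by (intro integrableI_nonneg) (auto simp: weight_def)
  have neg: "integrable lborel (\<lambda>x. indicator {0..} (- x) * weight x powr (- q))"
    using lborel_integrable_real_affine[OF pos, of "-1" 0] by (simp add: weight_def)
  show ?thesis
    by (rule Bochner_Integration.integrable_bound[OF Bochner_Integration.integrable_add[OF pos neg]])
      (auto simp: weight_def indicator_def)
qed

text \<open>The product |u| weight^(s - s1 + \<gamma>) splits into weight^s |u| and weight^(-(s1 -
  \<gamma>)). Both are square integrable, the second because 2 (s1 - \<gamma>) > 1. Half the minimum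
  of s - s1, s1 - 1/2 and 1 is an exponent that satisfies all constraints on \<gamma>
  strictly.\<close>

lemma weighted_potential_of_weighted_L2:
  assumes "s1 > 1 / 2" "s > s1" "u \<in> borel_measurable borel"
    and sq: "integrable lborel (\<lambda>x. (weight x powr s * \<bar>u x\<bar>)\<^sup>2)"
  shows "weighted_potential u (s - s1) (min (min (s - s1) (s1 - 1 / 2)) 1 / 2)"
proof
  define \<gamma> where "\<gamma> = min (min (s - s1) (s1 - 1 / 2)) 1 / 2"
  have \<gamma>: "0 < \<gamma>" "\<gamma> < 1" "\<gamma> \<le> s - s1" "\<gamma> < s1 - 1 / 2"
    using assms(1,2) by (auto simp: \<gamma>_def min_def)
  note [measurable] = assms(3)
  have [measurable]: "weight \<in> borel_measurable borel" unfolding weight_def by measurable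
  have "integrable lborel (\<lambda>x. weight x powr (- (2 * (s1 - \<gamma>))))"
    using \<gamma> by (intro integrable_weight_powr) auto
  from Bochner_Integration.integrable_add[OF sq this]
  have "integrable lborel (\<lambda>x. \<bar>u x\<bar> * weight x powr (s - s1) * weight x powr \<gamma>)"
  proof (rule Bochner_Integration.integrable_bound)
    show "AE x in lborel. norm (\<bar>u x\<bar> * weight x powr (s - s1) * weight x powr \<gamma>)
      \<le> norm ((weight x powr s * \<bar>u x\<bar>)\<^sup>2 + weight x powr (- (2 * (s1 - \<gamma>))))"
    proof (rule AE_I2)
      fix x
      let ?a = "weight x powr s * \<bar>u x\<bar>" and ?b = "weight x powr (- (s1 - \<gamma>))"
      have "weight x powr (s - s1) * weight x powr \<gamma> = weight x powr s * ?b"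
        unfolding powr_add[symmetric] by (simp add: algebra_simps)
      then have "\<bar>u x\<bar> * weight x powr (s - s1) * weight x powr \<gamma> = ?a * ?b"
        by (simp only: mult_ac)
      also have "\<dots> \<le> ?a\<^sup>2 + ?b\<^sup>2"
      proof -
        have "0 \<le> (?a - ?b)\<^sup>2 + ?a * ?b" by (intro add_nonneg_nonneg mult_nonneg_nonneg) auto
        then show ?thesis by (simp add: power2_eq_square algebra_simps)
      qed
      also have "?b\<^sup>2 = weight x powr (- (2 * (s1 - \<gamma>)))"
        using weight_pos[of x] by (simp add: powr_power mult_ac)
      finally show "norm (\<bar>u x\<bar> * weight x powr (s - s1) * weight x powr \<gamma>)
        \<le> norm ((weight x powr s * \<bar>u x\<bar>)\<^sup>2 + weight x powr (- (2 * (s1 - \<gamma>))))" by simp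
    qed
  qed measurable
  then show "integrable lborel (\<lambda>x. \<bar>u x\<bar> * weight x powr (s - s1) * weight x powr (min (min (s - s1) (s1 - 1 / 2)) 1 / 2))"
    by (simp only: \<gamma>_def)
  show "integrable lborel (\<lambda>x. (\<bar>u x\<bar> * weight x powr (s - s1))\<^sup>2)"
  proof (rule Bochner_Integration.integrable_bound[OF sq])
    have "\<bar>u x\<bar> * weight x powr (s - s1) \<le> weight x powr s * \<bar>u x\<bar>" for x
      using powr_mono[of "s - s1" s "weight x"] weight_ge_1[of x] assms(1,2)
      by (simp add: mult.commute mult_left_mono)
    then show "AE x in lborel. norm ((\<bar>u x\<bar> * weight x powr (s - s1))\<^sup>2) \<le> norm ((weight x powr s * \<bar>u x\<bar>)\<^sup>2)"
      by (intro AE_I2) (auto intro!: power_mono)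
  qed measurable
qed (use assms in \<open>auto simp: min_def\<close>)

section \<open>Translation between the Jost equations and the conjugated operator\<close>

context weighted_potential
begin

text \<open>The exponential in \<open>G_kernel \<sigma> l (x - y)\<close> factors into
  \<open>cnj (wave l x) * wave l y\<close>; the second factor conjugates \<open>m\<close> into
  \<open>n\<close>. Only y = x, where the integral defining \<open>G_tilde\<close> diverges, is
  excluded.\<close>

lemma convolution_eq_oper:
  assumes l: "l > 0" and u': "AE x in lborel. u' x = u x"
    and n: "wbound n B" "AE x in lborel. n x = wave l x * m x"
  shows "convolution (G_kernel \<sigma> l) (\<lambda>y. of_real (u' y) * m y) x = cnj (wave l x) * oper \<sigma> l n x"
proof -
  note [measurable] = wboundD(1)[OF n(1)] borel_measurable_kern[OF l]
  have "convolution (G_kernel \<sigma> l) (\<lambda>y. of_real (u' y) * m y) x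
      = (LINT y|lborel. cnj (wave l x) * (kern \<sigma> l (x - y) * (of_real (u y) * n y)))"
    unfolding convolution_def
  proof (rule lebesgue_integral_eq_lborel)
    show "AE y in lborel. G_kernel \<sigma> l (x - y) * (of_real (u' y) * m y) = cnj (wave l x) * (kern \<sigma> l (x - y) * (of_real (u y) * n y))"
      using u' n(2) AE_lborel_singleton[of x]
    proof eventually_elim
      case (elim y)
      have "exp (\<i> * of_real (l * (x - y))) = cnj (wave l x) * wave l y"
        unfolding cnj_wave unfolding wave_def exp_add[symmetric] by (simp add: algebra_simps)
      then show ?case using G_kernel_eq[OF l, of "x - y" \<sigma>] elim by (simp add: mult_ac)
    qed
  qed measurable
  then show ?thesis by (simp only: oper_def integral_mult_right_zero)
qed

lemma weighted_Linf_representative: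
  assumes "m \<in> weighted_Linf (- r)"
  obtains n B where "wbound n B" "AE x in lborel. n x = wave l x * m x"
proof -
  obtain C where m: "m \<in> borel_measurable lebesgue" and C: "AE x in lborel. weight x powr - r * norm (m x) \<le> C"
    using assms unfolding weighted_Linf_def AE_completion_iff by auto
  obtain g where g [measurable]: "g \<in> borel_measurable borel" and mg: "AE x in lborel. m x = g x"
    by (rule lebesgue_measurable_borel_representative[OF m])
  have "wbound (\<lambda>x. wave l x * g x) C"
    unfolding wbound_def
  proof
    show "AE x in lborel. norm (wave l x * g x) \<le> C * weight x powr r"
      using C mg
    proof eventually_elim
      case (elim x)
      then have "weight x powr - r * norm (g x) * weight x powr r \<le> C * weight x powr r"
        by (intro mult_right_mono) auto
      moreover have "weight x powr - r * norm (g x) * weight x powr r = norm (g x)"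
        using weight_pos[of x] by (simp add: powr_minus field_simps)
      ultimately show ?case by (simp add: norm_mult)
    qed
  qed measurable
  moreover have "AE x in lborel. wave l x * g x = wave l x * m x" using mg by eventually_elim simp
  ultimately show ?thesis by (rule that)
qed

lemma cnj_wave_cancel: "cnj (wave l x) * (wave l x * a) = a"
  unfolding cnj_wave unfolding wave_def mult.assoc[symmetric] exp_add[symmetric] by simp

lemma solution_of_jost_equation:
  assumes l: "l > 0" and u': "AE x in lborel. u' x = u x"
    and m: "solves_jost_equation r u' \<sigma> l h m"
  obtains n where "solution \<sigma> l (\<lambda>x. wave l x * h x) n" "AE x in lborel. n x = wave l x * m x"
proof -
  have mL: "m \<in> weighted_Linf (- r)"
    and eq: "AE x in lborel. m x = h x + convolution (G_kernel \<sigma> l) (\<lambda>y. of_real (u' y) * m y) x"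
    using m unfolding solves_jost_equation_def AE_completion_iff by auto
  obtain n B where n: "wbound n B" "AE x in lborel. n x = wave l x * m x"
    by (rule weighted_Linf_representative[OF mL])
  have "AE x in lborel. n x = wave l x * h x + oper \<sigma> l n x"
    using n(2) eq
  proof eventually_elim
    case (elim x)
    have "wave l x * (cnj (wave l x) * oper \<sigma> l n x) = oper \<sigma> l n x"
      using cnj_wave_cancel[of l x] by (simp add: mult.left_commute)
    then show ?case
      using elim unfolding convolution_eq_oper[OF l u' n] by (simp add: distrib_left)
  qed
  then show ?thesis using that n unfolding solution_def by blast
qed

text \<open>Conjugating a homogeneous solution \<open>k\<close> back and subtracting it from
  \<open>m\<close> gives another solution with the same source \<open>h\<close>; uniqueness makes it
  agree with \<open>m\<close>, so \<open>k\<close> vanishes. One source \<open>h\<close> with a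
  unique solution thus gives injectivity.\<close>

lemma regular_of_jost_solution:
  assumes l: "l > 0" and u': "AE x in lborel. u' x = u x"
    and m: "is_jost_solution r u' \<sigma> l h m"
  shows "regular \<sigma> l"
  unfolding regular_def
proof (intro allI impI)
  fix k assume "solution \<sigma> l (\<lambda>x. 0) k"
  then obtain K where k: "wbound k K" "AE x in lborel. k x = oper \<sigma> l k x" by (auto simp: solution_def)
  have mL: "m \<in> weighted_Linf (- r)"
    and eq: "AE x in lborel. m x = h x + convolution (G_kernel \<sigma> l) (\<lambda>y. of_real (u' y) * m y) x"
    and uniq: "\<And>m'. solves_jost_equation r u' \<sigma> l h m' \<Longrightarrow> AE x in lborel. m' x = m x"
    using m unfolding is_jost_solution_def solves_jost_equation_def AE_completion_iff by auto
  obtain n B where n: "wbound n B" "AE x in lborel. n x = wave l x * m x"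
    by (rule weighted_Linf_representative[OF mL])
  define m' where "m' x = m x - cnj (wave l x) * k x" for x
  have nk: "wbound (\<lambda>x. n x - k x) (B + K)" by (rule wbound_minus[OF n(1) k(1)])
  have nk': "AE x in lborel. n x - k x = wave l x * m' x"
    using n(2)
  proof eventually_elim
    case (elim x)
    have "wave l x * (cnj (wave l x) * k x) = k x" using cnj_wave_cancel[of l x] by (simp add: mult.left_commute)
    then show ?case using elim by (simp add: m'_def right_diff_distrib)
  qed
  have "solves_jost_equation r u' \<sigma> l h m'"
    unfolding solves_jost_equation_def AE_completion_iff
  proof
    show "AE x in lborel. m' x = h x + convolution (G_kernel \<sigma> l) (\<lambda>y. of_real (u' y) * m' y) x"
      using eq k(2)
    proof eventually_elim
      case (elim x)
      then show ?case
        unfolding convolution_eq_oper[OF l u' nk nk'] oper_minus[OF l n(1) k(1)]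
        using convolution_eq_oper[OF l u' n, of \<sigma> x] by (simp add: m'_def right_diff_distrib)
    qed
    have m'_eq: "AE x in lborel. m' x = cnj (wave l x) * (n x - k x)"
      using nk' by eventually_elim (simp add: cnj_wave_cancel)
    have [measurable]: "(\<lambda>x. cnj (wave l x)) \<in> borel_measurable borel" unfolding cnj_wave by measurable
    note [measurable] = wboundD(1)[OF nk]
    have "(\<lambda>x. cnj (wave l x) * (n x - k x)) \<in> borel_measurable lborel" by measurable
    then have "(\<lambda>x. cnj (wave l x) * (n x - k x)) \<in> borel_measurable lebesgue" by (rule measurable_completion)
    moreover have "AE x in lebesgue. cnj (wave l x) * (n x - k x) = m' x"
      using AE_completion[OF m'_eq] by eventually_elim simp
    ultimately have meas: "m' \<in> borel_measurable lebesgue" by (rule borel_measurable_AE)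
    have "AE x in lborel. weight x powr - r * norm (m' x) \<le> B + K"
      using m'_eq wboundD(2)[OF nk]
    proof eventually_elim
      case (elim x)
      then have "weight x powr - r * norm (m' x) \<le> weight x powr - r * ((B + K) * weight x powr r)"
        by (intro mult_left_mono) (auto simp: norm_mult)
      also have "\<dots> = B + K" using weight_pos[of x] by (simp add: powr_minus field_simps)
      finally show ?case .
    qed
    with meas show "m' \<in> weighted_Linf (- r)" unfolding weighted_Linf_def AE_completion_iff by blast
  qed
  from uniq[OF this] have "AE x in lborel. cnj (wave l x) * k x = 0"
    by eventually_elim (simp add: m'_def)
  then show "AE x in lborel. k x = 0"
    by eventually_elim (simp add: wave_def)
qed

end

theorem lemma4p4:
  fixes s s1 :: real and u :: "real \<Rightarrow> real"
    and m1 me :: "side \<Rightarrow> real \<Rightarrow> real \<Rightarrow> complex"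
  assumes "s > s1" and "s1 > 1 / 2"
    and "u \<in> weighted_L2 s"
    and "\<And>\<sigma> l. l > 0 \<Longrightarrow> is_jost_solution (s - s1) u \<sigma> l (\<lambda>x. 1) (m1 \<sigma> l)"
    and "\<And>\<sigma> l. l > 0 \<Longrightarrow>
           is_jost_solution (s - s1) u \<sigma> l (\<lambda>x. exp (\<i> * of_real (l * x))) (me \<sigma> l)"
  shows "(\<exists>\<gamma>. 0 < \<gamma> \<and> \<gamma> < 1 \<and>
            locally_C1_holder \<gamma> {0<..} (Gamma_coeff u me) \<and>
            locally_holder \<gamma> {0<..} (beta_coeff u m1) \<and>
            locally_holder \<gamma> {0<..} (f_coeff u me)) \<and>
         (\<forall>l>0.
            norm (Gamma_coeff u me l) = 1 \<and>
            f_coeff u me l = cnj (beta_coeff u m1 l) / (2 * of_real pi * \<i> * of_real l) \<and>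
            (norm (beta_coeff u m1 l))\<^sup>2 =
              2 * Im (LINT x|lebesgue. of_real (u x) * m1 Above l x) \<and>
            (Gamma_coeff u me has_vector_derivative
               of_real ((norm (beta_coeff u m1 l))\<^sup>2) / (2 * of_real pi * \<i> * of_real l)
                 * Gamma_coeff u me l) (at l))"
proof -
  define \<gamma> where "\<gamma> = min (min (s - s1) (s1 - 1 / 2)) 1 / 2"
  have uL: "u \<in> borel_measurable lebesgue" and uI: "integrable lebesgue (\<lambda>x. (weight x powr s * norm (u x))\<^sup>2)"
    using assms(3) by (auto simp: weighted_L2_def)
  \<comment> \<open>A Borel representative of \<open>u\<close>; replacing \<open>u\<close> by it
    changes none of the integrals and none of the equations.\<close>
  obtain v where v [measurable]: "v \<in> borel_measurable lborel" and uv: "AE x in lborel. u x = v x"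
    using completion_ex_borel_measurable_real[OF uL] by auto
  have [measurable]: "weight \<in> borel_measurable borel" unfolding weight_def by measurable
  have meas: "(\<lambda>x. (weight x powr s * \<bar>v x\<bar>)\<^sup>2) \<in> borel_measurable lborel" by measurable
  have "integrable lebesgue (\<lambda>x. (weight x powr s * \<bar>v x\<bar>)\<^sup>2)"
    by (rule integrable_cong_AE_imp[OF uI]) (use AE_completion[OF uv] measurable_completion[OF meas] in \<open>auto elim: eventually_mono\<close>)
  then have sq: "integrable lborel (\<lambda>x. (weight x powr s * \<bar>v x\<bar>)\<^sup>2)"
    using integrable_completion[OF meas] by simp
  interpret weighted_potential v "s - s1" \<gamma>
    unfolding \<gamma>_def by (rule weighted_potential_of_weighted_L2[OF assms(2,1) _ sq]) (use v in simp)
  have wave_e: "(\<lambda>x. wave l x * exp (\<i> * of_real (l * x))) = (\<lambda>x. 1)" for l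
    by (auto simp: wave_def exp_add[symmetric] mult.commute)
  \<comment> \<open>A choice of Borel representatives of the conjugated solutions. For
    \<open>l \<le> 0\<close> the value is unspecified; every later statement about it is restricted
    to \<open>l > 0\<close>.\<close>
  define n where "n \<sigma> l = (SOME n. solution \<sigma> l (\<lambda>x. 1) n \<and> (AE x in lborel. n x = wave l x * me \<sigma> l x))" for \<sigma> l
  have ex_n: "\<exists>n. solution \<sigma> l (\<lambda>x. 1) n \<and> (AE x in lborel. n x = wave l x * me \<sigma> l x)" if "l > 0" for \<sigma> l
    using solution_of_jost_equation[OF that uv conjunct1[OF assms(5)[OF that, unfolded is_jost_solution_def]]]
    unfolding wave_e by metis
  have n: "solution \<sigma> l (\<lambda>x. 1) (n \<sigma> l)" "AE x in lborel. n \<sigma> l x = wave l x * me \<sigma> l x" if "l > 0" for \<sigma> l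
    using someI_ex[OF ex_n[OF that], of \<sigma>, folded n_def] by blast+
  define p where "p \<sigma> l = (SOME p. solution \<sigma> l (wave l) p \<and> (AE x in lborel. p x = wave l x * m1 \<sigma> l x))" for \<sigma> l
  have ex_p: "\<exists>p. solution \<sigma> l (wave l) p \<and> (AE x in lborel. p x = wave l x * m1 \<sigma> l x)" if "l > 0" for \<sigma> l
    using solution_of_jost_equation[OF that uv conjunct1[OF assms(4)[OF that, unfolded is_jost_solution_def]]]
    unfolding mult_1_right by metis
  have p: "solution \<sigma> l (wave l) (p \<sigma> l)" "AE x in lborel. p \<sigma> l x = wave l x * m1 \<sigma> l x" if "l > 0" for \<sigma> l
    using someI_ex[OF ex_p[OF that], of \<sigma>, folded p_def] by blast+
  interpret jost_family v "s - s1" \<gamma> n p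
    by unfold_locales (use n(1) p(1) regular_of_jost_solution[OF _ uv assms(4)] in auto)
  have borel: "n \<sigma> l \<in> borel_measurable borel" "p \<sigma> l \<in> borel_measurable borel" if "l > 0" for \<sigma> l
    using wbound_ex[OF that] wboundD(1) by blast+
  have vb [measurable]: "v \<in> borel_measurable borel" using v by simp
  have cw [measurable]: "(\<lambda>x. cnj (wave l x)) \<in> borel_measurable borel" for l unfolding cnj_wave by measurable
  have wave_alt: "exp (- \<i> * of_real (l * x)) = wave l x" for l x by (simp add: wave_def mult.commute)
  have \<Gamma>_eq: "Gamma_coeff u me l = \<Gamma> l" if "l > 0" for l
  proof -
    note [measurable] = borel[OF that]
    have "(LINT x|lebesgue. of_real (u x) * me Above l x * exp (- \<i> * of_real (l * x))) = mass_n l"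
      unfolding mass_n_def wave_alt
    proof (rule lebesgue_integral_eq_lborel)
      show "AE x in lborel. of_real (u x) * me Above l x * wave l x = of_real (v x) * n Above l x"
        using uv n(2)[OF that, of Above] by eventually_elim simp
    qed measurable
    then show ?thesis by (simp only: Gamma_coeff_def \<Gamma>_def)
  qed
  have \<beta>_eq: "beta_coeff u m1 l = \<beta> l" if "l > 0" for l
  proof -
    note [measurable] = borel[OF that]
    have "(LINT x|lebesgue. of_real (u x) * m1 Above l x * exp (- \<i> * of_real (l * x))) = mass_p l"
      unfolding mass_p_def wave_alt
    proof (rule lebesgue_integral_eq_lborel)
      show "AE x in lborel. of_real (u x) * m1 Above l x * wave l x = of_real (v x) * p Above l x"
        using uv p(2)[OF that, of Above] by eventually_elim simp
    qed measurable
    then show ?thesis by (simp only: beta_coeff_def \<beta>_def)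
  qed
  have f_eq: "f_coeff u me l = cnj (\<beta> l) / (2 * of_real pi * \<i> * of_real l)" if "l > 0" for l
  proof -
    note [measurable] = borel[OF that]
    have "(LINT x|lebesgue. of_real (u x) * me Below l x) = mass_e l"
      unfolding mass_e_def
    proof (rule lebesgue_integral_eq_lborel)
      show "AE x in lborel. of_real (u x) * me Below l x = of_real (v x) * n Below l x * cnj (wave l x)"
        using uv n(2)[OF that, of Below]
        by eventually_elim (use cnj_wave_cancel[of l] in \<open>simp add: mult_ac\<close>)
    qed measurable
    then show ?thesis
      using mass_p_eq[OF that] that by (simp add: f_coeff_def \<beta>_def field_simps)
  qed
  have m1_eq: "(LINT x|lebesgue. of_real (u x) * m1 Above l x) = mass_1 l" if "l > 0" for l
  proof -
    note [measurable] = borel[OF that]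
    show ?thesis
      unfolding mass_1_def
    proof (rule lebesgue_integral_eq_lborel)
      show "AE x in lborel. of_real (u x) * m1 Above l x = of_real (v x) * p Above l x * cnj (wave l x)"
        using uv p(2)[OF that, of Above]
        by eventually_elim (use cnj_wave_cancel[of l] in \<open>simp add: mult_ac\<close>)
    qed measurable
  qed
  \<comment> \<open>\<open>Gamma_coeff u me\<close> and \<open>\<Gamma>\<close> are known to agree
    for positive parameters only; that set is open, so the derivative carries over.\<close>
  have deriv: "(Gamma_coeff u me has_vector_derivative
      of_real ((norm (\<beta> l))\<^sup>2) / (2 * of_real pi * \<i> * of_real l) * \<Gamma> l) (at l)" if "l > 0" for l
    by (rule has_vector_derivative_transform_within_open[OF \<Gamma>_has_derivative[OF that], of "{0<..}"])
      (use that \<Gamma>_eq in auto)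
  have holder_cong: "locally_holder \<gamma> {0<..} f" if "locally_holder \<gamma> {0<..} g" "\<And>l. l > 0 \<Longrightarrow> f l = g l" for f g
    using that unfolding locally_holder_def by (metis greaterThan_iff subsetD)
  have inv: "locally_holder \<gamma> {0<..} (\<lambda>l. 1 / (2 * of_real pi * \<i>) / of_real l)"
    by (rule locally_holder_inverse[OF \<gamma>_pos less_imp_le[OF \<gamma>_less]])
  note cnj_\<beta> = locally_holder_cnj[OF locally_holder_\<beta>]
  \<comment> \<open>The differential equation supplies the regularity of the derivative: its
    right-hand side is a product of locally Hoelder functions.\<close>
  have "locally_holder \<gamma> {0<..} (\<lambda>l. (\<beta> l * cnj (\<beta> l)) * (1 / (2 * of_real pi * \<i>) / of_real l) * \<Gamma> l)"
    by (intro locally_holder_mult locally_holder_\<beta> cnj_\<beta> inv locally_holder_\<Gamma> \<gamma>_pos)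
  then have "locally_holder \<gamma> {0<..} (\<lambda>l. of_real ((norm (\<beta> l))\<^sup>2) / (2 * of_real pi * \<i> * of_real l) * \<Gamma> l)"
    by (rule holder_cong) (simp only: complex_norm_square, simp)
  then have C1: "locally_C1_holder \<gamma> {0<..} (Gamma_coeff u me)"
    unfolding locally_C1_holder_def using deriv by (intro exI conjI) auto
  have f_holder: "locally_holder \<gamma> {0<..} (f_coeff u me)"
    by (rule holder_cong[OF locally_holder_mult[OF cnj_\<beta> inv \<gamma>_pos]]) (simp add: f_eq)
  have \<beta>_holder: "locally_holder \<gamma> {0<..} (beta_coeff u m1)"
    by (rule holder_cong[OF locally_holder_\<beta> \<beta>_eq])
  show ?thesis
    using \<gamma>_pos \<gamma>_less C1 f_holder \<beta>_holder \<Gamma>_unimodular norm_\<beta>_square deriv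
    by (auto simp: \<Gamma>_eq \<beta>_eq f_eq m1_eq)
qed

end
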